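(* Let $W\in\mathbb{Z}^{m\times(n_2+\bar n_2)}$, let $(q,T)$ be a random pair where $q$ takes values in $\Xi^q\subseteq\mathbb{R}^{n_2+\bar n_2}$ and $T$ is a random $m\times n_1$ matrix, and let $\alpha\in\mathbb{R}^m$. Assume that $-\infty<v^{q'}(s)<+\infty$ for all $q'\in\Xi^q$ and $s\in\mathbb{R}^m$, and that $\mathbb{E}[\|q\|_1]<+\infty$. Then there exist constants $C_1,C_2>0$ such that for every $f\in\mathcal{H}^m$ the following holds. If $h$ is a random vector in $\mathbb{R}^m$ with joint probability density function $f$, independent of $(q,T)$, with $\mathbb{E}[\|h\|_1]<+\infty$, then $$\|Q-\hat Q\|_\infty\le C_1\cdot\mathbb{E}\big[\|q\|_1\big]\sum_{i=1}^m\mathbb{E}\big[|\Delta|f_i(\cdot|h_{-i})\big]$$ and $$\|Q-\tilde Q_\alpha\|_\infty\le C_2\cdot\mathbb{E}\big[\|q\|_1\big]\sum_{i=1}^m\mathbb{E}\big[|\Delta|f_i(\cdot|h_{-i})\big].$$ Here $Q(x)=\mathbb{E}[v^q(h-Tx)]$, $\hat Q(x)=\mathbb{E}[\hat v^q(h-Tx)]$, $\tilde Q_\alpha(x)=\mathbb{E}[\tilde v^q_\alpha(h,Tx)]$ for $x\in\mathbb{R}^{n_1}$ (expectation over $(q,T,h)$, taken to be finite), and $\|Q-\tilde Q\|_\infty:=\sup_{x\in\mathbb{R}^{n_1}}|Q(x)-\tilde Q(x)|$ for $\tilde Q\in\{\hat Q,\tilde Q_\alpha\}$.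
   Context: Value function: $Y:=\mathbb{Z}_+^{n_2}\times\mathbb{R}_+^{\bar n_2}$ and $v^q(s):=\min_{y\in Y}\{q^\top y\mid Wy=s\}$, $s\in\mathbb{R}^m$. Bases: enumerate by $k$ the finitely many invertible $m\times m$ submatrices $B^k$ of $W$ formed by $m$ columns of $W$ (basis matrices); $N^k$ is the matrix of the remaining columns of $W$, and $q_{B^k},q_{N^k}$ (resp. $y_{B^k},y_{N^k}$) are the corresponding subvectors of $q$ (resp. $y$). Let $(\lambda^q_k)^\top:=q_{B^k}^\top(B^k)^{-1}$. $K^q$ is the set of indices $k$ for which $B^k$ is dual feasible for $q$, i.e. $(\lambda^q_k)^\top W\le q^\top$. Periodic functions: for $k\in K^q$, the Gomory relaxation $v^q_{B^k}(s)$ is the optimal value of the problem defining $v^q(s)$ after dropping the nonnegativity constraints on the basic variables $y_{B^k}$ only (integrality of the first $n_2$ variables, including basic ones, and nonnegativity of $y_{N^k}$ are kept). Define $\psi^q_k(s):=v^q_{B^k}(s)-(\lambda^q_k)^\top s$. It is $B^k$-periodic, i.e. $\psi^q_k(s)=\psi^q_k(s+B^k\ell)$ for all $s\in\mathbb{R}^m$, $\ell\in\mathbb{Z}^m$; hence it is also $p_kI_m$-periodic with $p_k:=|\det B^k|$. Its mean value is $\Gamma^q_k:=p_k^{-m}\int_0^{p_k}\cdots\int_0^{p_k}\psi^q_k(s)\,ds_1\cdots ds_m$. Shifted LP-relaxation approximation: $\hat v^q(s):=\max_{k\in K^q}\{(\lambda^q_k)^\top s+\Gamma^q_k\}$, $s\in\mathbb{R}^m$.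 $\alpha$-approximation: $\tilde v^q_\alpha(h,Tx):=\max_{k\in K^q}\{(\lambda^q_k)^\top(h-Tx)+\psi^q_k(h-\alpha)\}$. Total variation: for $g:\mathbb{R}\to\mathbb{R}$, $|\Delta|g:=\sup\sum_{i=1}^N|g(z_{i+1})-g(z_i)|$, the supremum over all finite ordered sets $z_1<\dots<z_{N+1}$ in $\mathbb{R}$; $g$ is of bounded variation if $|\Delta|g<+\infty$. Densities: for a joint pdf $f$ on $\mathbb{R}^m$ and $t_{-i}\in\mathbb{R}^{m-1}$ (the vector $t$ without its $i$th component), $f_i(\cdot|t_{-i})$ is the one-dimensional conditional density of the $i$th component given the other components, $f_i(t_i|t_{-i})=f(t)/f_{-i}(t_{-i})$ with $f_{-i}$ the marginal density (set to the zero function where $f_{-i}(t_{-i})\in\{0,\infty\}$). $\mathcal{H}^m$ is the set of all $m$-dimensional joint pdfs $f$ such that $f_i(\cdot|t_{-i})$ is of bounded variation for all $t_{-i}\in\mathbb{R}^{m-1}$, $i=1,\dots,m$. The expectation $\mathbb{E}[|\Delta|f_i(\cdot|h_{-i})]$ is over $h_{-i}$ and takes values in $[0,+\infty]$. *)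

theory Defs
  imports "HOL-Probability.Probability"
begin

definition norm1 :: "real^'a \<Rightarrow> real" where
  "norm1 x = (\<Sum>i\<in>UNIV. \<bar>x $ i\<bar>)"

section \<open>Mixed-integer value function\<close>

text \<open>
  The variables are indexed by a finite type; \<open>I\<close> is the set of indices of the integer variables
  and its complement that of the continuous ones.  Thus \<open>I = {}\<close> is the purely continuous and
  \<open>I = UNIV\<close> the purely integer case.
\<close>

definition Y :: "'n::finite set \<Rightarrow> (real^'n) set" where
  "Y I = {y. (\<forall>j\<in>I. y $ j \<in> \<int>) \<and> (\<forall>j. 0 \<le> y $ j)}"

text \<open>The optimal value is \<open>\<infinity>\<close> for an infeasible and \<open>-\<infinity>\<close> for an unbounded problem.\<close>

definition value_function ::
    "'n::finite set \<Rightarrow> real^'n^'m \<Rightarrow> real^'n \<Rightarrow> real^'m \<Rightarrow> ereal" where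
  "value_function I W q s = (INF y\<in>{y\<in>Y I. W *v y = s}. ereal (q \<bullet> y))"

section \<open>Bases and Gomory relaxations\<close>

text \<open>
  A basis is given by the function \<open>b\<close> that lists its \<open>m\<close> columns; invertibility of the
  resulting matrix forces \<open>b\<close> to be injective.  Listing the same columns in a different order
  changes neither the vector \<open>lam\<close>, nor \<open>dual_feasible\<close>, nor \<open>psi\<close> and \<open>Gam\<close>,
  so the maxima over \<open>dual_feasible\<close> below are unaffected by this repetition.
\<close>

definition basis_matrix :: "real^'n^'m \<Rightarrow> ('m \<Rightarrow> 'n) \<Rightarrow> real^'m^'m" where
  "basis_matrix W b = (\<chi> i j. W $ i $ b j)"

definition lam :: "real^'n::finite^'m::finite \<Rightarrow> real^'n \<Rightarrow> ('m \<Rightarrow> 'n) \<Rightarrow> real^'m" where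
  "lam W q b = (\<chi> j. q $ b j) v* matrix_inv (basis_matrix W b)"

definition dual_feasible ::
    "real^'n::finite^'m::finite \<Rightarrow> real^'n \<Rightarrow> ('m \<Rightarrow> 'n) set" where
  "dual_feasible W q =
     {b. invertible (basis_matrix W b) \<and> (\<forall>j. (lam W q b v* W) $ j \<le> q $ j)}"

definition gomory_value ::
    "'n::finite set \<Rightarrow> real^'n^'m \<Rightarrow> real^'n \<Rightarrow> ('m \<Rightarrow> 'n) \<Rightarrow> real^'m \<Rightarrow> ereal" where
  "gomory_value I W q b s =
     (INF y\<in>{y. (\<forall>j\<in>I. y $ j \<in> \<int>) \<and> (\<forall>j. j \<notin> range b \<longrightarrow> 0 \<le> y $ j) \<and> W *v y = s}.
        ereal (q \<bullet> y))"

definition psi ::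
    "'n::finite set \<Rightarrow> real^'n^'m::finite \<Rightarrow> real^'n \<Rightarrow> ('m \<Rightarrow> 'n) \<Rightarrow> real^'m \<Rightarrow> real" where
  "psi I W q b s = real_of_ereal (gomory_value I W q b s) - lam W q b \<bullet> s"

definition period :: "real^'n^'m::finite \<Rightarrow> ('m \<Rightarrow> 'n) \<Rightarrow> real" where
  "period W b = \<bar>det (basis_matrix W b)\<bar>"

definition Gam ::
    "'n::finite set \<Rightarrow> real^'n^'m::finite \<Rightarrow> real^'n \<Rightarrow> ('m \<Rightarrow> 'n) \<Rightarrow> real" where
  "Gam I W q b =
     (LINT s : cbox 0 (\<chi> i. period W b) | lborel. psi I W q b s) / period W b ^ CARD('m)"

section \<open>Convex approximations\<close>

definition v_hat ::
    "'n::finite set \<Rightarrow> real^'n^'m::finite \<Rightarrow> real^'n \<Rightarrow> real^'m \<Rightarrow> real" where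
  "v_hat I W q s = Max ((\<lambda>b. lam W q b \<bullet> s + Gam I W q b) ` dual_feasible W q)"

text \<open>The last argument \<open>t\<close> stands for the vector \<open>T x\<close>.\<close>

definition v_alpha ::
    "'n::finite set \<Rightarrow> real^'n^'m::finite \<Rightarrow> real^'m \<Rightarrow> real^'n \<Rightarrow> real^'m \<Rightarrow> real^'m \<Rightarrow> real" where
  "v_alpha I W \<alpha> q h t =
     Max ((\<lambda>b. lam W q b \<bullet> (h - t) + psi I W q b (h - \<alpha>)) ` dual_feasible W q)"

section \<open>Total variation and conditional densities\<close>

definition total_variation :: "(real \<Rightarrow> real) \<Rightarrow> ennreal" where
  "total_variation g =
     (SUP (N, z) \<in> {(N::nat, z::nat \<Rightarrow> real). 1 \<le> N \<and> strict_mono_on {1..N+1} z}.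
        ennreal (\<Sum>i=1..N. \<bar>g (z (i+1)) - g (z i)\<bar>))"

definition bounded_variation :: "(real \<Rightarrow> real) \<Rightarrow> bool" where
  "bounded_variation g \<longleftrightarrow> total_variation g < \<infinity>"

definition replace :: "'m \<Rightarrow> real^'m \<Rightarrow> real \<Rightarrow> real^'m" where
  "replace i t u = (\<chi> j. if j = i then u else t $ j)"

text \<open>
  A vector with its \<open>i\<close>th component removed is represented by a full vector \<open>t\<close> whose
  \<open>i\<close>th component is ignored: neither of the next two functions depends on \<open>t $ i\<close>.
\<close>

definition marginal :: "(real^'m \<Rightarrow> real) \<Rightarrow> 'm \<Rightarrow> real^'m \<Rightarrow> ennreal" where
  "marginal f i t = (\<integral>\<^sup>+ u. ennreal (f (replace i t u)) \<partial>lborel)"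

definition cond_density :: "(real^'m \<Rightarrow> real) \<Rightarrow> 'm \<Rightarrow> real^'m \<Rightarrow> real \<Rightarrow> real" where
  "cond_density f i t u =
     (if marginal f i t \<in> {0, \<infinity>} then 0
      else f (replace i t u) / enn2real (marginal f i t))"

definition joint_pdf :: "(real^'m::finite \<Rightarrow> real) \<Rightarrow> bool" where
  "joint_pdf f \<longleftrightarrow>
     f \<in> borel_measurable borel \<and> (\<forall>t. 0 \<le> f t) \<and> (\<integral>\<^sup>+ t. ennreal (f t) \<partial>lborel) = 1"

definition \<H> :: "(real^'m::finite \<Rightarrow> real) set" where
  "\<H> = {f. joint_pdf f \<and> (\<forall>i t. bounded_variation (cond_density f i t))}"

section \<open>Independence\<close>

text \<open>
  The library's \<open>indep_var\<close> requires both variables to have the same value type; this is its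
  characterization \<open>indep_var_eq\<close> without that restriction.
\<close>

definition independent ::
    "'w measure \<Rightarrow> ('w \<Rightarrow> 'a::topological_space) \<Rightarrow> ('w \<Rightarrow> 'b::topological_space) \<Rightarrow> bool" where
  "independent M X Z \<longleftrightarrow>
     X \<in> borel_measurable M \<and> Z \<in> borel_measurable M \<and>
     prob_space.indep_set M {X -` A \<inter> space M | A. A \<in> sets borel}
                            {Z -` A \<inter> space M | A. A \<in> sets borel}"

section \<open>Expected value functions and their distance\<close>

definition Q ::
    "'w measure \<Rightarrow> 'n::finite set \<Rightarrow> real^'n^'m \<Rightarrow> ('w \<Rightarrow> real^'n) \<Rightarrow> ('w \<Rightarrow> real^'k^'m) \<Rightarrow>
     ('w \<Rightarrow> real^'m) \<Rightarrow> real^'k \<Rightarrow> real" where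
  "Q M I W q T h x = (LINT \<omega>|M. real_of_ereal (value_function I W (q \<omega>) (h \<omega> - T \<omega> *v x)))"

definition Q_hat ::
    "'w measure \<Rightarrow> 'n::finite set \<Rightarrow> real^'n^'m::finite \<Rightarrow> ('w \<Rightarrow> real^'n) \<Rightarrow>
     ('w \<Rightarrow> real^'k^'m) \<Rightarrow> ('w \<Rightarrow> real^'m) \<Rightarrow> real^'k \<Rightarrow> real" where
  "Q_hat M I W q T h x = (LINT \<omega>|M. v_hat I W (q \<omega>) (h \<omega> - T \<omega> *v x))"

definition Q_alpha ::
    "'w measure \<Rightarrow> 'n::finite set \<Rightarrow> real^'n^'m::finite \<Rightarrow> real^'m \<Rightarrow> ('w \<Rightarrow> real^'n) \<Rightarrow>
     ('w \<Rightarrow> real^'k^'m) \<Rightarrow> ('w \<Rightarrow> real^'m) \<Rightarrow> real^'k \<Rightarrow> real" where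
  "Q_alpha M I W \<alpha> q T h x = (LINT \<omega>|M. v_alpha I W \<alpha> (q \<omega>) (h \<omega>) (T \<omega> *v x))"

text \<open>
  A Bochner integral of a non-integrable function is 0, so that these three expectations being
  finite has to be stated separately.
\<close>

definition finite_expectations ::
    "'w measure \<Rightarrow> 'n::finite set \<Rightarrow> real^'n^'m::finite \<Rightarrow> real^'m \<Rightarrow> ('w \<Rightarrow> real^'n) \<Rightarrow>
     ('w \<Rightarrow> real^'k^'m) \<Rightarrow> ('w \<Rightarrow> real^'m) \<Rightarrow> bool" where
  "finite_expectations M I W \<alpha> q T h \<longleftrightarrow>
     (\<forall>x. integrable M (\<lambda>\<omega>. real_of_ereal (value_function I W (q \<omega>) (h \<omega> - T \<omega> *v x))) \<and>
          integrable M (\<lambda>\<omega>. v_hat I W (q \<omega>) (h \<omega> - T \<omega> *v x)) \<and>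
          integrable M (\<lambda>\<omega>. v_alpha I W \<alpha> (q \<omega>) (h \<omega>) (T \<omega> *v x)))"

definition sup_dist :: "('x \<Rightarrow> real) \<Rightarrow> ('x \<Rightarrow> real) \<Rightarrow> ennreal" where
  "sup_dist F G = (SUP x. ennreal \<bar>F x - G x\<bar>)"

text \<open>
  The integral is the one of nonnegative extended functions.  It needs no measurability assumption:
  for a function that is measurable only with respect to the completion (which is what a supremum
  over uncountably many partitions yields) it coincides with the integral over the completion.
\<close>

definition expected_variation ::
    "'w measure \<Rightarrow> (real^'m \<Rightarrow> real) \<Rightarrow> ('w \<Rightarrow> real^'m) \<Rightarrow> 'm \<Rightarrow> ennreal" where
  "expected_variation M f h i = (\<integral>\<^sup>+ \<omega>. total_variation (cond_density f i (h \<omega>)) \<partial>M)"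

end

theory Submission
  imports Defs
begin

text \<open>
  Let \<open>P\<close> be a common multiple of all the determinants of bases.  Deep inside the cone spanned by a
  dual feasible basis \<open>b\<close> the value function coincides with the Gomory relaxation of \<open>b\<close>, and both
  maxima are attained at \<open>b\<close>; the required depth depends on \<open>W\<close> only, because subtracting
  multiples of \<open>period W b\<close> bounds the nonbasic variables without increasing the cost.  There the
  errors are \<open>psi - Gam\<close> and the difference of two translates of \<open>psi\<close>, hence \<open>P\<close>-periodic with mean
  zero.  The cones cover the space, so that the remaining right-hand sides lie in finitely many slabs, where the
  errors are still at most a multiple of \<open>norm1 q\<close>.  Replace the density by its average over all shifts from a cube
  of side \<open>P\<close>: in \<open>L\<^sup>1\<close> this costs at most \<open>P\<close> times the total variation, and it averages the
  error to zero outside the slabs.  The probability of a slab is also bounded by the total variation, since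
  a one-dimensional density is dominated by its variation.
\<close>

section \<open>Total variation along coordinate axes\<close>

text \<open>The obstacle is uniformity in \<open>q\<close>. That the basis with the larger slope
  wins far enough out would only give a depth that explodes as a reduced cost tends to 0. But the
  lead of \<open>lam W q k\<close> over \<open>lam W q l\<close> at s is the sum of the coordinates
  of s in the basis \<open>k\<close>, weighted by the numbers \<open>red_cost W q l $ k i\<close>,
  and the offset of \<open>l\<close> exceeds that of \<open>k\<close> by at most a constant times
  the sum of the same numbers. Both sides scale alike, so a depth that depends on \<open>W\<close>
  alone suffices. The remaining estimates are linear in \<open>q\<close> for each of finitely many
  bases, whence the factor \<open>norm1 q\<close>. Both approximations are maxima of
  \<open>lam W q b \<bullet> s + c b\<close> with \<open>c b\<close> between 0 and
  \<open>period W b\<close> times the total reduced cost, so that one error bound serves both. The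
  probability of a slab is bounded wherever the slab is centred. The vector \<open>T x\<close> only
  translates the slabs, and so the supremum over x costs nothing; independence reduces the claim to
  fixed values of \<open>q\<close> and \<open>T\<close>.\<close>

text \<open>Tonelli for Lebesgue times counting measure, with translation invariance in every term.
  If the translates of \<open>S\<close> tile the space, the inner factor on the left is 1 and the
  integral of \<open>F\<close> is folded onto the fundamental domain \<open>S\<close>. Used for the
  multiples of a step on the line and for cubes over a lattice.\<close>

lemma nn_integral_unfold:
  fixes F :: "'a::euclidean_space \<Rightarrow> ennreal" and \<tau> :: "'j::countable \<Rightarrow> 'a"
  assumes [measurable]: "F \<in> borel_measurable borel" "S \<in> sets borel"
  shows "(\<integral>\<^sup>+x. F x * (\<integral>\<^sup>+j. indicator S (x - \<tau> j) \<partial>count_space UNIV) \<partial>lborel)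
       = (\<integral>\<^sup>+x. indicator S x * (\<integral>\<^sup>+j. F (x + \<tau> j) \<partial>count_space UNIV) \<partial>lborel)"
proof -
  interpret pair_sigma_finite lborel "count_space (UNIV :: 'j set)"
    by (intro pair_sigma_finite.intro lborel.sigma_finite_measure_axioms
        sigma_finite_measure_count_space_countable) auto
  have 1: "(\<lambda>z. F (fst z) * indicator S (fst z - \<tau> (snd z))) \<in> borel_measurable (lborel \<Otimes>\<^sub>M count_space (UNIV :: 'j set))"
    by measurable
  have 2: "(\<lambda>z. indicator S (fst z) * F (fst z + \<tau> (snd z))) \<in> borel_measurable (lborel \<Otimes>\<^sub>M count_space (UNIV :: 'j set))"
    by measurable
  have "(\<integral>\<^sup>+x. F x * (\<integral>\<^sup>+j. indicator S (x - \<tau> j) \<partial>count_space UNIV) \<partial>lborel)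
      = (\<integral>\<^sup>+x. (\<integral>\<^sup>+j. F x * indicator S (x - \<tau> j) \<partial>count_space UNIV) \<partial>lborel)"
    by (simp add: nn_integral_cmult)
  also have "\<dots> = (\<integral>\<^sup>+j. (\<integral>\<^sup>+x. F x * indicator S (x - \<tau> j) \<partial>lborel) \<partial>count_space UNIV)"
    using Fubini[OF 1] by simp
  also have "\<dots> = (\<integral>\<^sup>+j. (\<integral>\<^sup>+x. indicator S x * F (x + \<tau> j) \<partial>lborel) \<partial>count_space UNIV)"
  proof (rule nn_integral_cong)
    fix j
    have "(\<integral>\<^sup>+x. F x * indicator S (x - \<tau> j) \<partial>lborel)
        = (\<integral>\<^sup>+x. F x * indicator S (x - \<tau> j) \<partial>distr lborel borel ((+) (\<tau> j)))"
      by (simp add: lborel_distr_plus)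
    also have "\<dots> = (\<integral>\<^sup>+x. indicator S x * F (x + \<tau> j) \<partial>lborel)"
      by (subst nn_integral_distr) (auto simp: mult.commute add.commute)
    finally show "(\<integral>\<^sup>+x. F x * indicator S (x - \<tau> j) \<partial>lborel) = (\<integral>\<^sup>+x. indicator S x * F (x + \<tau> j) \<partial>lborel)" .
  qed
  also have "\<dots> = (\<integral>\<^sup>+x. (\<integral>\<^sup>+j. indicator S x * F (x + \<tau> j) \<partial>count_space UNIV) \<partial>lborel)"
    using Fubini[OF 2] by simp
  also have "\<dots> = (\<integral>\<^sup>+x. indicator S x * (\<integral>\<^sup>+j. F (x + \<tau> j) \<partial>count_space UNIV) \<partial>lborel)"
    by (simp add: nn_integral_cmult)
  finally show ?thesis .
qed

lemma total_variation_ge: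
  fixes N :: nat and z :: "nat \<Rightarrow> real"
  assumes "1 \<le> N" "strict_mono_on {1..N+1} z"
  shows "ennreal (\<Sum>i=1..N. \<bar>g (z (i+1)) - g (z i)\<bar>) \<le> total_variation g"
  unfolding total_variation_def using assms by (intro SUP_upper2[where i = "(N,z)"]) auto

lemma total_variation_ge_diff: "ennreal \<bar>g y - g x\<bar> \<le> total_variation g"
proof -
  have *: "ennreal \<bar>g y - g x\<bar> \<le> total_variation g" if "x < y" for x y
  proof -
    have "strict_mono_on {1..1+1} (\<lambda>i::nat. if i = 1 then x else y)"
      using that by (auto simp: strict_mono_on_def)
    from total_variation_ge[OF _ this] show ?thesis by simp
  qed
  show ?thesis
    using *[of x y] *[of y x] by (cases x y rule: linorder_cases) (auto simp: abs_minus_commute)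
qed

lemma total_variation_cmult:
  assumes "0 \<le> c"
  shows "total_variation (\<lambda>x. c * g x) = ennreal c * total_variation g"
proof -
  have "total_variation (\<lambda>x. c * g x) = (SUP (N, z) \<in> {(N::nat, z::nat \<Rightarrow> real). 1 \<le> N \<and> strict_mono_on {1..N+1} z}.
        ennreal c * ennreal (\<Sum>i=1..N. \<bar>g (z (i+1)) - g (z i)\<bar>))"
    unfolding total_variation_def using assms
    by (intro SUP_cong refl) (auto simp: ennreal_mult'[symmetric] sum_distrib_left right_diff_distrib[symmetric] abs_mult)
  then show ?thesis
    by (simp add: total_variation_def SUP_mult_left_ennreal case_prod_unfold)
qed

text \<open>Folding onto [0, u) leaves, for each x, the sum of the increments of \<open>g\<close>
  between consecutive points \<open>x + j * u\<close>, which is at most the variation; the length of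
  [0, u) gives the factor \<open>u\<close>.\<close>

lemma nn_integral_shift_le_total_variation_pos:
  fixes g :: "real \<Rightarrow> real"
  assumes [measurable]: "g \<in> borel_measurable borel" and u: "0 < u"
  shows "(\<integral>\<^sup>+x. ennreal \<bar>g (x + u) - g x\<bar> \<partial>lborel) \<le> ennreal u * total_variation g"
proof -
  let ?F = "\<lambda>x. ennreal \<bar>g (x + u) - g x\<bar>"
  let ?\<tau> = "\<lambda>j::int. of_int j * u"
  have one: "(\<integral>\<^sup>+j. indicator {0..<u} (x - ?\<tau> j) \<partial>count_space UNIV) = (1::ennreal)" for x
  proof -
    have "(indicator {0..<u} (x - ?\<tau> j) :: ennreal) = indicator {\<lfloor>x / u\<rfloor>} j" for j
    proof -
      have "x - ?\<tau> j \<in> {0..<u} \<longleftrightarrow> of_int j \<le> x / u \<and> x / u < of_int j + 1"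
        using u by (auto simp: field_simps)
      also have "\<dots> \<longleftrightarrow> j = \<lfloor>x / u\<rfloor>" using floor_unique[of j "x / u"] by (auto simp: of_int_floor_le floor_less_iff intro: real_of_int_floor_add_one_gt)
      finally show ?thesis by (auto simp: indicator_def)
    qed
    then show ?thesis by (simp add: one_ennreal_def)
  qed
  \<comment> \<open>\<open>total_variation\<close> admits finite partitions only, so the sum over
    all integers is written as a supremum over the windows from -N to N - 1.\<close>
  have bound: "(\<integral>\<^sup>+j. ?F (x + ?\<tau> j) \<partial>count_space UNIV) \<le> total_variation g" for x
  proof -
    have "(\<integral>\<^sup>+j. ?F (x + ?\<tau> j) \<partial>count_space UNIV)
        = (\<integral>\<^sup>+j. (SUP N. ?F (x + ?\<tau> j) * indicator {- int N ..< int N} j) \<partial>count_space UNIV)"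
    proof (rule nn_integral_cong)
      fix j :: int
      have "?F (x + ?\<tau> j) * indicator {- int N ..< int N} j \<le> ?F (x + ?\<tau> j)" for N
        by (auto simp: indicator_def)
      moreover have "?F (x + ?\<tau> j) * indicator {- int (nat (\<bar>j\<bar> + 1)) ..< int (nat (\<bar>j\<bar> + 1))} j = ?F (x + ?\<tau> j)"
        by (auto simp: indicator_def)
      ultimately show "?F (x + ?\<tau> j) = (SUP N. ?F (x + ?\<tau> j) * indicator {- int N ..< int N} j)"
        by (intro antisym SUP_upper2[of "nat (\<bar>j\<bar> + 1)"] SUP_least) auto
    qed
    also have "\<dots> = (SUP N. \<integral>\<^sup>+j. ?F (x + ?\<tau> j) * indicator {- int N ..< int N} j \<partial>count_space UNIV)"
      by (intro nn_integral_monotone_convergence_SUP incseq_SucI le_funI mult_left_mono) (auto simp: indicator_def)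
    also have "\<dots> \<le> total_variation g"
    proof (rule SUP_least)
      fix N :: nat
      have "(\<integral>\<^sup>+j. ?F (x + ?\<tau> j) * indicator {- int N ..< int N} j \<partial>count_space UNIV)
          = (\<Sum>j\<in>{- int N ..< int N}. ?F (x + ?\<tau> j))"
        by (subst nn_integral_count_space'[of "{- int N ..< int N}"]) (auto simp: indicator_def)
      \<comment> \<open>Partition points are numbered from 1: \<open>i\<close> stands for
        \<open>j = i - 1 - N\<close>, which gives 2 N increments and 2 N + 1 points. The empty
        window N = 0 is not a partition and is split off below.\<close>
      also have "\<dots> = (\<Sum>i=1..2*N. ?F (x + ?\<tau> (int i - 1 - int N)))"
        by (rule sum.reindex_bij_witness[of _ "\<lambda>i. int i - 1 - int N" "\<lambda>j. nat (j + 1 + int N)"]) auto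
      also have "\<dots> = ennreal (\<Sum>i=1..2*N. \<bar>g (x + ?\<tau> (int (i + 1) - 1 - int N)) - g (x + ?\<tau> (int i - 1 - int N))\<bar>)"
        by (subst sum_ennreal[symmetric]) (auto intro!: sum.cong arg_cong[where f=ennreal] simp: algebra_simps)
      also have "\<dots> \<le> total_variation g"
      proof (cases "N = 0")
        case False
        then show ?thesis
          using u by (intro total_variation_ge[of "2*N" "\<lambda>i. x + ?\<tau> (int i - 1 - int N)"])
             (auto simp: strict_mono_on_def)
      qed auto
      finally show "(\<integral>\<^sup>+j. ?F (x + ?\<tau> j) * indicator {- int N ..< int N} j \<partial>count_space UNIV) \<le> total_variation g" .
    qed
    finally show ?thesis .
  qed
  have "(\<integral>\<^sup>+x. ?F x \<partial>lborel) = (\<integral>\<^sup>+x. ?F x * (\<integral>\<^sup>+j. indicator {0..<u} (x - ?\<tau> j) \<partial>count_space UNIV) \<partial>lborel)"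
    by (simp only: one mult_1_right)
  also have "\<dots> = (\<integral>\<^sup>+x. indicator {0..<u} x * (\<integral>\<^sup>+j. ?F (x + ?\<tau> j) \<partial>count_space UNIV) \<partial>lborel)"
    by (rule nn_integral_unfold) auto
  also have "\<dots> \<le> (\<integral>\<^sup>+x. total_variation g * indicator {0..<u} x \<partial>lborel)"
    using bound by (intro nn_integral_mono) (auto simp: indicator_def)
  also have "\<dots> = ennreal u * total_variation g"
    using u by (simp add: nn_integral_cmult_indicator mult.commute)
  finally show ?thesis .
qed

lemma nn_integral_shift_le_total_variation:
  fixes g :: "real \<Rightarrow> real"
  assumes [measurable]: "g \<in> borel_measurable borel"
  shows "(\<integral>\<^sup>+x. ennreal \<bar>g (x + u) - g x\<bar> \<partial>lborel) \<le> ennreal \<bar>u\<bar> * total_variation g"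
proof (cases u "0::real" rule: linorder_cases)
  case less
  have "(\<integral>\<^sup>+x. ennreal \<bar>g (x + u) - g x\<bar> \<partial>lborel)
      = (\<integral>\<^sup>+x. ennreal \<bar>g (x + u) - g x\<bar> \<partial>distr lborel borel ((+) (-u)))"
    by (simp only: lborel_distr_plus)
  also have "\<dots> = (\<integral>\<^sup>+x. ennreal \<bar>g (x + (-u)) - g x\<bar> \<partial>lborel)"
    by (subst nn_integral_distr) (auto simp: abs_minus_commute)
  also have "\<dots> \<le> ennreal \<bar>u\<bar> * total_variation g"
    using nn_integral_shift_le_total_variation_pos[of g "-u"] less by simp
  finally show ?thesis .
qed (use nn_integral_shift_le_total_variation_pos[of g u] in auto)

text \<open>An integrable nonnegative function takes values below every \<open>e > 0\<close>, so
  each of its values is, up to \<open>e\<close>, an increment.\<close>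

lemma le_total_variation:
  fixes g :: "real \<Rightarrow> real"
  assumes [measurable]: "g \<in> borel_measurable borel" and nn: "\<And>x. 0 \<le> g x"
    and fin: "(\<integral>\<^sup>+x. ennreal (g x) \<partial>lborel) < \<infinity>"
  shows "ennreal (g x) \<le> total_variation g"
proof (rule ennreal_le_epsilon)
  fix e :: real assume "0 < e"
  have "\<exists>y. g y < e"
  proof (rule ccontr)
    assume "\<not> (\<exists>y. g y < e)"
    then have "(\<integral>\<^sup>+x. ennreal e \<partial>(lborel::real measure)) \<le> (\<integral>\<^sup>+x. ennreal (g x) \<partial>lborel)"
      by (intro nn_integral_mono) (auto simp: not_less intro: ennreal_leI)
    with fin \<open>0 < e\<close> show False by (auto simp: ennreal_mult_top top_unique)
  qed
  then obtain y where "g y < e" by auto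
  then have "g x \<le> \<bar>g x - g y\<bar> + e" by auto
  then have "ennreal (g x) \<le> ennreal \<bar>g x - g y\<bar> + ennreal e"
    using \<open>0 < e\<close> by (metis abs_ge_zero ennreal_leI ennreal_plus less_imp_le)
  also have "\<dots> \<le> total_variation g + ennreal e"
    using total_variation_ge_diff[of g x y] by (intro add_right_mono)
  finally show "ennreal (g x) \<le> total_variation g + ennreal e" .
qed

section \<open>Slices along a coordinate axis and conditional densities\<close>

lemma borel_measurable_vec_nth_compose [measurable (raw)]:
  fixes g :: "'a \<Rightarrow> real^'m::finite"
  assumes "g \<in> borel_measurable M"
  shows "(\<lambda>x. g x $ i) \<in> borel_measurable M"
  by (rule measurable_compose[OF assms borel_measurable_nth])

lemma replace_alt: "replace i s x = s + (x - s $ i) *\<^sub>R axis i 1"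
  by (simp add: replace_def vec_eq_iff axis_def)

lemma replace_replace [simp]: "replace i (replace i s x) y = replace i s y"
  by (simp add: replace_def vec_eq_iff)

lemma replace_add_axis: "replace i s x + u *\<^sub>R axis i 1 = replace i s (x + u)"
  by (simp add: replace_def vec_eq_iff axis_def)

lemma measurable_replace [measurable]:
  "(\<lambda>z. replace i (fst z) (snd z) :: real^'m::finite) \<in> borel_measurable (lborel \<Otimes>\<^sub>M lborel)"
  unfolding replace_alt by measurable

lemma measurable_replace' [measurable]: "replace i (s :: real^'m::finite) \<in> borel_measurable borel"
  unfolding replace_alt[abs_def] by measurable

text \<open>Tonelli in the direction \<open>axis i 1\<close> without splitting the vector type: a
  line is represented by all its points with \<open>i\<close>th component in [0, 1), a segment of
  length 1, and is therefore counted exactly once.\<close>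

lemma nn_integral_slice:
  fixes F :: "real^'m::finite \<Rightarrow> ennreal"
  assumes [measurable]: "F \<in> borel_measurable borel"
  shows "(\<integral>\<^sup>+s. F s \<partial>lborel)
    = (\<integral>\<^sup>+s. indicator {s. 0 \<le> s $ i \<and> s $ i < 1} s * (\<integral>\<^sup>+x. F (replace i s x) \<partial>lborel) \<partial>lborel)"
proof -
  let ?e = "axis i (1::real) :: real^'m"
  let ?S = "{s::real^'m. 0 \<le> s $ i \<and> s $ i < 1}"
  have [measurable]: "?S \<in> sets borel" by measurable
  have translate: "(\<integral>\<^sup>+x. F (replace i s x) \<partial>lborel) = (\<integral>\<^sup>+x. F (s + x *\<^sub>R ?e) \<partial>lborel)" for s
  proof -
    have "(\<integral>\<^sup>+x. F (replace i s x) \<partial>lborel) = (\<integral>\<^sup>+x. F (replace i s x) \<partial>distr lborel borel ((+) (s $ i)))"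
      by (simp only: lborel_distr_plus)
    also have "\<dots> = (\<integral>\<^sup>+x. F (s + x *\<^sub>R ?e) \<partial>lborel)"
      by (subst nn_integral_distr) (auto simp: replace_alt)
    finally show ?thesis .
  qed
  have "(\<integral>\<^sup>+s. indicator ?S s * (\<integral>\<^sup>+x. F (replace i s x) \<partial>lborel) \<partial>lborel)
      = (\<integral>\<^sup>+s. (\<integral>\<^sup>+x. indicator ?S s * F (s + x *\<^sub>R ?e) \<partial>lborel) \<partial>lborel)"
    by (simp add: translate nn_integral_cmult)
  also have "\<dots> = (\<integral>\<^sup>+x. (\<integral>\<^sup>+s. indicator ?S s * F (s + x *\<^sub>R ?e) \<partial>lborel) \<partial>lborel)"
    by (rule lborel_pair.Fubini'[symmetric]) measurable
  also have "\<dots> = (\<integral>\<^sup>+x. (\<integral>\<^sup>+s. indicator ?S (s - x *\<^sub>R ?e) * F s \<partial>lborel) \<partial>lborel)"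
  proof (rule nn_integral_cong)
    fix x :: real
    have "(\<integral>\<^sup>+s. indicator ?S (s - x *\<^sub>R ?e) * F s \<partial>lborel)
        = (\<integral>\<^sup>+s. indicator ?S (s - x *\<^sub>R ?e) * F s \<partial>distr lborel borel ((+) (x *\<^sub>R ?e)))"
      by (simp only: lborel_distr_plus)
    also have "\<dots> = (\<integral>\<^sup>+s. indicator ?S s * F (s + x *\<^sub>R ?e) \<partial>lborel)"
      by (subst nn_integral_distr) (auto simp: add.commute)
    finally show "(\<integral>\<^sup>+s. indicator ?S s * F (s + x *\<^sub>R ?e) \<partial>lborel)
        = (\<integral>\<^sup>+s. indicator ?S (s - x *\<^sub>R ?e) * F s \<partial>lborel)" ..
  qed
  also have "\<dots> = (\<integral>\<^sup>+s. (\<integral>\<^sup>+x. indicator ?S (s - x *\<^sub>R ?e) * F s \<partial>lborel) \<partial>lborel)"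
    by (rule lborel_pair.Fubini') measurable
  also have "\<dots> = (\<integral>\<^sup>+s. F s \<partial>lborel)"
  proof (rule nn_integral_cong)
    fix s :: "real^'m"
    have "indicator ?S (s - x *\<^sub>R ?e) = (indicator {s $ i - 1 <.. s $ i} x :: ennreal)" for x
      by (auto simp: indicator_def)
    then show "(\<integral>\<^sup>+x. indicator ?S (s - x *\<^sub>R ?e) * F s \<partial>lborel) = F s"
      by (simp add: nn_integral_multc)
  qed
  finally show ?thesis ..
qed

lemma marginal_replace [simp]: "marginal f i (replace i s x) = marginal f i s"
  by (simp add: marginal_def)

lemma measurable_marginal [measurable]:
  fixes f :: "real^'m::finite \<Rightarrow> real"
  assumes [measurable]: "f \<in> borel_measurable borel"
  shows "marginal f i \<in> borel_measurable borel"
proof -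
  have "(\<lambda>t. \<integral>\<^sup>+ u. ennreal (f (replace i t u)) \<partial>lborel) \<in> borel_measurable lborel"
    by measurable
  then show ?thesis by (simp add: marginal_def[abs_def])
qed

text \<open>
  The total variation of the conditional densities need not be Borel measurable, so it is compared
  with the expected variation only through a measurable minorant \<open>R\<close>.
\<close>

lemma slice_integral_le_expected_variation:
  fixes f :: "real^'m::finite \<Rightarrow> real" and R :: "real^'m \<Rightarrow> ennreal"
  assumes f: "joint_pdf f" and h: "distributed M lborel h (\<lambda>t. ennreal (f t))"
    and [measurable]: "R \<in> borel_measurable borel"
    and slice: "\<And>s x. R (replace i s x) = R s"
    and R0: "\<And>s. marginal f i s = 0 \<Longrightarrow> R s = 0"
    and R: "\<And>s. marginal f i s < \<infinity> \<Longrightarrow> R s \<le> ennreal c * total_variation (\<lambda>x. f (replace i s x))"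
    and c: "0 < c"
  shows "(\<integral>\<^sup>+s. indicator {s. 0 \<le> s $ i \<and> s $ i < 1} s * R s \<partial>lborel)
    \<le> ennreal c * expected_variation M f h i"
proof -
  let ?S = "{s::real^'m. 0 \<le> s $ i \<and> s $ i < 1}"
  let ?m = "marginal f i"
  have [measurable]: "f \<in> borel_measurable borel" and nn: "\<And>t. 0 \<le> f t"
    and one: "(\<integral>\<^sup>+t. ennreal (f t) \<partial>lborel) = 1"
    using f by (auto simp: joint_pdf_def)
  have [measurable]: "?S \<in> sets borel" by measurable
  have [measurable]: "h \<in> measurable M lborel" using h by (auto simp: distributed_def)
  \<comment> \<open>The conditional counterpart of \<open>R\<close>: dividing by the marginal turns
    \<open>f\<close> along the line into the conditional density. The value 0 in the degenerate
    cases matches the zero function in \<open>cond_density\<close>.\<close>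
  define R' where "R' s = (if ?m s \<in> {0, \<infinity>} then 0 else R s / ?m s / ennreal c)" for s
  have [measurable]: "R' \<in> borel_measurable borel" unfolding R'_def by measurable
  have R'_slice: "R' (replace i s x) = R' s" for s x by (simp add: R'_def slice)
  have R'_le: "R' s \<le> total_variation (cond_density f i s)" for s
  proof (cases "?m s \<in> {0, \<infinity>}")
    case False
    then obtain r where r: "?m s = ennreal r" "0 < r" by (cases "?m s") (auto simp: less_le)
    have "cond_density f i s = (\<lambda>u. (1 / r) * f (replace i s u))"
      using False r by (auto simp: cond_density_def)
    then have tv: "total_variation (cond_density f i s) = ennreal (1 / r) * total_variation (\<lambda>u. f (replace i s u))"
      using r by (simp only: total_variation_cmult[of "1/r"] divide_nonneg_pos zero_le_one)
    have "R' s \<le> ennreal c * total_variation (\<lambda>x. f (replace i s x)) / ennreal r / ennreal c"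
      using False R[of s] r by (auto simp: R'_def intro!: divide_right_mono_ennreal)
    also have "\<dots> = total_variation (cond_density f i s)"
      using c r unfolding tv
      by (simp add: divide_ennreal_def inverse_ennreal ac_simps)
         (simp add: mult.assoc[symmetric] ennreal_mult'[symmetric] field_simps)
    finally show ?thesis .
  qed (simp add: R'_def)
  \<comment> \<open>\<open>R\<close> is controlled only on lines of finite marginal; almost every
    line is such, since \<open>f\<close> integrates to 1.\<close>
  have fin: "AE s in lborel. indicator ?S s * ?m s \<noteq> \<infinity>"
  proof (rule nn_integral_PInf_AE)
    show "(\<integral>\<^sup>+s. indicator ?S s * ?m s \<partial>lborel) \<noteq> \<infinity>"
      using nn_integral_slice[of "\<lambda>t. ennreal (f t)" i] one by (simp add: marginal_def)
  qed measurable
  have "(\<integral>\<^sup>+s. indicator ?S s * R s \<partial>lborel) = (\<integral>\<^sup>+s. ennreal c * (indicator ?S s * (R' s * ?m s)) \<partial>lborel)"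
  proof (rule nn_integral_cong_AE, use fin in eventually_elim)
    fix s assume *: "indicator ?S s * ?m s \<noteq> (\<infinity>::ennreal)"
    show "indicator ?S s * R s = ennreal c * (indicator ?S s * (R' s * ?m s))"
    proof (cases "s \<in> ?S \<and> ?m s \<noteq> 0")
      case True
      then obtain r where r: "?m s = ennreal r" "0 < r" using * by (cases "?m s") (auto simp: less_le)
      have "ennreal c * (R' s * ?m s) = R s * (ennreal c * inverse (ennreal c) * (inverse (ennreal r) * ennreal r))"
        using r by (simp add: R'_def divide_ennreal_def ac_simps)
      also have "\<dots> = R s"
        using r c by (simp add: inverse_ennreal ennreal_mult'[symmetric])
      finally have *: "ennreal c * (R' s * ?m s) = R s" .
      have "ennreal c * (indicator ?S s * (R' s * ?m s)) = indicator ?S s * (ennreal c * (R' s * ?m s))"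
        by (rule mult.left_commute)
      then show ?thesis by (simp only: *)
    qed (auto simp: R'_def R0 indicator_def)
  qed
  also have "\<dots> = ennreal c * (\<integral>\<^sup>+s. indicator ?S s * (R' s * ?m s) \<partial>lborel)"
    by (rule nn_integral_cmult) measurable
  \<comment> \<open>\<open>R'\<close> is constant on lines, so weighting it by the marginal amounts
    to integrating it against \<open>f\<close>, that is, to the expectation of
    \<open>R' (h \<omega>)\<close>.\<close>
  also have "(\<integral>\<^sup>+s. indicator ?S s * (R' s * ?m s) \<partial>lborel) = (\<integral>\<^sup>+s. ennreal (f s) * R' s \<partial>lborel)"
    by (subst nn_integral_slice[of "\<lambda>s. ennreal (f s) * R' s" i])
       (auto simp: R'_slice marginal_def nn_integral_cmult mult.commute)
  also have "\<dots> = (\<integral>\<^sup>+\<omega>. R' (h \<omega>) \<partial>M)"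
    by (rule distributed_nn_integral[OF h]) measurable
  also have "ennreal c * \<dots> \<le> ennreal c * expected_variation M f h i"
    unfolding expected_variation_def by (intro mult_left_mono nn_integral_mono R'_le) auto
  finally show ?thesis .
qed

text \<open>The one-dimensional shift estimate holds on every line parallel to the axis; averaging
  over the lines turns the variation of \<open>f\<close> into the expected variation of the
  conditional density.\<close>

lemma shift_axis_le_expected_variation:
  fixes f :: "real^'m::finite \<Rightarrow> real"
  assumes f: "joint_pdf f" and h: "distributed M lborel h (\<lambda>t. ennreal (f t))"
  shows "(\<integral>\<^sup>+s. ennreal \<bar>f (s + u *\<^sub>R axis i 1) - f s\<bar> \<partial>lborel)
    \<le> ennreal \<bar>u\<bar> * expected_variation M f h i"
proof (cases "u = 0")
  case False
  have [measurable]: "f \<in> borel_measurable borel" and nn: "\<And>t. 0 \<le> f t"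
    using f by (auto simp: joint_pdf_def)
  define R where "R s = (\<integral>\<^sup>+x. ennreal \<bar>f (replace i s x + u *\<^sub>R axis i 1) - f (replace i s x)\<bar> \<partial>lborel)" for s
  have R_alt: "R s = (\<integral>\<^sup>+x. ennreal \<bar>f (replace i s (x + u)) - f (replace i s x)\<bar> \<partial>lborel)" for s
    by (simp add: R_def replace_add_axis)
  have "R \<in> borel_measurable lborel" unfolding R_def by measurable
  then have [measurable]: "R \<in> borel_measurable borel" by simp
  have "(\<integral>\<^sup>+s. ennreal \<bar>f (s + u *\<^sub>R axis i 1) - f s\<bar> \<partial>lborel)
      = (\<integral>\<^sup>+s. indicator {s. 0 \<le> s $ i \<and> s $ i < 1} s * R s \<partial>lborel)"
    unfolding R_def by (rule nn_integral_slice) measurable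
  also have "\<dots> \<le> ennreal \<bar>u\<bar> * expected_variation M f h i"
  proof (rule slice_integral_le_expected_variation[OF f h])
    fix s
    show "R s \<le> ennreal \<bar>u\<bar> * total_variation (\<lambda>x. f (replace i s x))"
      unfolding R_alt by (rule nn_integral_shift_le_total_variation) measurable
    have eq: "(\<integral>\<^sup>+x. ennreal (f (replace i s (x + u))) \<partial>lborel) = marginal f i s"
    proof -
      have "marginal f i s = (\<integral>\<^sup>+x. ennreal (f (replace i s x)) \<partial>distr lborel borel ((+) u))"
        by (simp only: lborel_distr_plus marginal_def)
      also have "\<dots> = (\<integral>\<^sup>+x. ennreal (f (replace i s (x + u))) \<partial>lborel)"
        by (subst nn_integral_distr) (auto simp: add.commute)
      finally show ?thesis ..
    qed
    \<comment> \<open>Where the marginal is 0 the conditional density is the zero function, and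
      nothing on the right pays for \<open>R s\<close>. There \<open>f\<close> vanishes almost
      everywhere on the line, hence \<open>R s = 0\<close>.\<close>
    have "R s \<le> (\<integral>\<^sup>+x. ennreal (f (replace i s (x + u))) + ennreal (f (replace i s x)) \<partial>lborel)"
      unfolding R_alt using nn
      by (intro nn_integral_mono) (simp add: ennreal_plus[symmetric] abs_le_iff ennreal_leI nn add_increasing algebra_simps del: ennreal_plus)
    also have "\<dots> = marginal f i s + marginal f i s"
      by (subst nn_integral_add) (auto simp: eq marginal_def)
    finally show "R s = 0" if "marginal f i s = 0" using that by simp
  qed (use False in \<open>auto simp: R_def\<close>)
  finally show ?thesis .
qed simp

text \<open>The shift is made one coordinate at a time; the displacement \<open>w J\<close>
  accumulated so far is removed by translation invariance.\<close>

lemma shift_le_expected_variation: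
  fixes f :: "real^'m::finite \<Rightarrow> real"
  assumes f: "joint_pdf f" and h: "distributed M lborel h (\<lambda>t. ennreal (f t))"
  shows "(\<integral>\<^sup>+s. ennreal \<bar>f (s + u) - f s\<bar> \<partial>lborel)
    \<le> (\<Sum>i\<in>UNIV. ennreal \<bar>u $ i\<bar> * expected_variation M f h i)"
proof -
  have [measurable]: "f \<in> borel_measurable borel"
    using f by (auto simp: joint_pdf_def)
  define w where "w J = (\<Sum>i\<in>J. (u $ i) *\<^sub>R axis i (1::real))" for J
  have *: "(\<integral>\<^sup>+s. ennreal \<bar>f (s + w J) - f s\<bar> \<partial>lborel)
    \<le> (\<Sum>i\<in>J. ennreal \<bar>u $ i\<bar> * expected_variation M f h i)" if "finite J" for J
    using that
  proof induction
    case (insert i J)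
    let ?e = "(u $ i) *\<^sub>R axis i (1::real)"
    have "(\<integral>\<^sup>+s. ennreal \<bar>f (s + w (insert i J)) - f s\<bar> \<partial>lborel)
      \<le> (\<integral>\<^sup>+s. ennreal \<bar>f (s + w J + ?e) - f (s + w J)\<bar> + ennreal \<bar>f (s + w J) - f s\<bar> \<partial>lborel)"
      using insert.hyps
      by (intro nn_integral_mono) (auto simp: w_def ac_simps ennreal_plus[symmetric] simp del: ennreal_plus intro!: ennreal_leI)
    also have "\<dots> = (\<integral>\<^sup>+s. ennreal \<bar>f (s + w J + ?e) - f (s + w J)\<bar> \<partial>lborel)
        + (\<integral>\<^sup>+s. ennreal \<bar>f (s + w J) - f s\<bar> \<partial>lborel)"
      by (rule nn_integral_add) measurable
    also have "(\<integral>\<^sup>+s. ennreal \<bar>f (s + w J + ?e) - f (s + w J)\<bar> \<partial>lborel)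
       = (\<integral>\<^sup>+s. ennreal \<bar>f (s + ?e) - f s\<bar> \<partial>distr lborel borel ((+) (w J)))"
      by (subst nn_integral_distr) (auto simp: ac_simps)
    also have "\<dots> = (\<integral>\<^sup>+s. ennreal \<bar>f (s + ?e) - f s\<bar> \<partial>lborel)"
      by (simp only: lborel_distr_plus)
    also have "\<dots> \<le> ennreal \<bar>u $ i\<bar> * expected_variation M f h i"
      by (rule shift_axis_le_expected_variation[OF f h])
    finally show ?case using insert by (simp add: add_mono order_trans[OF _ add_mono])
  qed (simp add: w_def)
  have "w UNIV = u"
    using basis_expansion[of u] by (simp add: w_def scalar_mult_eq_scaleR)
  with *[of UNIV] show ?thesis by simp
qed

text \<open>A line parallel to axis \<open>i\<close> meets the slab in an interval of length
  \<open>2 * d / \<bar>a $ i\<bar>\<close>, on which the density is at most its variation along the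
  line.\<close>

lemma slab_le_expected_variation:
  fixes f :: "real^'m::finite \<Rightarrow> real"
  assumes f: "joint_pdf f" and h: "distributed M lborel h (\<lambda>t. ennreal (f t))"
    and a: "a $ i \<noteq> 0" and d: "0 < d"
  shows "(\<integral>\<^sup>+s. ennreal (f s) * indicator {s. \<bar>a \<bullet> s - c\<bar> \<le> d} s \<partial>lborel)
    \<le> ennreal (2 * d / \<bar>a $ i\<bar>) * expected_variation M f h i"
proof -
  let ?H = "{s. \<bar>a \<bullet> s - c\<bar> \<le> d}"
  have [measurable]: "f \<in> borel_measurable borel" and nn: "\<And>t. 0 \<le> f t"
    using f by (auto simp: joint_pdf_def)
  have [measurable]: "?H \<in> sets borel" by measurable
  define R where "R s = (\<integral>\<^sup>+x. ennreal (f (replace i s x)) * indicator ?H (replace i s x) \<partial>lborel)" for s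
  have "R \<in> borel_measurable lborel" unfolding R_def by measurable
  then have [measurable]: "R \<in> borel_measurable borel" by simp
  have "(\<integral>\<^sup>+s. ennreal (f s) * indicator ?H s \<partial>lborel)
      = (\<integral>\<^sup>+s. indicator {s. 0 \<le> s $ i \<and> s $ i < 1} s * R s \<partial>lborel)"
    unfolding R_def by (rule nn_integral_slice) measurable
  also have "\<dots> \<le> ennreal (2 * d / \<bar>a $ i\<bar>) * expected_variation M f h i"
  proof (rule slice_integral_le_expected_variation[OF f h])
    fix s
    let ?TV = "total_variation (\<lambda>x. f (replace i s x))"
    have "R s \<le> marginal f i s"
      unfolding R_def marginal_def by (intro nn_integral_mono) (auto simp: indicator_def)
    then show "R s = 0" if "marginal f i s = 0" using that by simp
    assume fin: "marginal f i s < \<infinity>"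
    \<comment> \<open>\<open>z\<close> is where the line crosses the hyperplane
      \<open>a \<bullet> s = c\<close>, and \<open>r\<close> is half the length of its part in the
      slab.\<close>
    define z where "z = s $ i + (c - a \<bullet> s) / a $ i"
    define r where "r = d / \<bar>a $ i\<bar>"
    have r: "0 < r" using a d by (simp add: r_def)
    have H: "replace i s x \<in> ?H \<longleftrightarrow> x \<in> {z - r .. z + r}" for x
    proof -
      have "a $ i * z = a $ i * s $ i + (c - a \<bullet> s)"
        using a by (simp add: z_def distrib_left)
      then have "a \<bullet> replace i s x - c = a $ i * (x - z)"
        by (simp add: replace_alt inner_add_right inner_axis right_diff_distrib mult.commute)
      then have "replace i s x \<in> ?H \<longleftrightarrow> \<bar>a $ i\<bar> * \<bar>x - z\<bar> \<le> d"
        by (simp add: abs_mult)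
      also have "\<dots> \<longleftrightarrow> \<bar>x - z\<bar> \<le> r"
        using a by (simp add: r_def pos_le_divide_eq mult.commute)
      finally have "replace i s x \<in> ?H \<longleftrightarrow> \<bar>x - z\<bar> \<le> r" .
      then show ?thesis by auto
    qed
    have "R s \<le> (\<integral>\<^sup>+x. ?TV * indicator {z - r .. z + r} x \<partial>lborel)"
      unfolding R_def
    proof (rule nn_integral_mono)
      fix x
      have "ennreal (f (replace i s x)) \<le> ?TV"
        by (rule le_total_variation[of "\<lambda>x. f (replace i s x)"])
           (use fin nn in \<open>auto simp: marginal_def\<close>)
      then show "ennreal (f (replace i s x)) * indicator ?H (replace i s x) \<le> ?TV * indicator {z - r .. z + r} x"
        using H[of x] by (auto simp: indicator_def)
    qed
    also have "\<dots> = ennreal (2 * d / \<bar>a $ i\<bar>) * ?TV"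
    proof -
      have "emeasure lborel {z - r .. z + r} = ennreal (2 * d / \<bar>a $ i\<bar>)"
        using r d by (subst emeasure_lborel_Icc) (auto simp: r_def)
      then show ?thesis
        by (subst nn_integral_cmult_indicator) (auto simp: mult.commute)
    qed
    finally show "R s \<le> ennreal (2 * d / \<bar>a $ i\<bar>) * ?TV" .
  qed (use a d in \<open>auto simp: R_def\<close>)
  finally show ?thesis .
qed

section \<open>Bases and Gomory relaxations\<close>

text \<open>Puts \<open>x\<close> on the basic variables and 0 on the others. Written as a sum it
  makes sense for any \<open>b\<close>, and \<open>inner_embed_sum\<close> and
  \<open>mult_embed\<close> need no injectivity.\<close>

definition basis_embed :: "('m::finite \<Rightarrow> 'n) \<Rightarrow> real^'m \<Rightarrow> real^'n" where
  "basis_embed b x = (\<chi> j. \<Sum>i\<in>UNIV. if b i = j then x $ i else 0)"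

definition red_cost :: "real^'n::finite^'m::finite \<Rightarrow> real^'n \<Rightarrow> ('m \<Rightarrow> 'n) \<Rightarrow> real^'n" where
  "red_cost W q b = q - lam W q b v* W"

definition gomory_set :: "'n::finite set \<Rightarrow> real^'n^'m \<Rightarrow> ('m \<Rightarrow> 'n) \<Rightarrow> real^'m \<Rightarrow> (real^'n) set" where
  "gomory_set I W b s = {y. (\<forall>j\<in>I. y $ j \<in> \<int>) \<and> (\<forall>j. j \<notin> range b \<longrightarrow> 0 \<le> y $ j) \<and> W *v y = s}"

lemma matrix_inv_left: "invertible (A :: real^'m^'m) \<Longrightarrow> matrix_inv A ** A = mat 1"
  and matrix_inv_right: "invertible A \<Longrightarrow> A ** matrix_inv A = mat 1"
  unfolding invertible_def matrix_inv_def by (metis (mono_tags, lifting) someI_ex)+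

lemma gomory_value_alt: "gomory_value I W q b s = (INF y\<in>gomory_set I W b s. ereal (q \<bullet> y))"
  by (simp add: gomory_value_def gomory_set_def)

text \<open>The dual solution is added and subtracted. As this holds for every \<open>y\<close> and
  \<open>b\<close>, comparing costs at equal right-hand sides becomes comparing reduced
  costs.\<close>

lemma inner_eq_lam_plus_red_cost: "q \<bullet> y = lam W q b \<bullet> (W *v y) + red_cost W q b \<bullet> y"
  by (simp add: red_cost_def inner_diff_left dot_lmul_matrix)

lemma basis_matrix_inj:
  assumes "invertible (basis_matrix W b)"
  shows "inj b"
proof (rule injI, rule ccontr)
  fix i j assume "b i = b j" "i \<noteq> j"
  then have "det (basis_matrix W b) = 0"
    by (intro det_identical_columns[of i j]) (auto simp: column_def basis_matrix_def)
  with assms show False by (simp add: invertible_det_nz)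
qed

lemma red_cost_basis:
  assumes "invertible (basis_matrix W b)"
  shows "red_cost W q b $ b i = 0"
proof -
  have "lam W q b v* basis_matrix W b = (\<chi> j. q $ b j)"
    using assms by (simp add: lam_def vector_matrix_mul_assoc matrix_inv_left)
  moreover have "(lam W q b v* W) $ b i = (lam W q b v* basis_matrix W b) $ i"
    by (simp add: vector_matrix_mult_def basis_matrix_def)
  ultimately show ?thesis by (simp add: red_cost_def)
qed

lemma dual_feasible_iff:
  "b \<in> dual_feasible W q \<longleftrightarrow> invertible (basis_matrix W b) \<and> (\<forall>j. 0 \<le> red_cost W q b $ j)"
  by (simp add: dual_feasible_def red_cost_def)

lemma inner_embed_sum: "c \<bullet> basis_embed b x = (\<Sum>i\<in>UNIV. x $ i * c $ b i)"
proof -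
  have "c \<bullet> basis_embed b x = (\<Sum>j\<in>UNIV. \<Sum>i\<in>UNIV. if b i = j then x $ i * c $ j else 0)"
    by (auto simp: inner_vec_def basis_embed_def sum_distrib_left mult.commute intro!: sum.cong)
  also have "\<dots> = (\<Sum>i\<in>UNIV. \<Sum>j\<in>UNIV. if b i = j then x $ i * c $ j else 0)"
    by (rule sum.swap)
  finally show ?thesis by simp
qed

lemma mult_embed: "W *v basis_embed b x = basis_matrix W b *v x"
  by (simp add: vec_eq_iff matrix_vector_mul_component inner_embed_sum)
     (simp add: basis_matrix_def inner_vec_def mult.commute)

lemma embed_basis: "inj b \<Longrightarrow> basis_embed b x $ b i = x $ i"
  by (simp add: basis_embed_def inj_eq)

lemma embed_nonbasis: "j \<notin> range b \<Longrightarrow> basis_embed b x $ j = 0"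
  by (auto simp: basis_embed_def intro!: sum.neutral)

lemma embed_Ints: "(\<And>i. x $ i \<in> \<int>) \<Longrightarrow> basis_embed b x $ j \<in> \<int>"
  by (auto simp: basis_embed_def intro!: Ints_sum)

lemma inner_embed:
  assumes "invertible (basis_matrix W b)"
  shows "q \<bullet> basis_embed b x = lam W q b \<bullet> (basis_matrix W b *v x)"
  by (simp add: inner_eq_lam_plus_red_cost[of q _ W b] mult_embed inner_embed_sum[of "red_cost W q b"] red_cost_basis assms)

lemma det_Ints:
  fixes A :: "real^'m^'m::finite"
  assumes "\<And>i j. A $ i $ j \<in> \<int>"
  shows "det A \<in> \<int>"
  unfolding det_def using assms by (auto intro!: Ints_sum Ints_mult Ints_prod)

lemma mult_Ints:
  fixes A :: "real^'n::finite^'m"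
  assumes "\<And>i j. A $ i $ j \<in> \<int>" "\<And>j. w $ j \<in> \<int>"
  shows "(A *v w) $ i \<in> \<int>"
  using assms by (auto simp: matrix_vector_mult_def intro!: Ints_sum Ints_mult)

lemma period_pos: "invertible (basis_matrix W b) \<Longrightarrow> 0 < period W b"
  by (simp add: period_def invertible_det_nz)

lemma period_Ints: "(\<And>i j. W $ i $ j \<in> \<int>) \<Longrightarrow> period W b \<in> \<int>"
  by (auto simp: period_def basis_matrix_def intro!: Ints_abs det_Ints)

text \<open>By Cramer's rule the entries of the inverse applied to an integer vector are integer
  determinants divided by the determinant of the basis; the factor \<open>period W b\<close> cancels
  this denominator up to sign.\<close>

lemma inverse_basis_Ints:
  fixes W :: "real^'n::finite^'m::finite"
  assumes W: "\<And>i j. W $ i $ j \<in> \<int>" and inv: "invertible (basis_matrix W b)"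
    and w: "\<And>i. w $ i \<in> \<int>"
  shows "(matrix_inv (basis_matrix W b) *v (period W b *\<^sub>R w)) $ k \<in> \<int>"
proof -
  let ?B = "basis_matrix W b"
  let ?x = "matrix_inv ?B *v (period W b *\<^sub>R w)"
  let ?C = "\<lambda>w. det (\<chi> i j. if j = k then w $ i else ?B $ i $ j)"
  have det: "det ?B \<noteq> 0" using inv by (simp add: invertible_det_nz)
  have "?B *v (matrix_inv ?B *v w) = w"
    using inv by (simp add: matrix_vector_mul_assoc matrix_inv_right)
  then have "matrix_inv ?B *v w = (\<chi> k. det (\<chi> i j. if j = k then w $ i else ?B $ i $ j) / det ?B)"
    using cramer[OF det] by blast
  then have "(matrix_inv ?B *v w) $ k = ?C w / det ?B" by simp
  then have "?x $ k = (period W b / det ?B) * ?C w"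
    by (simp add: matrix_vector_mult_scaleR)
  also have "period W b / det ?B = sgn (det ?B)"
    by (simp add: period_def sgn_real_def)
  finally show ?thesis
    using W w by (auto simp: sgn_real_def basis_matrix_def intro!: Ints_mult det_Ints)
qed

text \<open>From every nonbasic variable the largest multiple of the period is subtracted that keeps
  it nonnegative. An integer change of the basic variables, which have no sign constraint, restores
  the right-hand side, and the cost falls by the reduced cost of what was subtracted.\<close>

lemma gomory_set_reduce:
  fixes W :: "real^'n::finite^'m::finite"
  assumes W: "\<And>i j. W $ i $ j \<in> \<int>" and b: "b \<in> dual_feasible W q"
    and y: "y \<in> gomory_set I W b s"
  obtains y' where "y' \<in> gomory_set I W b s" "\<And>j. j \<notin> range b \<Longrightarrow> y' $ j < period W b"
    "q \<bullet> y' \<le> q \<bullet> y"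
proof -
  let ?p = "period W b"
  have inv: "invertible (basis_matrix W b)" and red: "\<And>j. 0 \<le> red_cost W q b $ j"
    using b by (auto simp: dual_feasible_iff)
  have p: "0 < ?p" "?p \<in> \<int>" using period_pos[OF inv] period_Ints[OF W] .
  define z where "z = (\<chi> j. if j \<in> range b then 0 else real_of_int \<lfloor>y $ j / ?p\<rfloor>)"
  \<comment> \<open>The correction of the basic variables; it is integral by
    \<open>inverse_basis_Ints\<close>, since \<open>W *v z\<close> is an integer vector.\<close>
  define x where "x = matrix_inv (basis_matrix W b) *v (?p *\<^sub>R (W *v z))"
  define y' where "y' = y - ?p *\<^sub>R z + basis_embed b x"
  have x: "x $ i \<in> \<int>" for i
    unfolding x_def by (intro inverse_basis_Ints[OF W inv] mult_Ints W) (simp add: z_def)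
  have Bx: "basis_matrix W b *v x = ?p *\<^sub>R (W *v z)"
    using inv by (simp add: x_def matrix_vector_mul_assoc matrix_inv_right)
  have nonbasic: "y' $ j = y $ j - ?p * real_of_int \<lfloor>y $ j / ?p\<rfloor>" if "j \<notin> range b" for j
    using that by (simp add: y'_def z_def embed_nonbasis)
  show ?thesis
  proof
    have "W *v y' = s"
      using y by (simp add: y'_def matrix_vector_right_distrib matrix_vector_mult_diff_distrib mult_embed Bx
          matrix_vector_mult_scaleR gomory_set_def)
    moreover have "y' $ j \<in> \<int>" if "j \<in> I" for j
      using y that p x by (auto simp: y'_def z_def gomory_set_def intro!: Ints_add Ints_diff Ints_mult embed_Ints)
    moreover have "0 \<le> y' $ j" if "j \<notin> range b" for j
    proof -
      have "?p * real_of_int \<lfloor>y $ j / ?p\<rfloor> \<le> ?p * (y $ j / ?p)"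
        using p by (intro mult_left_mono of_int_floor_le) simp
      also have "\<dots> = y $ j" using p by simp
      finally show ?thesis using that by (simp add: nonbasic)
    qed
    ultimately show "y' \<in> gomory_set I W b s" by (simp add: gomory_set_def)
    show "y' $ j < ?p" if "j \<notin> range b" for j
      using that p real_of_int_floor_add_one_gt[of "y $ j / ?p"]
      by (simp add: nonbasic pos_divide_less_eq algebra_simps)
    have "q \<bullet> y' = q \<bullet> y - ?p * (red_cost W q b \<bullet> z)"
      using inner_eq_lam_plus_red_cost[of q "?p *\<^sub>R z" W b]
      by (simp add: y'_def inner_diff_right inner_add_right inner_embed[OF inv] Bx matrix_vector_mult_scaleR)
    moreover have "0 \<le> red_cost W q b \<bullet> z"
      using red y p by (auto simp: inner_vec_def z_def gomory_set_def intro!: sum_nonneg mult_nonneg_nonneg)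
    ultimately show "q \<bullet> y' \<le> q \<bullet> y" using p by simp
  qed
qed

text \<open>Weak duality for the relaxation: the basic variables, whose sign is free, carry reduced
  cost 0.\<close>

lemma gomory_set_cost_ge:
  assumes "b \<in> dual_feasible W q" "y \<in> gomory_set I W b s"
  shows "lam W q b \<bullet> s \<le> q \<bullet> y"
proof -
  have "0 \<le> red_cost W q b $ j * y $ j" for j
    using assms red_cost_basis[of W b q] by (cases "j \<in> range b") (auto simp: dual_feasible_iff gomory_set_def)
  then have "0 \<le> red_cost W q b \<bullet> y" by (auto simp: inner_vec_def intro!: sum_nonneg)
  then show ?thesis
    using assms inner_eq_lam_plus_red_cost[of q y W b] by (auto simp: gomory_set_def)
qed

lemma Y_gomory_set: "y \<in> Y I \<Longrightarrow> W *v y = s \<Longrightarrow> y \<in> gomory_set I W b s"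
  by (auto simp: Y_def gomory_set_def)

lemma gomory_value_le_value_function: "gomory_value I W q b s \<le> value_function I W q s"
  unfolding gomory_value_alt value_function_def by (intro INF_superset_mono) (auto intro: Y_gomory_set)

context
  fixes I :: "'n::finite set" and W :: "real^'n^'m::finite" and q :: "real^'n"
  assumes W: "\<And>i j. W $ i $ j \<in> \<int>"
    and full: "\<And>s. \<exists>y\<in>Y I. W *v y = s"
begin

text \<open>Below, weak duality; above, a feasible point reduced so that its nonbasic variables lie
  below the period. Hence the relaxation is finite, and \<open>psi\<close> lies between 0 and a
  quantity that is linear in \<open>q\<close>.\<close>

lemma gomory_value_bounds:
  assumes b: "b \<in> dual_feasible W q"
  shows "ereal (lam W q b \<bullet> s) \<le> gomory_value I W q b s"
    and "gomory_value I W q b s \<le> ereal (lam W q b \<bullet> s + period W b * (\<Sum>j\<in>UNIV. red_cost W q b $ j))"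
proof -
  have inv: "invertible (basis_matrix W b)" and red: "\<And>j. 0 \<le> red_cost W q b $ j"
    using b by (auto simp: dual_feasible_iff)
  show "ereal (lam W q b \<bullet> s) \<le> gomory_value I W q b s"
    unfolding gomory_value_alt using gomory_set_cost_ge[OF b] by (intro INF_greatest) auto
  obtain y where "y \<in> gomory_set I W b s" using full[of s] Y_gomory_set by blast
  then obtain y' where y': "y' \<in> gomory_set I W b s" "\<And>j. j \<notin> range b \<Longrightarrow> y' $ j < period W b"
    using gomory_set_reduce[OF W b] by blast
  have "red_cost W q b $ j * y' $ j \<le> period W b * red_cost W q b $ j" for j
    using red_cost_basis[OF inv, of q] mult_left_mono[OF less_imp_le[OF y'(2)[of j]] red[of j]]
    by (cases "j \<in> range b") (auto simp: mult.commute[of "period W b"])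
  then have "red_cost W q b \<bullet> y' \<le> period W b * (\<Sum>j\<in>UNIV. red_cost W q b $ j)"
    unfolding inner_vec_def sum_distrib_left by (intro sum_mono) simp
  moreover have "W *v y' = s" using y' by (simp add: gomory_set_def)
  ultimately have "q \<bullet> y' \<le> lam W q b \<bullet> s + period W b * (\<Sum>j\<in>UNIV. red_cost W q b $ j)"
    using inner_eq_lam_plus_red_cost[of q y' W b] by simp
  then show "gomory_value I W q b s \<le> ereal (lam W q b \<bullet> s + period W b * (\<Sum>j\<in>UNIV. red_cost W q b $ j))"
    unfolding gomory_value_alt using y'(1) by (intro INF_lower2) auto
qed

lemma gomory_value_eq:
  assumes b: "b \<in> dual_feasible W q"
  shows "gomory_value I W q b s = ereal (lam W q b \<bullet> s + psi I W q b s)"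
  using gomory_value_bounds[OF b, of s] by (cases "gomory_value I W q b s") (auto simp: psi_def)

lemma psi_bounds:
  assumes b: "b \<in> dual_feasible W q"
  shows "0 \<le> psi I W q b s" "psi I W q b s \<le> period W b * (\<Sum>j\<in>UNIV. red_cost W q b $ j)"
  using gomory_value_bounds[OF b, of s] by (auto simp: gomory_value_eq[OF b])

text \<open>The shift is an integer combination of the basic columns, hence absorbed by the basic
  variables at a price that the linear part \<open>lam\<close> accounts for exactly. The inequality
  \<open>le\<close> for \<open>w\<close> and for \<open>-w\<close> gives equality.\<close>

lemma psi_periodic:
  assumes b: "b \<in> dual_feasible W q" and w: "\<And>i. w $ i \<in> \<int>"
  shows "psi I W q b (s + period W b *\<^sub>R w) = psi I W q b s"
proof -
  let ?p = "period W b"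
  have inv: "invertible (basis_matrix W b)" using b by (auto simp: dual_feasible_iff)
  have le: "psi I W q b (s + ?p *\<^sub>R w) \<le> psi I W q b s" if w: "\<And>i. w $ i \<in> \<int>" for s w
  proof -
    define x where "x = matrix_inv (basis_matrix W b) *v (?p *\<^sub>R w)"
    have x: "x $ i \<in> \<int>" for i unfolding x_def by (rule inverse_basis_Ints[OF W inv w])
    have Bx: "basis_matrix W b *v x = ?p *\<^sub>R w"
      using inv by (simp add: x_def matrix_vector_mul_assoc matrix_inv_right)
    have "ereal (lam W q b \<bullet> s + psi I W q b (s + ?p *\<^sub>R w)) \<le> gomory_value I W q b s"
      unfolding gomory_value_alt
    proof (rule INF_greatest)
      fix y assume y: "y \<in> gomory_set I W b s"
      have "y + basis_embed b x \<in> gomory_set I W b (s + ?p *\<^sub>R w)"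
        using y x by (auto simp: gomory_set_def matrix_vector_right_distrib mult_embed Bx embed_nonbasis
            intro!: Ints_add embed_Ints)
      then have "gomory_value I W q b (s + ?p *\<^sub>R w) \<le> ereal (q \<bullet> (y + basis_embed b x))"
        unfolding gomory_value_alt by (intro INF_lower) auto
      then show "ereal (lam W q b \<bullet> s + psi I W q b (s + ?p *\<^sub>R w)) \<le> ereal (q \<bullet> y)"
        by (simp add: gomory_value_eq[OF b] inner_add_right inner_embed[OF inv] Bx)
    qed
    then show ?thesis by (simp add: gomory_value_eq[OF b])
  qed
  show ?thesis
    using le[of w s] le[of "-w" "s + ?p *\<^sub>R w"] w by (intro antisym) auto
qed


end

text \<open>Bounds how far nonbasic variables below the period can push a basic variable down, for
  all bases at once; a sum stands in for a maximum. Noninvertible \<open>b\<close> contribute 0,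
  their \<open>period\<close> being 0.\<close>

definition cone_depth :: "real^'n::finite^'m::finite \<Rightarrow> real" where
  "cone_depth W = (\<Sum>b\<in>UNIV. \<Sum>i\<in>UNIV. \<Sum>j\<in>UNIV. \<bar>(matrix_inv (basis_matrix W b) ** W) $ i $ j\<bar> * period W b)"

text \<open>A reduced point has nonbasic variables \<open>z\<close> below the period, and solving
  for the basic ones gives the basis coordinates of \<open>s\<close> minus those of
  \<open>W *v z\<close>. At this depth they stay nonnegative, so the point is feasible for the
  original problem and no dearer.\<close>

lemma value_function_eq_gomory_value:
  fixes W :: "real^'n::finite^'m::finite"
  assumes W: "\<And>i j. W $ i $ j \<in> \<int>" and b: "b \<in> dual_feasible W q"
    and deep: "\<And>i. cone_depth W \<le> (matrix_inv (basis_matrix W b) *v s) $ i"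
  shows "value_function I W q s = gomory_value I W q b s"
proof (rule antisym)
  let ?A = "matrix_inv (basis_matrix W b)"
  have inv: "invertible (basis_matrix W b)" using b by (auto simp: dual_feasible_iff)
  show "value_function I W q s \<le> gomory_value I W q b s"
    unfolding gomory_value_alt
  proof (rule INF_greatest)
    fix y assume "y \<in> gomory_set I W b s"
    then obtain y' where y': "y' \<in> gomory_set I W b s" "\<And>j. j \<notin> range b \<Longrightarrow> y' $ j < period W b"
        and le: "q \<bullet> y' \<le> q \<bullet> y"
      using gomory_set_reduce[OF W b] by blast
    define z where "z = (\<chi> j. if j \<in> range b then 0 else y' $ j)"
    have z: "0 \<le> z $ j" "z $ j \<le> period W b" for j
      using y' period_pos[OF inv] by (auto simp: z_def gomory_set_def intro: less_imp_le)
    have "y' = z + basis_embed b (\<chi> i. y' $ b i)"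
    proof (rule vec_eq_iff[THEN iffD2, rule_format])
      fix j show "y' $ j = (z + basis_embed b (\<chi> i. y' $ b i)) $ j"
        using embed_basis[OF basis_matrix_inj[OF inv], of "\<chi> i. y' $ b i"]
        by (cases "j \<in> range b") (auto simp: z_def embed_nonbasis)
    qed
    then have "s = W *v z + basis_matrix W b *v (\<chi> i. y' $ b i)"
      using y' by (metis (mono_tags, lifting) gomory_set_def matrix_vector_right_distrib mem_Collect_eq mult_embed)
    then have As: "?A *v s = (?A ** W) *v z + (\<chi> i. y' $ b i)"
      using inv by (simp add: matrix_vector_right_distrib matrix_vector_mul_assoc matrix_inv_left)
    have "0 \<le> y' $ b i" for i
    proof -
      have "((?A ** W) *v z) $ i \<le> (\<Sum>j\<in>UNIV. \<bar>(?A ** W) $ i $ j\<bar> * period W b)"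
        unfolding matrix_vector_mult_def vec_lambda_beta
        by (intro sum_mono order_trans[OF mult_right_mono[OF abs_ge_self] mult_left_mono] z) auto
      also have "\<dots> \<le> (\<Sum>i\<in>UNIV. \<Sum>j\<in>UNIV. \<bar>(?A ** W) $ i $ j\<bar> * period W b)"
        by (rule member_le_sum[of i UNIV "\<lambda>i. \<Sum>j\<in>UNIV. \<bar>(?A ** W) $ i $ j\<bar> * period W b"])
           (auto simp: period_def intro!: sum_nonneg)
      also have "\<dots> \<le> cone_depth W"
        unfolding cone_depth_def
        by (rule member_le_sum[of b UNIV "\<lambda>b. \<Sum>i\<in>UNIV. \<Sum>j\<in>UNIV. \<bar>(matrix_inv (basis_matrix W b) ** W) $ i $ j\<bar> * period W b"])
           (auto simp: period_def intro!: sum_nonneg)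
      also have "\<dots> \<le> ((?A ** W) *v z) $ i + y' $ b i"
        using deep[of i] by (simp add: As)
      finally show ?thesis by simp
    qed
    then have "0 \<le> y' $ j" for j
      using y'(1) by (cases "j \<in> range b") (auto simp: gomory_set_def)
    then have "y' \<in> Y I" using y'(1) by (simp add: Y_def gomory_set_def)
    then show "value_function I W q s \<le> ereal (q \<bullet> y)"
      unfolding value_function_def using y'(1) le
      by (intro INF_lower2[of y']) (auto simp: gomory_set_def)
  qed
qed (rule gomory_value_le_value_function)

section \<open>Bounded feasible points and recession directions\<close>

lemma norm1_nonneg [simp]: "0 \<le> norm1 x"
  by (simp add: norm1_def sum_nonneg)

lemma nth_le_norm1: "\<bar>x $ i\<bar> \<le> norm1 x" for x :: "real^'a::finite"
  unfolding norm1_def by (rule member_le_sum) auto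

lemma norm1_triangle: "norm1 (x + y) \<le> norm1 x + norm1 y"
  unfolding norm1_def sum.distrib[symmetric] by (intro sum_mono) auto

lemma inner_le_norm1: "\<bar>x \<bullet> y\<bar> \<le> norm1 x * norm1 y" for x :: "real^'a::finite"
proof -
  have "\<bar>x \<bullet> y\<bar> \<le> (\<Sum>i\<in>UNIV. \<bar>x $ i\<bar> * \<bar>y $ i\<bar>)"
    unfolding inner_vec_def by (rule order_trans[OF sum_abs]) (simp add: abs_mult)
  also have "\<dots> \<le> (\<Sum>i\<in>UNIV. \<bar>x $ i\<bar> * norm1 y)"
    by (intro sum_mono mult_left_mono nth_le_norm1) auto
  finally show ?thesis by (simp add: norm1_def sum_distrib_right)
qed

lemma norm1_mult_le:
  fixes A :: "real^'n::finite^'m::finite"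
  shows "norm1 (A *v x) \<le> (\<Sum>i\<in>UNIV. norm1 (A $ i)) * norm1 x"
  unfolding norm1_def[of "A *v x"] sum_distrib_right
  by (intro sum_mono) (simp add: matrix_vector_mul_component inner_le_norm1)

lemma finite_Ints_vec: "finite {l :: real^'m::finite. (\<forall>i. l $ i \<in> \<int>) \<and> norm1 l \<le> R}"
proof (rule finite_subset)
  let ?S = "{k::real. k \<in> \<int> \<and> \<bar>k\<bar> \<le> R}"
  show "{l :: real^'m. (\<forall>i. l $ i \<in> \<int>) \<and> norm1 l \<le> R} \<subseteq> vec_lambda ` (PiE UNIV (\<lambda>_. ?S))"
  proof
    fix l :: "real^'m" assume "l \<in> {l. (\<forall>i. l $ i \<in> \<int>) \<and> norm1 l \<le> R}"
    then have "vec_nth l \<in> PiE UNIV (\<lambda>_. ?S)" using nth_le_norm1[of l] by (auto intro: order_trans)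
    then show "l \<in> vec_lambda ` (PiE UNIV (\<lambda>_. ?S))" by (intro image_eqI[of _ _ "vec_nth l"]) auto
  qed
  show "finite (vec_lambda ` (PiE UNIV (\<lambda>_::'m. ?S)))"
    by (intro finite_imageI finite_PiE finite_abs_int_segment) auto
qed

context
  fixes I :: "'n::finite set" and W :: "real^'n^'m::finite"
  assumes W: "\<And>i j. W $ i $ j \<in> \<int>"
    and full: "\<And>s. \<exists>y\<in>Y I. W *v y = s"
begin

text \<open>
  Removing the integer parts of the components of some feasible point changes the right-hand side by
  one of finitely many integer vectors.
\<close>

lemma bounded_feasible:
  shows "\<exists>D. \<forall>r::real^'m. norm1 r \<le> R \<longrightarrow> (\<exists>y\<in>Y I. W *v y = r \<and> norm1 y \<le> D)"
proof -
  \<comment> \<open>Bounds \<open>r - W *v y\<close> when the components of \<open>y\<close> lie in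
    [0, 1).\<close>
  define R' where "R' = R + (\<Sum>i\<in>UNIV. norm1 (W $ i)) * CARD('n)"
  define L where "L = {l :: real^'m. (\<forall>i. l $ i \<in> \<int>) \<and> norm1 l \<le> R'}"
  obtain sel where sel: "\<And>s. sel s \<in> Y I" "\<And>s. W *v sel s = s" using full by metis
  have finL: "finite L" unfolding L_def by (rule finite_Ints_vec)
  show ?thesis
  proof (intro exI allI impI)
    fix r :: "real^'m" assume r: "norm1 r \<le> R"
    define y where "y = (\<chi> j. frac (sel r $ j))"
    have y1: "norm1 y \<le> CARD('n)"
    proof -
      have "norm1 y \<le> (\<Sum>j\<in>(UNIV::'n set). 1)"
        unfolding norm1_def by (intro sum_mono) (auto simp: y_def frac_lt_1 less_imp_le)
      then show ?thesis by simp
    qed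
    let ?l = "r - W *v y"
    have "?l = W *v (sel r - y)" by (simp add: matrix_vector_mult_diff_distrib sel)
    moreover have "sel r - y = (\<chi> j. of_int \<lfloor>sel r $ j\<rfloor>)" by (simp add: y_def vec_eq_iff frac_def)
    ultimately have "?l $ i \<in> \<int>" for i
      using W by (auto simp: matrix_vector_mult_def intro!: Ints_sum Ints_mult)
    moreover have "norm1 ?l \<le> norm1 r + norm1 (W *v y)"
      using norm1_triangle[of r "- (W *v y)"] by (simp add: norm1_def)
    moreover have "norm1 (W *v y) \<le> (\<Sum>i\<in>UNIV. norm1 (W $ i)) * CARD('n)"
      by (intro order_trans[OF norm1_mult_le] mult_left_mono y1 sum_nonneg) auto
    ultimately have l: "?l \<in> L" using r by (auto simp: L_def R'_def)
    \<comment> \<open>The fractional part of an integer is 0, so \<open>y\<close> vanishes on the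
      integer variables.\<close>
    have "y + sel ?l \<in> Y I"
      using sel(1)[of ?l] sel(1)[of r] by (auto simp: Y_def y_def frac_eq_0_iff[THEN iffD2] intro!: add_nonneg_nonneg)
    moreover have "W *v (y + sel ?l) = r" by (simp add: matrix_vector_right_distrib sel)
    moreover have "norm1 (y + sel ?l) \<le> CARD('n) + (\<Sum>l\<in>L. norm1 (sel l))"
      using norm1_triangle[of y "sel ?l"] y1 member_le_sum[of ?l L "\<lambda>l. norm1 (sel l)", OF l] finL by simp
    ultimately show "\<exists>y\<in>Y I. W *v y = r \<and> norm1 y \<le> CARD('n) + (\<Sum>l\<in>L. norm1 (sel l))" by blast
  qed
qed

text \<open>For points of \<open>Y I\<close>, multiples of negative cost would drive the value at 0
  to -\<infinity>. For real \<open>y\<close>, the multiple \<open>n\<close> times \<open>y\<close>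
  is rounded down and the remainder exchanged for a feasible point of bounded norm, which gives a
  point of \<open>Y I\<close> with right-hand side 0. Its cost differs from that of the multiple by
  an amount bounded uniformly in \<open>n\<close>.\<close>

lemma recession_cost_nonneg:
  assumes q: "-\<infinity> < value_function I W q 0" and y: "\<And>j. 0 \<le> y $ j" "W *v y = 0"
  shows "0 \<le> q \<bullet> y"
proof -
  have Ycost: "0 \<le> q \<bullet> z" if z: "z \<in> Y I" "W *v z = 0" for z
  proof (rule ccontr)
    assume neg: "\<not> 0 \<le> q \<bullet> z"
    have le: "value_function I W q 0 \<le> ereal (of_nat n * (q \<bullet> z))" for n :: nat
      unfolding value_function_def using z
      by (intro INF_lower2[of "of_nat n *\<^sub>R z"]) (auto simp: Y_def matrix_vector_mult_scaleR intro!: Ints_mult)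
    have "value_function I W q 0 = -\<infinity>"
    proof (rule ereal_bot)
      fix B :: real
      obtain n :: nat where "- B / - (q \<bullet> z) < of_nat n" using reals_Archimedean2 by blast
      then have "of_nat n * (q \<bullet> z) \<le> B" using neg by (simp add: pos_divide_less_eq field_simps)
      with le[of n] show "value_function I W q 0 \<le> ereal B" by (meson ereal_less_eq(3) order_trans)
    qed
    with q show False by simp
  qed
  obtain D where D: "\<And>r. norm1 r \<le> (\<Sum>i\<in>UNIV. norm1 (W $ i)) * CARD('n) \<Longrightarrow> \<exists>y\<in>Y I. W *v y = r \<and> norm1 y \<le> D"
    using bounded_feasible by metis
  \<comment> \<open>Bounds the cost of exchanging the remainder \<open>fr\<close> for
    \<open>z\<close>, independently of \<open>n\<close>.\<close>
  define c where "c = norm1 q * (D + CARD('n))"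
  have "- c \<le> of_nat n * (q \<bullet> y)" for n :: nat
  proof -
    define fl where "fl = (\<chi> j. real_of_int \<lfloor>of_nat n * y $ j\<rfloor>)"
    define fr where "fr = (\<chi> j. frac (of_nat n * y $ j))"
    have sum: "of_nat n *\<^sub>R y = fl + fr" by (simp add: fl_def fr_def vec_eq_iff frac_def)
    have fr1: "norm1 fr \<le> CARD('n)"
    proof -
      have "norm1 fr \<le> (\<Sum>j\<in>(UNIV::'n set). 1)"
        unfolding norm1_def by (intro sum_mono) (auto simp: fr_def frac_lt_1 less_imp_le)
      then show ?thesis by simp
    qed
    have "norm1 (W *v fr) \<le> (\<Sum>i\<in>UNIV. norm1 (W $ i)) * CARD('n)"
      by (intro order_trans[OF norm1_mult_le] mult_left_mono fr1 sum_nonneg) auto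
    from D[OF this] obtain z where z: "z \<in> Y I" "W *v z = W *v fr" "norm1 z \<le> D" by blast
    have "fl + z \<in> Y I"
      using z(1) y(1) by (auto simp: Y_def fl_def)
    moreover have "W *v (fl + z) = 0"
      using z(2) y(2) sum by (metis matrix_vector_mult_scaleR matrix_vector_right_distrib scaleR_zero_right)
    ultimately have "0 \<le> q \<bullet> (fl + z)" by (rule Ycost)
    also have "\<dots> = of_nat n * (q \<bullet> y) + q \<bullet> z - q \<bullet> fr"
      using sum by (metis add_diff_cancel_right' inner_add_right inner_diff_right inner_scaleR_right add.commute add_diff_eq)
    finally have "0 \<le> of_nat n * (q \<bullet> y) + q \<bullet> z - q \<bullet> fr" .
    moreover have "q \<bullet> z \<le> norm1 q * D"
      using inner_le_norm1[of q z] mult_left_mono[OF z(3), of "norm1 q"] by simp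
    moreover have "- (q \<bullet> fr) \<le> norm1 q * CARD('n)"
      using inner_le_norm1[of q fr] mult_left_mono[OF fr1, of "norm1 q"] by simp
    ultimately show ?thesis by (simp add: c_def algebra_simps)
  qed
  then have *: "of_nat n * (- (q \<bullet> y)) \<le> c" for n :: nat by (simp add: minus_le_iff)
  show ?thesis
  proof (rule ccontr)
    assume "\<not> 0 \<le> q \<bullet> y"
    then obtain n :: nat where "c < of_nat n * (- (q \<bullet> y))"
      using reals_Archimedean3[of "- (q \<bullet> y)"] by auto
    with *[of n] show False by simp
  qed
qed


end

section \<open>Optimal bases of the linear relaxation\<close>

lemma mult_uminus: "A *v (- x) = - (A *v x)" for A :: "real^'n::finite^'m"
  using matrix_vector_mult_diff_distrib[of A 0 x] by simp

context
  fixes W :: "real^'n::finite^'m::finite" and q :: "real^'n"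
  assumes rec: "\<And>y. (\<And>j. 0 \<le> y $ j) \<Longrightarrow> W *v y = 0 \<Longrightarrow> 0 \<le> q \<bullet> y"
begin

text \<open>While the columns of the support are dependent, move along a kernel direction supported
  there on which the cost does not increase, until a component vanishes. The hypothesis on recession
  directions provides such a direction with a negative component, so that the move ends.\<close>

lemma basic_solution_le:
  assumes "\<And>j. 0 \<le> y $ j"
  shows "\<exists>y'. (\<forall>j. 0 \<le> y' $ j) \<and> W *v y' = W *v y \<and> q \<bullet> y' \<le> q \<bullet> y \<and>
    (\<forall>d. {j. d $ j \<noteq> 0} \<subseteq> {j. y' $ j \<noteq> 0} \<longrightarrow> W *v d = 0 \<longrightarrow> d = 0)"
  using assms
proof (induction "card {j. y $ j \<noteq> 0}" arbitrary: y rule: less_induct)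
  case less
  let ?S = "{j. y $ j \<noteq> 0}"
  show ?case
  proof (cases "\<forall>d. {j. d $ j \<noteq> 0} \<subseteq> ?S \<longrightarrow> W *v d = 0 \<longrightarrow> d = 0")
    case True
    then show ?thesis using less.prems by blast
  next
    case False
    then obtain d0 where d0: "{j. d0 $ j \<noteq> 0} \<subseteq> ?S" "W *v d0 = 0" "d0 \<noteq> 0" by blast
    \<comment> \<open>The sign of \<open>d0\<close> is free. A direction of negative cost has a
      negative component by \<open>rec\<close>; and if \<open>d0\<close> is nonnegative,
      \<open>rec\<close> shows that \<open>- d0\<close> does not increase the cost.\<close>
    have "\<exists>d. {j. d $ j \<noteq> 0} \<subseteq> ?S \<and> W *v d = 0 \<and> q \<bullet> d \<le> 0 \<and> (\<exists>j. d $ j < 0)"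
    proof (cases "\<exists>j. d0 $ j < 0")
      case neg: True
      show ?thesis
      proof (cases "q \<bullet> d0 \<le> 0")
        case False
        have Wneg: "W *v (- d0) = 0" using d0(2) by (simp add: mult_uminus)
        then have "\<exists>j. (- d0) $ j < 0" using rec[of "- d0"] False by (force simp: not_le)
        then show ?thesis using False d0(1) Wneg by (intro exI[of _ "- d0"]) auto
      qed (use neg d0 in blast)
    next
      case False
      then have "0 \<le> d0 $ j" for j by (simp add: not_less)
      then have "0 \<le> q \<bullet> d0" using rec d0(2) by blast
      moreover obtain j where "d0 $ j \<noteq> 0" using d0(3) by (auto simp: vec_eq_iff)
      then have "(- d0) $ j < 0" using \<open>\<And>j. 0 \<le> d0 $ j\<close>[of j] by simp
      moreover have "W *v (- d0) = 0" using d0(2) by (simp add: mult_uminus)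
      ultimately show ?thesis using d0(1) by (intro exI[of _ "- d0"]) auto
    qed
    then obtain d where d: "{j. d $ j \<noteq> 0} \<subseteq> ?S" "W *v d = 0" "q \<bullet> d \<le> 0" and neg: "\<exists>j. d $ j < 0" by blast
    \<comment> \<open>Ratio test: the longest step that keeps \<open>y\<close> nonnegative, at which
      a minimizing component becomes 0.\<close>
    define t where "t = Min ((\<lambda>j. y $ j / - d $ j) ` {j. d $ j < 0})"
    have "t \<in> (\<lambda>j. y $ j / - d $ j) ` {j. d $ j < 0}"
      unfolding t_def using neg by (intro Min_in) auto
    then obtain k where k: "d $ k < 0" "t = y $ k / - d $ k" by blast
    have t_le: "t \<le> y $ j / - d $ j" if "d $ j < 0" for j
      unfolding t_def using that by (intro Min_le) auto
    have t0: "0 \<le> t" using k less.prems[of k] divide_nonneg_pos[of "y $ k" "- d $ k"] by simp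
    let ?y = "y + t *\<^sub>R d"
    have nn: "0 \<le> ?y $ j" for j
    proof (cases "d $ j < 0")
      case True
      then show ?thesis using iffD1[OF pos_le_divide_eq t_le[OF True]] True by simp
    next
      case False
      then show ?thesis using less.prems[of j] t0 by simp
    qed
    have "{j. ?y $ j \<noteq> 0} \<subset> ?S"
    proof
      show "{j. ?y $ j \<noteq> 0} \<subseteq> ?S" using d(1) by auto
      have "?y $ k = 0" using k by simp
      moreover have "k \<in> ?S" using subsetD[OF d(1), of k] k(1) by simp
      ultimately show "{j. ?y $ j \<noteq> 0} \<noteq> ?S" by blast
    qed
    then have "card {j. ?y $ j \<noteq> 0} < card ?S" by (intro psubset_card_mono) auto
    from less.hyps[OF this nn] obtain y' where y': "\<forall>j. 0 \<le> y' $ j" "W *v y' = W *v ?y" "q \<bullet> y' \<le> q \<bullet> ?y"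
      "\<forall>d. {j. d $ j \<noteq> 0} \<subseteq> {j. y' $ j \<noteq> 0} \<longrightarrow> W *v d = 0 \<longrightarrow> d = 0" by blast
    moreover have "W *v ?y = W *v y" using d(2) by (simp add: matrix_vector_right_distrib matrix_vector_mult_scaleR)
    moreover have "q \<bullet> ?y \<le> q \<bullet> y" using d(3) t0 by (simp add: inner_add_right mult_nonneg_nonpos)
    ultimately show ?thesis by (intro exI[of _ y']) auto
  qed
qed

text \<open>A basic solution is determined by its support, so there are finitely many of them; the
  best one is optimal because every feasible point is dominated by a basic solution.\<close>

lemma optimal_basic_solution:
  assumes "\<And>j. 0 \<le> y0 $ j" "W *v y0 = s"
  obtains y where "\<And>j. 0 \<le> y $ j" "W *v y = s"
    "\<And>d. {j. d $ j \<noteq> 0} \<subseteq> {j. y $ j \<noteq> 0} \<Longrightarrow> W *v d = 0 \<Longrightarrow> d = 0"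
    "\<And>z. (\<And>j. 0 \<le> z $ j) \<Longrightarrow> W *v z = s \<Longrightarrow> q \<bullet> y \<le> q \<bullet> z"
proof -
  define B where "B = {y. (\<forall>j. 0 \<le> y $ j) \<and> W *v y = s \<and>
    (\<forall>d. {j. d $ j \<noteq> 0} \<subseteq> {j. y $ j \<noteq> 0} \<longrightarrow> W *v d = 0 \<longrightarrow> d = 0)}"
  have "inj_on (\<lambda>y. {j. y $ j \<noteq> 0}) B"
  proof (rule inj_onI)
    fix y z assume y: "y \<in> B" and z: "z \<in> B" and eq: "{j. y $ j \<noteq> 0} = {j. z $ j \<noteq> 0}"
    have "y $ j \<noteq> 0 \<longleftrightarrow> z $ j \<noteq> 0" for j using eq by (simp add: set_eq_iff)
    then have "{j. (y - z) $ j \<noteq> 0} \<subseteq> {j. y $ j \<noteq> 0}"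
      unfolding subset_iff mem_Collect_eq vector_minus_component by (metis diff_self)
    moreover have "W *v (y - z) = 0" using y z by (simp add: B_def matrix_vector_mult_diff_distrib)
    ultimately have "y - z = 0" using y unfolding B_def mem_Collect_eq by blast
    then show "y = z" by simp
  qed
  then have fin: "finite B" by (rule finite_imageD[rotated]) (rule finite_subset[of _ UNIV], auto)
  have dominated: "\<exists>y\<in>B. q \<bullet> y \<le> q \<bullet> z" if "\<And>j. 0 \<le> z $ j" "W *v z = s" for z
    using basic_solution_le[of z] that by (auto simp: B_def)
  then have "B \<noteq> {}" using assms by blast
  with fin have "Min ((\<lambda>y. q \<bullet> y) ` B) \<in> (\<lambda>y. q \<bullet> y) ` B" by (intro Min_in) auto
  then obtain y where y: "y \<in> B" "Min ((\<lambda>y. q \<bullet> y) ` B) = q \<bullet> y" by blast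
  have min: "q \<bullet> y \<le> q \<bullet> z" if "z \<in> B" for z
    unfolding y(2)[symmetric] using fin that by (intro Min_le) auto
  show ?thesis
  proof (rule that[of y])
    fix z :: "real^'n" assume "\<And>j. 0 \<le> z $ j" "W *v z = s"
    from dominated[OF this] show "q \<bullet> y \<le> q \<bullet> z" using min by force
  qed (use y(1) in \<open>auto simp: B_def\<close>)
qed

text \<open>Genericity of \<open>s\<close> excludes degenerate basic solutions, for which optimality need not give dual feasibility.\<close>

lemma optimal_basis_generic:
  assumes feas: "\<And>j. 0 \<le> y0 $ j" "W *v y0 = s"
    and generic: "\<And>J. card J < CARD('m) \<Longrightarrow> s \<notin> span ((\<lambda>j. column j W) ` J)"
  shows "\<exists>b\<in>dual_feasible W q. \<forall>i. 0 \<le> (matrix_inv (basis_matrix W b) *v s) $ i"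
proof -
  obtain y where y: "\<And>j. 0 \<le> y $ j" "W *v y = s"
    and indep: "\<And>d. {j. d $ j \<noteq> 0} \<subseteq> {j. y $ j \<noteq> 0} \<Longrightarrow> W *v d = 0 \<Longrightarrow> d = 0"
    and opt: "\<And>z. (\<And>j. 0 \<le> z $ j) \<Longrightarrow> W *v z = s \<Longrightarrow> q \<bullet> y \<le> q \<bullet> z"
    using optimal_basic_solution[OF feas] by blast
  let ?S = "{j. y $ j \<noteq> 0}"
  have "s = (\<Sum>j\<in>UNIV. y $ j *\<^sub>R column j W)"
    using y(2) by (simp add: matrix_mult_sum scalar_mult_eq_scaleR)
  also have "\<dots> = (\<Sum>j\<in>?S. y $ j *\<^sub>R column j W)"
    by (rule sum.mono_neutral_right) auto
  also have "\<dots> \<in> span ((\<lambda>j. column j W) ` ?S)"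
    by (intro span_sum span_scale span_base) auto
  finally have "CARD('m) \<le> card ?S" using generic[of ?S] by (meson not_le)
  then obtain T where T: "T \<subseteq> ?S" "card T = CARD('m)" by (meson obtain_subset_with_card_n)
  then obtain b where b: "bij_betw b (UNIV :: 'm set) T"
    using bij_betw_iff_card[of "UNIV :: 'm set" T] by (auto simp: finite_subset[of T UNIV])
  have injb: "inj b" and rangeb: "range b = T" using b by (auto simp: bij_betw_def)
  let ?B = "basis_matrix W b" and ?A = "matrix_inv (basis_matrix W b)"
  have supp: "{j. basis_embed b x $ j \<noteq> 0} \<subseteq> T" for x
    using embed_nonbasis[of _ b x] by (auto simp: rangeb)
  have "x = 0" if "?B *v x = 0" for x
  proof -
    have "basis_embed b x = 0"
      using indep[of "basis_embed b x"] supp[of x] T that by (auto simp: mult_embed)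
    then show ?thesis using embed_basis[OF injb, of x] by (simp add: vec_eq_iff)
  qed
  then have inv: "invertible ?B" by (simp add: invertible_left_inverse matrix_left_invertible_ker)
  have BA: "?B *v (?A *v x) = x" for x
    using inv by (simp add: matrix_vector_mul_assoc matrix_inv_right)
  have AB: "?A *v (?B *v x) = x" for x
    using inv by (simp add: matrix_vector_mul_assoc matrix_inv_left)
  \<comment> \<open>The edge direction that raises variable \<open>j\<close> by 1 and lets the basic
    variables compensate; its cost is the reduced cost of \<open>j\<close>.\<close>
  define d where "d j = axis j 1 - basis_embed b (?A *v column j W)" for j
  have Wd: "W *v d j = 0" for j
    by (simp add: d_def matrix_vector_mult_diff_distrib mult_embed BA matrix_vector_mult_basis)
  \<comment> \<open>A further column in the support would depend on the columns of \<open>T\<close>,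
    through \<open>d j\<close>, against the independence of the support columns.\<close>
  have ST: "?S = T"
  proof (rule ccontr)
    assume "?S \<noteq> T"
    then obtain j where j: "j \<in> ?S" "j \<notin> T" using T by blast
    have "{k. d j $ k \<noteq> 0} \<subseteq> ?S" using supp T(1) j(1) by (auto simp: d_def axis_def split: if_splits)
    with indep Wd have "d j = 0" by blast
    moreover have "d j $ j = 1" using j(2) by (simp add: d_def embed_nonbasis rangeb)
    ultimately show False by simp
  qed
  define x where "x = (\<chi> i. y $ b i)"
  have yx: "y = basis_embed b x"
  proof (rule vec_eq_iff[THEN iffD2, rule_format])
    fix j show "y $ j = basis_embed b x $ j"
    proof (cases "j \<in> range b")
      case True
      then show ?thesis by (auto simp: x_def embed_basis[OF injb])
    next
      case False
      then have "j \<notin> ?S" using ST rangeb by simp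
      with False show ?thesis by (simp add: embed_nonbasis)
    qed
  qed
  have Bx: "?B *v x = s" using y(2) by (simp add: yx mult_embed)
  then have As: "?A *v s = x" using AB by blast
  have xpos: "0 < x $ i" for i
    using ST rangeb y(1)[of "b i"] by (auto simp: x_def less_le)
  have "0 \<le> red_cost W q b $ j" for j
  proof (cases "j \<in> range b")
    case True
    then show ?thesis using red_cost_basis[OF inv] by auto
  next
    case False
    define c where "c = ?A *v column j W"
    \<comment> \<open>A step that keeps all basic variables nonnegative. The 1 in the denominator
      spares a case distinction on \<open>c $ i\<close>, and \<open>t\<close> is positive because
      genericity made every \<open>x $ i\<close> positive.\<close>
    define t where "t = Min (range (\<lambda>i. x $ i / (1 + \<bar>c $ i\<bar>)))"
    have "t \<in> range (\<lambda>i. x $ i / (1 + \<bar>c $ i\<bar>))" unfolding t_def by (intro Min_in) auto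
    then have t0: "0 < t" using xpos by (auto intro!: divide_pos_pos)
    have tc: "t * c $ i \<le> x $ i" for i
    proof -
      have "t \<le> x $ i / (1 + \<bar>c $ i\<bar>)" unfolding t_def by (intro Min_le) auto
      then have "t * (1 + \<bar>c $ i\<bar>) \<le> x $ i" by (simp add: pos_le_divide_eq)
      moreover have "t * c $ i \<le> t * (1 + \<bar>c $ i\<bar>)" using t0 by (intro mult_left_mono) auto
      ultimately show ?thesis by simp
    qed
    have "q \<bullet> y \<le> q \<bullet> (y + t *\<^sub>R d j)"
    proof (rule opt)
      show "W *v (y + t *\<^sub>R d j) = s"
        by (simp add: matrix_vector_right_distrib matrix_vector_mult_scaleR Wd y(2))
      fix k show "0 \<le> (y + t *\<^sub>R d j) $ k"
      proof (cases "k \<in> range b")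
        case True
        then obtain i where k: "k = b i" by blast
        then have "k \<noteq> j" using False by auto
        then show ?thesis using tc[of i]
          by (simp add: k yx d_def embed_basis[OF injb] c_def[symmetric] axis_def algebra_simps)
      next
        case False
        then show ?thesis using t0 by (simp add: yx d_def embed_nonbasis axis_def)
      qed
    qed
    then have "0 \<le> q \<bullet> d j" using t0 by (simp add: inner_add_right zero_le_mult_iff)
    also have "q \<bullet> d j = red_cost W q b \<bullet> axis j 1 - red_cost W q b \<bullet> basis_embed b c"
      by (simp add: inner_eq_lam_plus_red_cost[of q _ W b] Wd) (simp add: d_def c_def inner_diff_right)
    also have "red_cost W q b \<bullet> basis_embed b c = 0"
      using inner_embed[OF inv, of q c] inner_eq_lam_plus_red_cost[of q "basis_embed b c" W b]
      by (simp add: mult_embed)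
    finally show ?thesis by (simp add: inner_axis)
  qed
  then have "b \<in> dual_feasible W q" using inv by (simp add: dual_feasible_iff)
  then show ?thesis using xpos by (intro bexI[of _ b]) (auto simp: As less_imp_le)
qed

text \<open>The covered right-hand sides form a finite union of closed cones, and the nongeneric
  ones lie in finitely many proper subspaces. The uncovered set is open and negligible, hence
  empty.\<close>

lemma optimal_basis:
  assumes feas: "\<And>s. \<exists>y. (\<forall>j. 0 \<le> y $ j) \<and> W *v y = s"
  shows "\<exists>b\<in>dual_feasible W q. \<forall>i. 0 \<le> (matrix_inv (basis_matrix W b) *v s) $ i"
proof -
  define C where "C = (\<Union>b\<in>dual_feasible W q. {s. \<forall>i. 0 \<le> (matrix_inv (basis_matrix W b) *v s) $ i})"
  define G where "G = (\<Union>J\<in>{J. card J < CARD('m)}. span ((\<lambda>j. column j W) ` J))"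
  have "closed C"
    unfolding C_def matrix_vector_mul_component
    by (intro closed_UN finite ballI closed_Collect_all closed_Collect_le continuous_intros)
  moreover have "negligible G"
    unfolding G_def
  proof (rule negligible_Union, safe)
    fix J :: "'n set" assume J: "card J < CARD('m)"
    have "dim (span ((\<lambda>j. column j W) ` J)) \<le> card ((\<lambda>j. column j W) ` J)"
      by (simp add: dim_le_card')
    also have "\<dots> < DIM(real^'m)" using J card_image_le[of J "\<lambda>j. column j W"] by simp
    finally show "negligible (span ((\<lambda>j. column j W) ` J))" by (rule negligible_lowdim)
  qed auto
  moreover have "- C \<subseteq> G"
  proof
    fix s assume "s \<in> - C"
    show "s \<in> G"
    proof (rule ccontr)
      assume "s \<notin> G"
      then have "\<And>J. card J < CARD('m) \<Longrightarrow> s \<notin> span ((\<lambda>j. column j W) ` J)" by (auto simp: G_def)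
      moreover obtain y where "\<And>j. 0 \<le> y $ j" "W *v y = s" using feas[of s] by blast
      ultimately have "s \<in> C" using optimal_basis_generic by (fastforce simp: C_def)
      with \<open>s \<in> - C\<close> show False by simp
    qed
  qed
  ultimately have "- C = {}"
    using open_not_negligible[of "- C"] negligible_subset by (auto simp: open_closed)
  then show ?thesis by (auto simp: C_def)
qed


end

section \<open>Measurability and periodic functions\<close>

text \<open>The sublevel sets are projections of countable unions of compact sets.\<close>

lemma borel_measurable_INF_fibre:
  fixes W :: "real^'n::finite^'m::finite"
  assumes C: "closed C"
  shows "(\<lambda>z. INF y\<in>{y\<in>C. W *v y = snd z}. ereal (fst z \<bullet> y)) \<in> borel_measurable borel"
proof (rule borel_measurableI_less)
  fix a :: ereal
  let ?g = "\<lambda>z :: (real^'n) \<times> (real^'n). (fst z, W *v snd z)"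
  let ?U = "{z :: (real^'n) \<times> (real^'n). ereal (fst z \<bullet> snd z) < a}"
  have "open ?U" by (intro open_Collect_less continuous_intros)
  from open_countable_Union_open_cbox[OF this]
  obtain D where D: "countable D" "D \<subseteq> Pow ?U" "\<And>X. X \<in> D \<Longrightarrow> \<exists>a b. X = cbox a b" "\<Union>D = ?U"
    by blast
  have *: "{z \<in> space borel. (INF y\<in>{y\<in>C. W *v y = snd z}. ereal (fst z \<bullet> y)) < a}
      = (\<Union>X\<in>D. ?g ` (X \<inter> UNIV \<times> C))"
  proof -
    have "{z \<in> space borel. (INF y\<in>{y\<in>C. W *v y = snd z}. ereal (fst z \<bullet> y)) < a}
        = ?g ` (?U \<inter> UNIV \<times> C)"
    proof (intro set_eqI iffI)
      fix z assume "z \<in> {z \<in> space borel. (INF y\<in>{y\<in>C. W *v y = snd z}. ereal (fst z \<bullet> y)) < a}"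
      then obtain y where "y \<in> C" "W *v y = snd z" "ereal (fst z \<bullet> y) < a" by (auto simp: INF_less_iff)
      then show "z \<in> ?g ` (?U \<inter> UNIV \<times> C)" by (intro image_eqI[of _ _ "(fst z, y)"]) auto
    qed (auto simp: INF_less_iff)
    also have "\<dots> = (\<Union>X\<in>D. ?g ` (X \<inter> UNIV \<times> C))" by (subst D(4)[symmetric]) blast
    finally show ?thesis .
  qed
  show "{z \<in> space borel. (INF y\<in>{y\<in>C. W *v y = snd z}. ereal (fst z \<bullet> y)) < a} \<in> sets borel"
    unfolding *
  proof (rule sets.countable_UN''[OF D(1)])
    fix X assume "X \<in> D"
    then obtain a b where "X = cbox a b" using D(3) by blast
    then have "compact (X \<inter> UNIV \<times> C)"
      by (intro compact_Int_closed closed_Times closed_UNIV C) auto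
    moreover have "continuous_on (X \<inter> UNIV \<times> C) ?g"
      by (intro continuous_intros linear_continuous_on_compose[OF _ matrix_vector_mul_linear])
    ultimately show "?g ` (X \<inter> UNIV \<times> C) \<in> sets borel"
      by (intro borel_compact compact_continuous_image)
  qed
qed

lemma closed_mixed_integer: "closed {y :: real^'n::finite. (\<forall>j\<in>I. y $ j \<in> \<int>) \<and> (\<forall>j\<in>J. 0 \<le> y $ j)}"
proof -
  have "{y :: real^'n. (\<forall>j\<in>I. y $ j \<in> \<int>) \<and> (\<forall>j\<in>J. 0 \<le> y $ j)}
      = (\<Inter>j\<in>I. (\<lambda>y. y $ j) -` \<int>) \<inter> (\<Inter>j\<in>J. {y. 0 \<le> y $ j})" by auto
  also have "closed \<dots>"
    by (intro closed_Int closed_INT ballI closed_vimage closed_Ints closed_Collect_le continuous_intros)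
  finally show ?thesis .
qed

lemma measurable_value_function:
  fixes W :: "real^'n::finite^'m::finite"
  shows "(\<lambda>z. value_function I W (fst z) (snd z)) \<in> borel_measurable borel"
  using borel_measurable_INF_fibre[OF closed_mixed_integer[of I UNIV], of W]
  by (simp add: value_function_def Y_def)

lemma measurable_gomory_value:
  fixes W :: "real^'n::finite^'m::finite"
  shows "(\<lambda>z. gomory_value I W (fst z) b (snd z)) \<in> borel_measurable borel"
  using borel_measurable_INF_fibre[OF closed_mixed_integer[of I "- range b"], of W]
  by (simp add: gomory_value_def conj_assoc Ball_def)

section \<open>Lattice points in cubes and integrals of periodic functions\<close>

text \<open>Each coordinate runs through the lattice points of a half-open interval of length
  \<open>N * r\<close>, of which there are exactly \<open>N\<close> wherever the interval
  lies.\<close>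

lemma card_lattice_points:
  fixes r :: real
  assumes r: "0 < r" and N: "0 < (N::nat)"
  shows "finite {l :: int^'m::finite. \<forall>i. 0 \<le> c $ i - r * of_int (l $ i) \<and> c $ i - r * of_int (l $ i) < of_nat N * r}" (is "finite ?L")
    and "card {l :: int^'m::finite. \<forall>i. 0 \<le> c $ i - r * of_int (l $ i) \<and> c $ i - r * of_int (l $ i) < of_nat N * r} = N ^ CARD('m)"
proof -
  have eq: "{l :: int^'m. \<forall>i. 0 \<le> c $ i - r * of_int (l $ i) \<and> c $ i - r * of_int (l $ i) < of_nat N * r}
      = vec_lambda ` (PiE UNIV (\<lambda>i. {\<lfloor>c $ i / r\<rfloor> - int N + 1 .. \<lfloor>c $ i / r\<rfloor>}))"
    (is "?L = vec_lambda ` ?P")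
  proof -
    have *: "0 \<le> x - r * of_int k \<and> x - r * of_int k < of_nat N * r \<longleftrightarrow> k \<in> {\<lfloor>x / r\<rfloor> - int N + 1 .. \<lfloor>x / r\<rfloor>}"
      for x :: real and k :: int
    proof -
      have "0 \<le> x - r * of_int k \<and> x - r * of_int k < of_nat N * r
          \<longleftrightarrow> of_int k \<le> x / r \<and> x / r < of_int (k + int N)"
        using r by (simp add: pos_le_divide_eq pos_divide_less_eq algebra_simps)
      also have "\<dots> \<longleftrightarrow> k \<le> \<lfloor>x / r\<rfloor> \<and> \<lfloor>x / r\<rfloor> < k + int N"
        by (simp only: le_floor_iff floor_less_iff)
      finally show ?thesis by auto
    qed
    show ?thesis
    proof (intro set_eqI iffI)
      fix l assume "l \<in> ?L"
      then have "vec_nth l \<in> ?P" using * by (simp add: PiE_iff)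
      then show "l \<in> vec_lambda ` ?P" by (intro image_eqI[of _ _ "vec_nth l"]) auto
    qed (use * in \<open>auto simp: PiE_iff\<close>)
  qed
  have inj: "inj_on vec_lambda ?P" by (rule inj_onI) (metis vec_lambda_inverse UNIV_I)
  show "finite ?L" unfolding eq by (intro finite_imageI finite_PiE) auto
  show "card ?L = N ^ CARD('m)"
    unfolding eq using N by (subst card_image[OF inj]) (simp add: card_PiE)
qed

text \<open>Half-open, so that its translates by the lattice of step \<open>r\<close> tile the space
  without overlap.\<close>

definition cube :: "real \<Rightarrow> (real^'m) set" where
  "cube r = {u. \<forall>i. 0 \<le> u $ i \<and> u $ i < r}"

lemma cube_sets [measurable]: "(cube r :: (real^'m::finite) set) \<in> sets borel"
  unfolding cube_def by measurable

text \<open>Unfolding over the lattice of step \<open>r\<close>: the cube of side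
  \<open>N * r\<close>, however placed, contains \<open>N ^ CARD('m)\<close> representatives of
  every class modulo the lattice. The reflected argument \<open>a - u\<close> is the form in which
  averaged errors appear later, and Lebesgue measure is invariant under the reflection.\<close>

lemma nn_integral_periodic:
  fixes g :: "real^'m::finite \<Rightarrow> ennreal"
  assumes [measurable]: "g \<in> borel_measurable borel"
    and per: "\<And>x w. (\<And>i. w $ i \<in> \<int>) \<Longrightarrow> g (x + r *\<^sub>R w) = g x"
    and r: "0 < r" and N: "0 < (N::nat)"
  shows "(\<integral>\<^sup>+u. indicator (cube (of_nat N * r)) u * g (a - u) \<partial>lborel)
    = of_nat (N ^ CARD('m)) * (\<integral>\<^sup>+u. indicator (cube r) u * g u \<partial>lborel)"
proof -
  let ?\<tau> = "\<lambda>l :: int^'m. r *\<^sub>R (\<chi> i. of_int (l $ i))"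
  let ?F = "\<lambda>x. indicator (cube (of_nat N * r)) (a - x) * g x"
  have count: "(\<integral>\<^sup>+l. indicator (cube (of_nat N * r)) (c - ?\<tau> l) \<partial>count_space UNIV) = (of_nat (N ^ CARD('m)) :: ennreal)"
    if "0 < N" for c and N :: nat
  proof -
    let ?L = "{l :: int^'m. \<forall>i. 0 \<le> c $ i - r * of_int (l $ i) \<and> c $ i - r * of_int (l $ i) < of_nat N * r}"
    have "(\<integral>\<^sup>+l. indicator (cube (of_nat N * r)) (c - ?\<tau> l) \<partial>count_space UNIV)
        = (\<integral>\<^sup>+l. indicator ?L l \<partial>count_space UNIV)"
      by (intro nn_integral_cong) (auto simp: indicator_def cube_def)
    also have "\<dots> = emeasure (count_space UNIV) ?L" by simp
    also have "\<dots> = of_nat (N ^ CARD('m))"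
      using card_lattice_points[OF r that, of c] by (subst emeasure_count_space_finite) auto
    finally show ?thesis .
  qed
  have "(\<integral>\<^sup>+u. indicator (cube (of_nat N * r)) u * g (a - u) \<partial>lborel)
      = (\<integral>\<^sup>+x. ?F x \<partial>distr lborel borel (\<lambda>u. a - u))"
    by (subst nn_integral_distr) auto
  also have "distr lborel borel (\<lambda>u. a - u) = lborel"
  proof -
    have "lborel = density (distr lborel borel (\<lambda>u. a + (-1) *\<^sub>R u)) (\<lambda>_. 1)"
      using lborel_affine[of "-1" a] by simp
    then show ?thesis by (simp add: density_1)
  qed
  also have "(\<integral>\<^sup>+x. ?F x \<partial>lborel)
      = (\<integral>\<^sup>+x. ?F x * (\<integral>\<^sup>+l. indicator (cube r) (x - ?\<tau> l) \<partial>count_space UNIV) \<partial>lborel)"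
    using count[of 1] by simp
  also have "\<dots> = (\<integral>\<^sup>+x. indicator (cube r) x * (\<integral>\<^sup>+l. ?F (x + ?\<tau> l) \<partial>count_space UNIV) \<partial>lborel)"
    by (rule nn_integral_unfold) measurable
  also have "\<dots> = (\<integral>\<^sup>+x. of_nat (N ^ CARD('m)) * (indicator (cube r) x * g x) \<partial>lborel)"
  proof (rule nn_integral_cong)
    fix x
    have "(\<integral>\<^sup>+l. ?F (x + ?\<tau> l) \<partial>count_space UNIV)
        = (\<integral>\<^sup>+l. g x * indicator (cube (of_nat N * r)) ((a - x) - ?\<tau> l) \<partial>count_space UNIV)"
      by (intro nn_integral_cong) (simp add: per mult.commute diff_diff_eq)
    also have "\<dots> = g x * of_nat (N ^ CARD('m))" by (simp only: nn_integral_cmult count[OF N] borel_measurable_count_space)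
    finally show "indicator (cube r) x * (\<integral>\<^sup>+l. ?F (x + ?\<tau> l) \<partial>count_space UNIV)
        = of_nat (N ^ CARD('m)) * (indicator (cube r) x * g x)"
      by (simp add: ac_simps)
  qed
  also have "\<dots> = of_nat (N ^ CARD('m)) * (\<integral>\<^sup>+u. indicator (cube r) u * g u \<partial>lborel)"
    by (rule nn_integral_cmult) measurable
  finally show ?thesis .
qed

text \<open>\<open>Gam\<close> integrates over a closed box whereas tiling needs half-open cubes;
  the two differ by faces of measure 0.\<close>

lemma nn_integral_cbox_eq_cube:
  fixes g :: "real^'m::finite \<Rightarrow> ennreal"
  assumes "0 \<le> r"
  shows "(\<integral>\<^sup>+u. indicator (cbox 0 (\<chi> i. r)) u * g u \<partial>lborel) = (\<integral>\<^sup>+u. indicator (cube r) u * g u \<partial>lborel)"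
proof (rule nn_integral_cong_AE)
  let ?c = "\<chi> i. r :: real^'m"
  have "emeasure lborel (cbox 0 ?c - box 0 ?c) = 0"
    using assms by (subst emeasure_Diff) (auto simp: emeasure_lborel_cbox_eq emeasure_lborel_box_eq box_subset_cbox)
  then have "AE u in lborel. u \<notin> cbox 0 ?c - box 0 ?c"
    by (intro AE_not_in null_setsI) auto
  then show "AE u in lborel. indicator (cbox 0 ?c) u * g u = indicator (cube r) u * g u"
  proof eventually_elim
    fix u assume "u \<notin> cbox 0 ?c - box 0 ?c"
    then have "u \<in> cbox 0 ?c \<longleftrightarrow> u \<in> cube r"
      by (auto simp: cube_def mem_box_cart less_imp_le)
    then show "indicator (cbox 0 ?c) u * g u = indicator (cube r) u * g u" by (simp add: indicator_def)
  qed
qed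

section \<open>The value function deep inside the cones\<close>

text \<open>Any positive common multiple would do. Noninvertible \<open>b\<close> are left out
  because their factor 0 would destroy positivity.\<close>

definition common_period :: "real^'n::finite^'m::finite \<Rightarrow> real" where
  "common_period W = (\<Prod>b\<in>{b. invertible (basis_matrix W b)}. period W b)"

lemma common_period_pos: "0 < common_period W"
  unfolding common_period_def by (intro prod_pos) (auto intro: period_pos)

lemma common_period_multiple:
  fixes W :: "real^'n::finite^'m::finite"
  assumes W: "\<And>i j. W $ i $ j \<in> \<int>" and inv: "invertible (basis_matrix W b)"
  obtains N :: nat where "0 < N" "common_period W = of_nat N * period W b"
proof -
  let ?S = "{b. invertible (basis_matrix W b)}"
  let ?r = "\<Prod>c\<in>?S - {b}. period W c"
  have eq: "common_period W = ?r * period W b"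
    using inv by (simp add: common_period_def prod.remove[of ?S b] mult.commute)
  have pos: "0 < ?r" by (intro prod_pos) (auto intro: period_pos)
  have "?r \<in> \<int>" by (intro Ints_prod period_Ints W)
  then obtain k where k: "?r = of_int k" by (auto elim: Ints_cases)
  then have "?r = of_nat (nat k)" "0 < nat k" using pos by auto
  with eq that show ?thesis by metis
qed

text \<open>The cost of the basic solution of \<open>k\<close> is computed with the reduced costs of
  \<open>k\<close>, which vanish on it, and with those of \<open>l\<close>. For dual feasible
  \<open>l\<close> the latter are nonnegative, so that \<open>k\<close> is ahead on its own
  cone.\<close>

lemma lam_inner_eq:
  assumes k: "invertible (basis_matrix W k)"
  shows "lam W q k \<bullet> s = lam W q l \<bullet> s + (\<Sum>i\<in>UNIV. (matrix_inv (basis_matrix W k) *v s) $ i * red_cost W q l $ k i)"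
proof -
  let ?x = "matrix_inv (basis_matrix W k) *v s"
  have Bx: "basis_matrix W k *v ?x = s" using k by (simp add: matrix_vector_mul_assoc matrix_inv_right)
  show ?thesis
    using inner_embed[OF k, of q ?x] inner_eq_lam_plus_red_cost[of q "basis_embed k ?x" W l]
    by (simp add: mult_embed inner_embed_sum[of "red_cost W q l"] Bx)
qed

text \<open>\<open>lam\<close> is linear in \<open>q\<close> for each \<open>b\<close>, and there
  are finitely many \<open>b\<close>.\<close>

lemma norm1_lam_le: "\<exists>K\<ge>0. \<forall>q b. norm1 (lam W q b) \<le> K * norm1 q"
  for W :: "real^'n::finite^'m::finite"
proof -
  let ?k = "\<lambda>b. \<Sum>i\<in>UNIV. norm1 (transpose (matrix_inv (basis_matrix W b)) $ i)"
  show ?thesis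
  proof (intro exI conjI allI)
    show "0 \<le> (\<Sum>b\<in>UNIV. ?k b) * CARD('m)" by (intro mult_nonneg_nonneg sum_nonneg) auto
    fix q :: "real^'n" and b :: "'m \<Rightarrow> 'n"
    have "norm1 (\<chi> j. q $ b j) \<le> (\<Sum>j\<in>(UNIV::'m set). norm1 q)"
      unfolding norm1_def[of "\<chi> j. q $ b j"] by (intro sum_mono) (simp add: nth_le_norm1)
    then have q: "norm1 (\<chi> j. q $ b j) \<le> CARD('m) * norm1 q" by simp
    have "norm1 (lam W q b) \<le> ?k b * norm1 (\<chi> j. q $ b j)"
      unfolding lam_def transpose_matrix_vector[symmetric] by (rule norm1_mult_le)
    also have "\<dots> \<le> (\<Sum>b\<in>UNIV. ?k b) * (CARD('m) * norm1 q)"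
      by (intro mult_mono q member_le_sum sum_nonneg) auto
    finally show "norm1 (lam W q b) \<le> (\<Sum>b\<in>UNIV. ?k b) * CARD('m) * norm1 q" by (simp add: mult.assoc)
  qed
qed

lemma sum_red_cost_le: "\<exists>K\<ge>0. \<forall>q b. (\<Sum>j\<in>UNIV. red_cost W q b $ j) \<le> K * norm1 q"
  for W :: "real^'n::finite^'m::finite"
proof -
  obtain K where K: "0 \<le> K" "\<And>q b. norm1 (lam W q b) \<le> K * norm1 q" using norm1_lam_le by blast
  let ?k = "\<Sum>i\<in>UNIV. norm1 (transpose W $ i)"
  have "(\<Sum>j\<in>UNIV. red_cost W q b $ j) \<le> (1 + ?k * K) * norm1 q" for q b
  proof -
    have "(\<Sum>j\<in>UNIV. red_cost W q b $ j) \<le> norm1 (red_cost W q b)"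
      unfolding norm1_def by (intro sum_mono) simp
    also have "\<dots> \<le> norm1 q + norm1 (lam W q b v* W)"
      using norm1_triangle[of q "- (lam W q b v* W)"] by (simp add: red_cost_def norm1_def)
    also have "norm1 (lam W q b v* W) \<le> ?k * norm1 (lam W q b)"
      unfolding transpose_matrix_vector[symmetric] by (rule norm1_mult_le)
    also have "\<dots> \<le> ?k * (K * norm1 q)"
      by (intro mult_left_mono K sum_nonneg) auto
    finally show ?thesis by (simp add: algebra_simps)
  qed
  moreover have "0 \<le> 1 + ?k * K" using K by (auto intro!: add_nonneg_nonneg mult_nonneg_nonneg sum_nonneg)
  ultimately show ?thesis by blast
qed

definition recourse_finite :: "'n::finite set \<Rightarrow> real^'n^'m::finite \<Rightarrow> real^'n \<Rightarrow> bool" where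
  "recourse_finite I W q \<longleftrightarrow> (\<forall>s. -\<infinity> < value_function I W q s \<and> value_function I W q s < \<infinity>)"

lemma recourse_finite_feasible:
  assumes "recourse_finite I W q" shows "\<exists>y\<in>Y I. W *v y = s"
proof (rule ccontr)
  assume "\<not> ?thesis"
  then have "{y \<in> Y I. W *v y = s} = {}" by blast
  then have "value_function I W q s = \<infinity>"
    unfolding value_function_def by (simp only: image_empty Inf_empty top_ereal_def)
  with assms show False by (simp add: recourse_finite_def)
qed

context
  fixes I :: "'n::finite set" and W :: "real^'n^'m::finite" and q :: "real^'n"
  assumes W: "\<And>i j. W $ i $ j \<in> \<int>"
    and fin: "recourse_finite I W q"
begin

lemmas feasible = recourse_finite_feasible[OF fin]
lemmas psi_bounds' = psi_bounds[OF W feasible] and psi_periodic' = psi_periodic[OF W feasible]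
  and gomory_value_eq' = gomory_value_eq[OF W feasible]

lemma optimal_basis_exists:
  "\<exists>b\<in>dual_feasible W q. \<forall>i. 0 \<le> (matrix_inv (basis_matrix W b) *v s) $ i"
proof (rule optimal_basis)
  fix y :: "real^'n" assume "\<And>j. 0 \<le> y $ j" "W *v y = 0"
  then show "0 \<le> q \<bullet> y"
    using recession_cost_nonneg[OF W feasible] fin by (simp add: recourse_finite_def)
next
  fix s show "\<exists>y. (\<forall>j. 0 \<le> y $ j) \<and> W *v y = s"
    using feasible[of s] by (auto simp: Y_def)
qed

lemma value_function_real: "value_function I W q s = ereal (real_of_ereal (value_function I W q s))"
  using fin by (cases "value_function I W q s") (auto simp: recourse_finite_def dest: spec[of _ s])

lemma psi_common_periodic:
  assumes b: "b \<in> dual_feasible W q" and w: "\<And>i. w $ i \<in> \<int>"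
  shows "psi I W q b (s + common_period W *\<^sub>R w) = psi I W q b s"
proof -
  have "invertible (basis_matrix W b)" using b by (simp add: dual_feasible_iff)
  then obtain N :: nat where "common_period W = of_nat N * period W b"
    using common_period_multiple[OF W] by metis
  then have eq: "common_period W *\<^sub>R w = period W b *\<^sub>R (of_nat N *\<^sub>R w)" by (simp add: mult.commute)
  show ?thesis unfolding eq using w by (intro psi_periodic' b) (auto intro: Ints_mult)
qed

text \<open>
  The bound vanishes together with the reduced costs \<open>red_cost W q l $ k i\<close>, which is what makes the depth in
  \<open>Max_deep\<close> independent of \<open>q\<close>.  It holds for all \<open>u\<close> because a periodic translation moves \<open>u\<close>
  into the part of the cone of \<open>k\<close> where the relaxation at \<open>k\<close> is exact.
\<close>

lemma psi_diff_le:
  assumes k: "k \<in> dual_feasible W q" and l: "l \<in> dual_feasible W q"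
  shows "psi I W q l u - psi I W q k u \<le> (cone_depth W + common_period W) * (\<Sum>i\<in>UNIV. red_cost W q l $ k i)"
proof -
  let ?D = "cone_depth W" and ?P = "common_period W" and ?A = "matrix_inv (basis_matrix W k)"
  have inv: "invertible (basis_matrix W k)" and P: "0 < ?P"
    using k common_period_pos by (auto simp: dual_feasible_iff)
  \<comment> \<open>Rounding up in the coordinates of the basis \<open>k\<close> puts every
    coordinate of \<open>s\<close> between \<open>?D\<close> and \<open>?D + ?P\<close>: the lower
    bound makes the relaxation at \<open>k\<close> exact, the upper one limits the lead of
    \<open>k\<close> over \<open>l\<close>. As \<open>z\<close> is integral, \<open>psi\<close> does
    not change.\<close>
  define z where "z = (\<chi> i. real_of_int \<lceil>(?D - (?A *v u) $ i) / ?P\<rceil>)"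
  define s where "s = u + ?P *\<^sub>R (basis_matrix W k *v z)"
  have As: "?A *v s = ?A *v u + ?P *\<^sub>R z"
    using inv by (simp add: s_def matrix_vector_right_distrib matrix_vector_mult_scaleR matrix_vector_mul_assoc matrix_inv_left)
  have lower: "?D \<le> (?A *v s) $ i" for i
  proof -
    have "(?D - (?A *v u) $ i) / ?P \<le> z $ i" by (simp add: z_def)
    then show ?thesis using P by (simp add: As pos_divide_le_eq mult.commute)
  qed
  have upper: "(?A *v s) $ i \<le> ?D + ?P" for i
  proof -
    have "z $ i < (?D - (?A *v u) $ i) / ?P + 1" unfolding z_def vec_lambda_beta by linarith
    then have "?P * z $ i < ?P * ((?D - (?A *v u) $ i) / ?P + 1)" using P by (intro mult_strict_left_mono)
    also have "\<dots> = ?D - (?A *v u) $ i + ?P" using P by (simp add: distrib_left)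
    finally show ?thesis by (simp add: As)
  qed
  have psi_eq: "psi I W q b s = psi I W q b u" if "b \<in> dual_feasible W q" for b
    unfolding s_def using W by (intro psi_common_periodic that mult_Ints) (auto simp: basis_matrix_def z_def)
  \<comment> \<open>At \<open>s\<close> the relaxation at \<open>k\<close> equals the value
    function, which no relaxation exceeds.\<close>
  have "gomory_value I W q l s \<le> gomory_value I W q k s"
    using gomory_value_le_value_function value_function_eq_gomory_value[OF W k lower] by metis
  then have "psi I W q l u - psi I W q k u \<le> lam W q k \<bullet> s - lam W q l \<bullet> s"
    by (simp add: gomory_value_eq'[OF k] gomory_value_eq'[OF l] psi_eq k l)
  also have "\<dots> = (\<Sum>i\<in>UNIV. (?A *v s) $ i * red_cost W q l $ k i)"
    using lam_inner_eq[OF inv, of q s l] by simp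
  also have "\<dots> \<le> (\<Sum>i\<in>UNIV. (?D + ?P) * red_cost W q l $ k i)"
    using l upper by (intro sum_mono mult_right_mono) (auto simp: dual_feasible_iff)
  finally show ?thesis by (simp add: sum_distrib_left)
qed

text \<open>By \<open>lam_inner_eq\<close> the lead of \<open>k\<close> in the linear parts is at
  least the assumed bound on the difference of the offsets. The offsets are left general to cover
  both \<open>Gam\<close> and translates of \<open>psi\<close>.\<close>

lemma Max_deep:
  fixes c :: "('m \<Rightarrow> 'n) \<Rightarrow> real"
  assumes k: "k \<in> dual_feasible W q"
    and c: "\<And>l. l \<in> dual_feasible W q \<Longrightarrow>
      c l - c k \<le> (cone_depth W + common_period W) * (\<Sum>i\<in>UNIV. red_cost W q l $ k i)"
    and deep: "\<And>i. cone_depth W + common_period W \<le> (matrix_inv (basis_matrix W k) *v s) $ i"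
  shows "Max ((\<lambda>b. lam W q b \<bullet> s + c b) ` dual_feasible W q) = lam W q k \<bullet> s + c k"
proof (rule Max_eqI)
  fix x assume "x \<in> (\<lambda>b. lam W q b \<bullet> s + c b) ` dual_feasible W q"
  then obtain l where l: "l \<in> dual_feasible W q" "x = lam W q l \<bullet> s + c l" by blast
  have "c l - c k \<le> (\<Sum>i\<in>UNIV. (cone_depth W + common_period W) * red_cost W q l $ k i)"
    using c[OF l(1)] by (simp add: sum_distrib_left)
  also have "\<dots> \<le> (\<Sum>i\<in>UNIV. (matrix_inv (basis_matrix W k) *v s) $ i * red_cost W q l $ k i)"
    using l(1) deep by (intro sum_mono mult_right_mono) (auto simp: dual_feasible_iff)
  also have "\<dots> = lam W q k \<bullet> s - lam W q l \<bullet> s"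
    using lam_inner_eq[of W k q s l] k by (simp add: dual_feasible_iff)
  finally show "x \<le> lam W q k \<bullet> s + c k" by (simp add: l(2))
qed (use k in auto)

lemma value_function_deep:
  assumes k: "k \<in> dual_feasible W q"
    and deep: "\<And>i. cone_depth W + common_period W \<le> (matrix_inv (basis_matrix W k) *v s) $ i"
  shows "real_of_ereal (value_function I W q s) = lam W q k \<bullet> s + psi I W q k s"
proof -
  have "cone_depth W \<le> (matrix_inv (basis_matrix W k) *v s) $ i" for i
    using deep[of i] common_period_pos[of W] by simp
  then show ?thesis
    using value_function_eq_gomory_value[OF W k] by (simp add: gomory_value_eq'[OF k])
qed

lemma measurable_psi [measurable]: "psi I W q b \<in> borel_measurable borel"
proof -
  have "(\<lambda>s. (q, s)) \<in> borel \<rightarrow>\<^sub>M (borel :: ((real^'n) \<times> (real^'m)) measure)" by measurable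
  from measurable_compose[OF this measurable_gomory_value[of I W b]]
  have [measurable]: "gomory_value I W q b \<in> borel_measurable borel" by simp
  show ?thesis unfolding psi_def[abs_def] by measurable
qed

lemma psi_integrable:
  assumes b: "b \<in> dual_feasible W q"
  shows "integrable lborel (\<lambda>u. indicator (cbox x y) u * psi I W q b (a - u))"
proof (rule integrableI_bounded_set[where A = "cbox x y" and B = "period W b * (\<Sum>j\<in>UNIV. red_cost W q b $ j)"])
  show "AE u in lborel. u \<in> cbox x y \<longrightarrow>
      norm (indicator (cbox x y) u * psi I W q b (a - u)) \<le> period W b * (\<Sum>j\<in>UNIV. red_cost W q b $ j)"
    using psi_bounds'[OF b] by (intro AE_I2) (auto simp: indicator_def)
qed (use emeasure_lborel_cbox_finite in auto)

text \<open>By periodicity the cube of side \<open>common_period W\<close> amounts to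
  \<open>N ^ CARD('m)\<close> copies of the cube over which \<open>Gam\<close> averages. The result
  does not depend on \<open>a\<close>, and this is what makes the averaged errors vanish.\<close>

lemma psi_mean:
  assumes b: "b \<in> dual_feasible W q"
  shows "(LINT u|lborel. indicator (cbox 0 (\<chi> i. common_period W)) u * psi I W q b (a - u))
    = common_period W ^ CARD('m) * Gam I W q b"
proof -
  let ?p = "period W b" and ?P = "common_period W"
  have inv: "invertible (basis_matrix W b)" using b by (simp add: dual_feasible_iff)
  have p: "0 < ?p" using period_pos[OF inv] .
  obtain N :: nat where N: "0 < N" "?P = of_nat N * ?p" using common_period_multiple[OF W inv] by blast
  let ?g = "\<lambda>u. ennreal (psi I W q b u)"
  have nn: "0 \<le> psi I W q b u" for u by (rule psi_bounds'[OF b])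
  have int_eq: "(LINT u|lborel. indicator S u * psi I W q b (f u)) = enn2real (\<integral>\<^sup>+u. indicator S u * ?g (f u) \<partial>lborel)"
    if [measurable]: "S \<in> sets borel" "f \<in> borel_measurable borel" for S :: "(real^'m) set" and f
    using nn by (subst integral_eq_nn_integral) (auto simp: ennreal_mult ennreal_indicator)
  have cbox_eq: "(\<integral>\<^sup>+u. indicator (cbox 0 (\<chi> i. r)) u * ?g (f u) \<partial>lborel) = (\<integral>\<^sup>+u. indicator (cube r) u * ?g (f u) \<partial>lborel)"
    if "0 < r" for r and f :: "real^'m \<Rightarrow> real^'m" using that by (intro nn_integral_cbox_eq_cube) simp
  have "(LINT u|lborel. indicator (cbox 0 (\<chi> i. ?P)) u * psi I W q b (a - u))
      = enn2real (\<integral>\<^sup>+u. indicator (cube (of_nat N * ?p)) u * ?g (a - u) \<partial>lborel)"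
    using cbox_eq[of ?P "\<lambda>u. a - u"] common_period_pos[of W] by (subst int_eq) (simp_all add: N(2))
  also have "\<dots> = enn2real (of_nat (N ^ CARD('m)) * (\<integral>\<^sup>+u. indicator (cube ?p) u * ?g u \<partial>lborel))"
    by (subst nn_integral_periodic) (use p N psi_periodic'[OF b] in auto)
  also have "\<dots> = of_nat N ^ CARD('m) * enn2real (\<integral>\<^sup>+u. indicator (cbox 0 (\<chi> i. ?p)) u * ?g u \<partial>lborel)"
    using cbox_eq[OF p, of "\<lambda>u. u"] by (simp add: enn2real_mult ennreal_of_nat_eq_real_of_nat)
  also have "enn2real (\<integral>\<^sup>+u. indicator (cbox 0 (\<chi> i. ?p)) u * ?g u \<partial>lborel)
      = (LINT u|lborel. indicator (cbox 0 (\<chi> i. ?p)) u * psi I W q b u)"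
    by (subst int_eq[of _ "\<lambda>u. u"]) auto
  also have "\<dots> = ?p ^ CARD('m) * Gam I W q b"
    using p by (simp add: Gam_def set_lebesgue_integral_def)
  finally show ?thesis by (simp add: N(2) power_mult_distrib mult.assoc)
qed


end

section \<open>Errors inside and outside the slabs\<close>

lemma measure_cbox_cart_const:
  assumes "0 < r"
  shows "measure lborel (cbox 0 (\<chi> i. r) :: (real^'m::finite) set) = r ^ CARD('m)"
proof -
  have "cbox 0 (\<chi> i. r) \<noteq> ({} :: (real^'m) set)"
    using assms by (simp add: interval_ne_empty_cart)
  from content_cbox_cart[OF this] show ?thesis by simp
qed

lemma integral_cbox_const:
  assumes "0 < r"
  shows "(LINT u|lborel. indicator (cbox 0 (\<chi> i. r) :: (real^'m::finite) set) u * c) = r ^ CARD('m) * c"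
  using measure_cbox_cart_const[OF assms, where 'm = 'm] by (simp del: measure_lborel_cbox_eq content_cbox_if)

lemma integrable_cbox_const: "integrable lborel (\<lambda>u. indicator (cbox x y) u * (c :: real))"
  using emeasure_lborel_cbox_finite by (intro integrable_mult_left) (auto intro!: integrable_real_indicator)

context
  fixes I :: "'n::finite set" and W :: "real^'n^'m::finite" and q :: "real^'n"
  assumes W: "\<And>i j. W $ i $ j \<in> \<int>"
    and fin: "recourse_finite I W q"
begin

text \<open>The two means are taken over cubes of possibly different sides; \<open>psi_mean\<close>
  rewrites both over the common cube, where the pointwise bound can be integrated.\<close>

lemma Gam_diff_le:
  assumes k: "k \<in> dual_feasible W q" and l: "l \<in> dual_feasible W q"
    and le: "\<And>u. psi I W q l u - psi I W q k u \<le> c"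
  shows "Gam I W q l - Gam I W q k \<le> c"
proof -
  let ?P = "common_period W"
  let ?U = "cbox 0 (\<chi> i. ?P) :: (real^'m) set"
  note int = psi_integrable[OF W fin] and mean = psi_mean[OF W fin]
  have P: "0 < ?P ^ CARD('m)" using common_period_pos[of W] by simp
  have vol: "(LINT u|lborel. indicator ?U u * c) = ?P ^ CARD('m) * c"
    by (rule integral_cbox_const) (rule common_period_pos)
  have "?P ^ CARD('m) * (Gam I W q l - Gam I W q k)
      = (LINT u|lborel. indicator ?U u * psi I W q l (0 - u)) - (LINT u|lborel. indicator ?U u * psi I W q k (0 - u))"
    using mean[OF l, of 0] mean[OF k, of 0] by (simp add: right_diff_distrib)
  also have "\<dots> = (LINT u|lborel. indicator ?U u * psi I W q l (0 - u) - indicator ?U u * psi I W q k (0 - u))"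
    by (rule Bochner_Integration.integral_diff[symmetric] int k l)+
  also have "\<dots> \<le> (LINT u|lborel. indicator ?U u * c)"
  proof (rule integral_mono)
    show "integrable lborel (\<lambda>u. indicator ?U u * psi I W q l (0 - u) - indicator ?U u * psi I W q k (0 - u))"
      by (intro Bochner_Integration.integrable_diff int k l)
    show "integrable lborel (\<lambda>u. indicator ?U u * c)"
      by (rule integrable_cbox_const)
    fix u show "indicator ?U u * psi I W q l (0 - u) - indicator ?U u * psi I W q k (0 - u) \<le> indicator ?U u * c"
      using le[of "0 - u"] by (auto simp: indicator_def)
  qed
  also note vol
  finally show ?thesis using P by simp
qed

lemma Gam_bounds:
  assumes b: "b \<in> dual_feasible W q"
  shows "0 \<le> Gam I W q b" "Gam I W q b \<le> period W b * (\<Sum>j\<in>UNIV. red_cost W q b $ j)"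
proof -
  let ?P = "common_period W"
  let ?U = "cbox 0 (\<chi> i. ?P) :: (real^'m) set"
  let ?c = "period W b * (\<Sum>j\<in>UNIV. red_cost W q b $ j)"
  note bounds = psi_bounds'[OF W fin b]
  have P: "0 < ?P ^ CARD('m)" using common_period_pos[of W] by simp
  have vol: "(LINT u|lborel. indicator ?U u * c) = ?P ^ CARD('m) * c" for c
    by (rule integral_cbox_const) (rule common_period_pos)
  have "0 \<le> ?P ^ CARD('m) * Gam I W q b"
    unfolding psi_mean[OF W fin b, of 0, symmetric] using bounds by (intro Bochner_Integration.integral_nonneg) auto
  then show "0 \<le> Gam I W q b" using P by (simp add: zero_le_mult_iff)
  have "?P ^ CARD('m) * Gam I W q b \<le> (LINT u|lborel. indicator ?U u * ?c)"
    unfolding psi_mean[OF W fin b, of 0, symmetric]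
  proof (rule integral_mono)
    show "integrable lborel (\<lambda>u. indicator ?U u * ?c)"
      by (rule integrable_cbox_const)
    fix u show "indicator ?U u * psi I W q b (0 - u) \<le> indicator ?U u * ?c"
      using bounds by (auto simp: indicator_def)
  qed (rule psi_integrable[OF W fin b])
  also note vol
  finally show "Gam I W q b \<le> ?c" using P by simp
qed


end

lemma value_function_le:
  fixes I :: "'n::finite set" and W :: "real^'n^'m::finite"
  assumes W: "\<And>i j. W $ i $ j \<in> \<int>" and feasible: "\<And>s. \<exists>y\<in>Y I. W *v y = s"
  shows "\<exists>C. \<forall>q b s. recourse_finite I W q \<longrightarrow> b \<in> dual_feasible W q \<longrightarrow>
    (\<forall>i. 0 \<le> (matrix_inv (basis_matrix W b) *v s) $ i) \<longrightarrow>
    real_of_ereal (value_function I W q s) \<le> lam W q b \<bullet> s + C * norm1 q"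
proof -
  obtain K where K: "0 \<le> K" "\<And>q b. norm1 (lam W q b) \<le> K * norm1 q" using norm1_lam_le by blast
  \<comment> \<open>Bounds the images under all basis matrices of vectors with components in
    [0, 1].\<close>
  define R where "R = (\<Sum>b\<in>UNIV. (\<Sum>i\<in>UNIV. norm1 (basis_matrix W b $ i)) * CARD('m))"
  obtain D where D: "\<And>r. norm1 r \<le> R \<Longrightarrow> \<exists>y\<in>Y I. W *v y = r \<and> norm1 y \<le> D"
    using bounded_feasible[OF W feasible, of R] by blast
  show ?thesis
  proof (intro exI allI impI)
    fix q b s
    assume fin: "recourse_finite I W q" and b: "b \<in> dual_feasible W q"
      and pos: "\<forall>i. 0 \<le> (matrix_inv (basis_matrix W b) *v s) $ i"
    have inv: "invertible (basis_matrix W b)" using b by (simp add: dual_feasible_iff)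
    let ?B = "basis_matrix W b" and ?x = "matrix_inv (basis_matrix W b) *v s"
    define z where "z = (\<chi> i. real_of_int \<lfloor>?x $ i\<rfloor>)"
    define r where "r = ?B *v (?x - z)"
    have Bx: "?B *v ?x = s" using inv by (simp add: matrix_vector_mul_assoc matrix_inv_right)
    have "norm1 (?x - z) \<le> (\<Sum>i\<in>(UNIV::'m set). 1)"
      unfolding norm1_def
    proof (intro sum_mono)
      fix i show "\<bar>(?x - z) $ i\<bar> \<le> 1"
        by (simp add: z_def) linarith
    qed
    then have "norm1 r \<le> (\<Sum>i\<in>UNIV. norm1 (?B $ i)) * CARD('m)"
      unfolding r_def by (intro order_trans[OF norm1_mult_le] mult_left_mono sum_nonneg) auto
    also have "\<dots> \<le> R"
      unfolding R_def by (rule member_le_sum[of b UNIV "\<lambda>b. (\<Sum>i\<in>UNIV. norm1 (basis_matrix W b $ i)) * CARD('m)"])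
        (auto intro!: mult_nonneg_nonneg sum_nonneg)
    finally have r: "norm1 r \<le> R" .
    from D[OF this] obtain y where y: "y \<in> Y I" "W *v y = r" "norm1 y \<le> D" by blast
    have z0: "0 \<le> z $ i" for i using pos by (simp add: z_def)
    have "0 \<le> basis_embed b z $ j" for j
      using z0 by (auto simp: basis_embed_def intro!: sum_nonneg)
    moreover have "basis_embed b z $ j \<in> \<int>" for j by (rule embed_Ints) (simp add: z_def)
    ultimately have "y + basis_embed b z \<in> Y I" using y(1) by (auto simp: Y_def)
    moreover have "W *v (y + basis_embed b z) = s"
      by (simp add: matrix_vector_right_distrib mult_embed y(2) r_def matrix_vector_mult_diff_distrib Bx)
    ultimately have "value_function I W q s \<le> ereal (q \<bullet> (y + basis_embed b z))"
      unfolding value_function_def by (intro INF_lower) auto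
    then have "real_of_ereal (value_function I W q s) \<le> q \<bullet> (y + basis_embed b z)"
      by (subst (asm) value_function_real[OF W fin]) simp
    also have "\<dots> = q \<bullet> y + lam W q b \<bullet> s - lam W q b \<bullet> r"
      by (simp add: inner_add_right inner_embed[OF inv] r_def matrix_vector_mult_diff_distrib Bx inner_diff_right)
    also have "\<dots> \<le> lam W q b \<bullet> s + (D + K * R) * norm1 q"
    proof -
      have "q \<bullet> y \<le> norm1 q * D"
        using inner_le_norm1[of q y] mult_left_mono[OF y(3), of "norm1 q"] by simp
      moreover have "- (lam W q b \<bullet> r) \<le> norm1 (lam W q b) * norm1 r"
        using inner_le_norm1[of "lam W q b" r] by simp
      moreover have "norm1 (lam W q b) * norm1 r \<le> (K * norm1 q) * R"
        using K r by (intro mult_mono) auto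
      ultimately show ?thesis by (simp add: algebra_simps)
    qed
    finally show "real_of_ereal (value_function I W q s) \<le> lam W q b \<bullet> s + (D + K * R) * norm1 q" .
  qed
qed

lemma approximation_error_bound:
  fixes I :: "'n::finite set" and W :: "real^'n^'m::finite"
  assumes W: "\<And>i j. W $ i $ j \<in> \<int>" and feasible: "\<And>s. \<exists>y\<in>Y I. W *v y = s"
  shows "\<exists>C>0. \<forall>q c s. recourse_finite I W q \<longrightarrow>
    (\<forall>b\<in>dual_feasible W q. 0 \<le> c b \<and> c b \<le> period W b * (\<Sum>j\<in>UNIV. red_cost W q b $ j)) \<longrightarrow>
    \<bar>real_of_ereal (value_function I W q s) - Max ((\<lambda>b. lam W q b \<bullet> s + c b) ` dual_feasible W q)\<bar> \<le> C * norm1 q"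
proof -
  obtain C1 where C1: "\<And>q b s. recourse_finite I W q \<Longrightarrow> b \<in> dual_feasible W q \<Longrightarrow>
    (\<forall>i. 0 \<le> (matrix_inv (basis_matrix W b) *v s) $ i) \<Longrightarrow>
    real_of_ereal (value_function I W q s) \<le> lam W q b \<bullet> s + C1 * norm1 q"
    using value_function_le[OF W feasible] by blast
  obtain K where K: "0 \<le> K" "\<And>q b. (\<Sum>j\<in>UNIV. red_cost W q b $ j) \<le> K * norm1 q" using sum_red_cost_le by blast
  define C2 where "C2 = (\<Sum>b\<in>UNIV. period W b) * K"
  \<comment> \<open>\<open>C1\<close> comes without a sign; the absolute value and the summand 1
    make the constant positive.\<close>
  have "\<bar>real_of_ereal (value_function I W q s) - Max ((\<lambda>b. lam W q b \<bullet> s + c b) ` dual_feasible W q)\<bar>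
      \<le> (\<bar>C1\<bar> + C2 + 1) * norm1 q"
    if fin: "recourse_finite I W q"
      and c: "\<forall>b\<in>dual_feasible W q. 0 \<le> c b \<and> c b \<le> period W b * (\<Sum>j\<in>UNIV. red_cost W q b $ j)"
    for q c s
  proof -
    let ?M = "Max ((\<lambda>b. lam W q b \<bullet> s + c b) ` dual_feasible W q)"
    let ?v = "real_of_ereal (value_function I W q s)"
    obtain b where b: "b \<in> dual_feasible W q" "\<forall>i. 0 \<le> (matrix_inv (basis_matrix W b) *v s) $ i"
      using optimal_basis_exists[OF W fin] by blast
    have "?v \<le> lam W q b \<bullet> s + C1 * norm1 q" by (rule C1[OF fin b])
    also have "lam W q b \<bullet> s \<le> ?M"
      using b(1) c by (intro Max_ge_iff[THEN iffD2]) force+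
    finally have 1: "?v \<le> ?M + C1 * norm1 q" by simp
    have 2: "?M \<le> ?v + C2 * norm1 q"
    proof (rule Max.boundedI)
      fix x assume "x \<in> (\<lambda>b. lam W q b \<bullet> s + c b) ` dual_feasible W q"
      then obtain l where l: "l \<in> dual_feasible W q" "x = lam W q l \<bullet> s + c l" by blast
      have "ereal (lam W q l \<bullet> s) \<le> value_function I W q s"
        using gomory_value_bounds(1)[OF W recourse_finite_feasible[OF fin] l(1), of s]
          gomory_value_le_value_function[of I W q l s] by (rule order_trans)
      then have "lam W q l \<bullet> s \<le> ?v" by (subst (asm) value_function_real[OF W fin]) simp
      moreover have "c l \<le> C2 * norm1 q"
      proof -
        have "c l \<le> period W l * (K * norm1 q)"
          using c l(1) mult_left_mono[OF K(2)[of q l], of "period W l"] by (force simp: period_def)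
        also have "\<dots> \<le> (\<Sum>b\<in>UNIV. period W b) * (K * norm1 q)"
          using K(1) by (intro mult_right_mono member_le_sum mult_nonneg_nonneg) (auto simp: period_def)
        finally show ?thesis by (simp add: C2_def mult.assoc)
      qed
      ultimately show "x \<le> ?v + C2 * norm1 q" by (simp add: l(2))
    qed (use b in auto)
    have "C1 * norm1 q \<le> \<bar>C1\<bar> * norm1 q" by (intro mult_right_mono) auto
    moreover have "0 \<le> C2 * norm1 q" using K(1) by (auto simp: C2_def period_def intro!: mult_nonneg_nonneg sum_nonneg)
    ultimately have "\<bar>?v - ?M\<bar> \<le> \<bar>C1\<bar> * norm1 q + C2 * norm1 q + 1 * norm1 q"
      using 1 2 norm1_nonneg[of q] mult_nonneg_nonneg[OF abs_ge_zero[of C1] norm1_nonneg[of q]] by linarith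
    then show ?thesis by (simp add: distrib_right)
  qed
  moreover have "0 < \<bar>C1\<bar> + C2 + 1"
    using K(1) by (auto simp: C2_def period_def intro!: add_nonneg_pos add_nonneg_nonneg mult_nonneg_nonneg sum_nonneg)
  ultimately show ?thesis by blast
qed

text \<open>The last summand makes room for subtracting any vector of the cube of side \<open>common_period W\<close>.\<close>

definition slab_width :: "real^'n::finite^'m::finite \<Rightarrow> real" where
  "slab_width W = cone_depth W + common_period W +
    (\<Sum>b\<in>UNIV. \<Sum>i\<in>UNIV. norm1 (matrix_inv (basis_matrix W b) $ i)) * (CARD('m) * common_period W)"

text \<open>Neighbourhoods of the hyperplanes that bound the cones of all bases, dual feasible or
  not, so that the set does not depend on \<open>q\<close>.\<close>

definition slabs :: "real^'n::finite^'m::finite \<Rightarrow> (real^'m) set" where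
  "slabs W = (\<Union>b\<in>{b. invertible (basis_matrix W b)}. \<Union>i. {s. \<bar>matrix_inv (basis_matrix W b) $ i \<bullet> s\<bar> \<le> slab_width W})"

context
  fixes I :: "'n::finite set" and W :: "real^'n^'m::finite" and q :: "real^'n"
  assumes W: "\<And>i j. W $ i $ j \<in> \<int>"
    and fin: "recourse_finite I W q"
begin

text \<open>In a cone that contains \<open>s\<close> the coordinates are nonnegative, and off the
  slabs they exceed the slab width. One basis then serves the whole cube of shifted points;
  otherwise the average would mix different periodic functions.\<close>

lemma deep_off_slabs:
  assumes s: "s \<notin> slabs W"
  obtains k where "k \<in> dual_feasible W q"
    "\<And>u i. u \<in> cbox 0 (\<chi> i. common_period W) \<Longrightarrow>
      cone_depth W + common_period W \<le> (matrix_inv (basis_matrix W k) *v (s - u)) $ i"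
proof -
  let ?P = "common_period W"
  obtain k where k: "k \<in> dual_feasible W q" "\<forall>i. 0 \<le> (matrix_inv (basis_matrix W k) *v s) $ i"
    using optimal_basis_exists[OF W fin] by blast
  let ?A = "matrix_inv (basis_matrix W k)"
  show ?thesis
  proof (rule that[OF k(1)])
    fix u :: "real^'m" and i assume u: "u \<in> cbox 0 (\<chi> i. ?P)"
    have "slab_width W < \<bar>?A $ i \<bullet> s\<bar>" using s k(1) by (auto simp: slabs_def dual_feasible_iff not_le)
    then have "slab_width W < (?A *v s) $ i" using k(2) by (simp add: matrix_vector_mul_component)
    moreover have "(?A *v u) $ i \<le> (\<Sum>b\<in>UNIV. \<Sum>i\<in>UNIV. norm1 (matrix_inv (basis_matrix W b) $ i)) * (CARD('m) * ?P)"
    proof -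
      have "norm1 u \<le> (\<Sum>i\<in>(UNIV :: 'm set). ?P)"
        unfolding norm1_def using u by (intro sum_mono) (auto simp: mem_box_cart)
      moreover have "norm1 (?A $ i) \<le> (\<Sum>i\<in>UNIV. norm1 (?A $ i))"
        by (rule member_le_sum) auto
      moreover have "\<dots> \<le> (\<Sum>b\<in>UNIV. \<Sum>i\<in>UNIV. norm1 (matrix_inv (basis_matrix W b) $ i))"
        by (rule member_le_sum[of k UNIV "\<lambda>b. \<Sum>i\<in>UNIV. norm1 (matrix_inv (basis_matrix W b) $ i)"]) (auto intro!: sum_nonneg)
      ultimately have "norm1 (?A $ i) * norm1 u \<le> (\<Sum>b\<in>UNIV. \<Sum>i\<in>UNIV. norm1 (matrix_inv (basis_matrix W b) $ i)) * (CARD('m) * ?P)"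
        by (intro mult_mono) (auto intro!: sum_nonneg)
      then show ?thesis using inner_le_norm1[of "?A $ i" u] by (simp add: matrix_vector_mul_component)
    qed
    ultimately show "cone_depth W + ?P \<le> (?A *v (s - u)) $ i"
      by (simp add: slab_width_def matrix_vector_mult_diff_distrib)
  qed
qed

lemma v_hat_mean_error:
  assumes s: "s \<notin> slabs W"
  shows "(LINT u|lborel. indicator (cbox 0 (\<chi> i. common_period W)) u *
    (real_of_ereal (value_function I W q (s - u)) - v_hat I W q (s - u))) = 0"
proof -
  let ?P = "common_period W"
  let ?U = "cbox 0 (\<chi> i. ?P) :: (real^'m) set"
  from deep_off_slabs[OF s] obtain k where k: "k \<in> dual_feasible W q"
    and deep: "\<And>u i. u \<in> ?U \<Longrightarrow> cone_depth W + ?P \<le> (matrix_inv (basis_matrix W k) *v (s - u)) $ i" by metis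
  have eq: "real_of_ereal (value_function I W q (s - u)) - v_hat I W q (s - u) = psi I W q k (s - u) - Gam I W q k"
    if "u \<in> ?U" for u
    unfolding v_hat_def value_function_deep[OF W fin k deep[OF that]]
    by (subst Max_deep[OF W fin k _ deep[OF that]])
       (auto intro!: Gam_diff_le[OF W fin] psi_diff_le[OF W fin] k)
  have "(LINT u|lborel. indicator ?U u * (real_of_ereal (value_function I W q (s - u)) - v_hat I W q (s - u)))
      = (LINT u|lborel. indicator ?U u * psi I W q k (s - u) - indicator ?U u * Gam I W q k)"
    by (intro Bochner_Integration.integral_cong) (auto simp: indicator_def eq)
  also have "\<dots> = (LINT u|lborel. indicator ?U u * psi I W q k (s - u)) - (LINT u|lborel. indicator ?U u * Gam I W q k)"
    by (intro Bochner_Integration.integral_diff psi_integrable[OF W fin k] integrable_cbox_const)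
  also have "\<dots> = 0"
    by (simp only: psi_mean[OF W fin k] integral_cbox_const[OF common_period_pos] diff_self)
  finally show ?thesis .
qed

text \<open>Here \<open>s + t - u\<close> takes the place of \<open>h\<close>, so the offset is
  \<open>psi\<close> at \<open>(s + t - \<alpha>) - u\<close>. The error is a difference of two
  translates of one \<open>psi\<close>, which have the same mean over the cube.\<close>

lemma v_alpha_mean_error:
  assumes s: "s \<notin> slabs W"
  shows "(LINT u|lborel. indicator (cbox 0 (\<chi> i. common_period W)) u *
    (real_of_ereal (value_function I W q (s - u)) - v_alpha I W \<alpha> q (s + t - u) t)) = 0"
proof -
  let ?P = "common_period W"
  let ?U = "cbox 0 (\<chi> i. ?P) :: (real^'m) set"
  from deep_off_slabs[OF s] obtain k where k: "k \<in> dual_feasible W q"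
    and deep: "\<And>u i. u \<in> ?U \<Longrightarrow> cone_depth W + ?P \<le> (matrix_inv (basis_matrix W k) *v (s - u)) $ i" by metis
  have eq: "real_of_ereal (value_function I W q (s - u)) - v_alpha I W \<alpha> q (s + t - u) t
      = psi I W q k (s - u) - psi I W q k ((s + t - \<alpha>) - u)"
    if "u \<in> ?U" for u
  proof -
    have "s + t - u - t = s - u" "s + t - u - \<alpha> = s + t - \<alpha> - u" by simp_all
    then show ?thesis
      unfolding v_alpha_def value_function_deep[OF W fin k deep[OF that]]
      by (simp only:) (subst Max_deep[OF W fin k _ deep[OF that]], auto intro!: psi_diff_le[OF W fin] k)
  qed
  have "(LINT u|lborel. indicator ?U u * (real_of_ereal (value_function I W q (s - u)) - v_alpha I W \<alpha> q (s + t - u) t))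
      = (LINT u|lborel. indicator ?U u * psi I W q k (s - u) - indicator ?U u * psi I W q k ((s + t - \<alpha>) - u))"
    by (intro Bochner_Integration.integral_cong) (auto simp: indicator_def eq)
  also have "\<dots> = (LINT u|lborel. indicator ?U u * psi I W q k (s - u)) - (LINT u|lborel. indicator ?U u * psi I W q k ((s + t - \<alpha>) - u))"
    by (intro Bochner_Integration.integral_diff psi_integrable[OF W fin k])
  also have "\<dots> = 0" by (simp add: psi_mean[OF W fin k])
  finally show ?thesis .
qed


end

section \<open>Expected errors\<close>

text \<open>Shifting the density by \<open>u\<close> changes the expectation of \<open>g\<close>
  little, in terms of the variation; averaged over \<open>u\<close>, the shift moves by Fubini to
  \<open>g\<close>, whose average vanishes off \<open>B\<close>. On \<open>B\<close> the bound
  \<open>c\<close> is all there is.\<close>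

lemma density_mean_error:
  fixes f :: "real^'m::finite \<Rightarrow> real"
  assumes f: "joint_pdf f" and h: "distributed M lborel h (\<lambda>t. ennreal (f t))"
    and [measurable]: "g \<in> borel_measurable borel" and bound: "\<And>s. \<bar>g s\<bar> \<le> c"
    and P: "0 < P" and [measurable]: "B \<in> sets borel"
    and mean: "\<And>s. s \<notin> B \<Longrightarrow> (LINT u|lborel. indicator (cbox 0 (\<chi> i. P)) u * g (s - u)) = 0"
  shows "ennreal \<bar>LINT s|lborel. f s * g s\<bar>
    \<le> ennreal c * ((\<Sum>i\<in>UNIV. ennreal P * expected_variation M f h i) + (\<integral>\<^sup>+s. ennreal (f s) * indicator B s \<partial>lborel))"
proof -
  let ?E = "\<Sum>i\<in>UNIV. ennreal P * expected_variation M f h i"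
  let ?U = "cbox 0 (\<chi> i. P) :: (real^'m) set"
  let ?X = "LINT s|lborel. f s * g s"
  have [measurable]: "f \<in> borel_measurable borel" and nn: "\<And>t. 0 \<le> f t"
    and one: "(\<integral>\<^sup>+t. ennreal (f t) \<partial>lborel) = 1"
    using f by (auto simp: joint_pdf_def)
  have c0: "0 \<le> c" using bound[of 0] by simp
  have f_int: "integrable lborel f"
    using nn one by (intro integrableI_nonneg) auto
  have int_shift: "integrable lborel (\<lambda>s. f (s + u))" for u
  proof (rule integrableI_nonneg)
    have "(\<integral>\<^sup>+s. ennreal (f (s + u)) \<partial>lborel) = (\<integral>\<^sup>+s. ennreal (f s) \<partial>distr lborel borel ((+) u))"
      by (subst nn_integral_distr) (auto simp: add.commute)
    then show "(\<integral>\<^sup>+s. ennreal (f (s + u)) \<partial>lborel) < \<infinity>" by (simp add: lborel_distr_plus one)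
  qed (auto simp: nn)
  have mult_int: "integrable lborel (\<lambda>s. k s * g' s)"
    if "integrable lborel k" and [measurable]: "g' \<in> borel_measurable borel" and "\<And>s. \<bar>g' s\<bar> \<le> c" for k g' :: "real^'m \<Rightarrow> real"
  proof (rule Bochner_Integration.integrable_bound)
    show "integrable lborel (\<lambda>s. c * k s)" using that by simp
    have [measurable]: "k \<in> borel_measurable lborel" using that(1) by auto
    show "(\<lambda>s. k s * g' s) \<in> borel_measurable lborel" by measurable
    have "\<bar>k s\<bar> * \<bar>g' s\<bar> \<le> c * \<bar>k s\<bar>" for s
      using mult_left_mono[OF that(3)[of s], of "\<bar>k s\<bar>"] by (simp add: mult.commute)
    then show "AE s in lborel. norm (k s * g' s) \<le> norm (c * k s)"
      using c0 by (intro AE_I2) (simp add: abs_mult)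
  qed
  \<comment> \<open>\<open>c = 0\<close> is apart because 0 times \<infinity> is 0; for
    \<open>c > 0\<close> an infinite variation makes the claim trivial, and a finite one allows
    computing with reals.\<close>
  consider "c = 0" | "0 < c" "?E = \<infinity>" | e where "0 \<le> e" "?E = ennreal e"
    using c0 by (cases ?E) (auto simp: less_le)
  then show ?thesis
  proof cases
    case 1
    then have "g s = 0" for s using bound[of s] by simp
    then show ?thesis by simp
  next
    case 2
    then show ?thesis unfolding 2(2) by (simp add: ennreal_mult_top)
  next
    case (3 e)
    \<comment> \<open>The expectation of the shifted error, not related to the set \<open>B\<close>;
      translation moves the shift to the density as \<open>f (s + u)\<close>.\<close>
    define B' where "B' u = (LINT s|lborel. f s * g (s - u))" for u
    define V where "V = P ^ CARD('m)"
    define p where "p = (LINT s|lborel. f s * indicator B s)"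
    have V: "0 < V" using P by (simp add: V_def)
    have shift: "\<bar>?X - B' u\<bar> \<le> c * e" if u: "u \<in> ?U" for u
    proof -
      have "B' u = (LINT s|distr lborel borel ((+) u). f s * g (s - u))"
        by (simp add: B'_def lborel_distr_plus)
      also have "\<dots> = (LINT s|lborel. f (s + u) * g s)"
        by (subst integral_distr) (auto simp: add.commute)
      finally have B'_eq: "B' u = (LINT s|lborel. f (s + u) * g s)" .
      have diff: "?X - B' u = (LINT s|lborel. (f s - f (s + u)) * g s)"
        unfolding B'_eq left_diff_distrib
        by (rule Bochner_Integration.integral_diff[symmetric]) (auto intro!: mult_int f_int int_shift bound)
      have "ennreal \<bar>?X - B' u\<bar> \<le> (\<integral>\<^sup>+s. ennreal \<bar>(f s - f (s + u)) * g s\<bar> \<partial>lborel)"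
        unfolding diff using integral_norm_bound_ennreal[of lborel "\<lambda>s. (f s - f (s + u)) * g s"]
        by (simp add: mult_int f_int int_shift bound)
      also have "\<dots> \<le> (\<integral>\<^sup>+s. ennreal c * ennreal \<bar>f (s + u) - f s\<bar> \<partial>lborel)"
        using c0 mult_left_mono[OF bound]
        by (intro nn_integral_mono)
           (simp add: abs_mult ennreal_mult[symmetric] mult.commute[of c] abs_minus_commute ennreal_leI)
      also have "\<dots> = ennreal c * (\<integral>\<^sup>+s. ennreal \<bar>f (s + u) - f s\<bar> \<partial>lborel)"
        by (rule nn_integral_cmult) measurable
      also have "\<dots> \<le> ennreal c * (\<Sum>i\<in>UNIV. ennreal \<bar>u $ i\<bar> * expected_variation M f h i)"
        by (intro mult_left_mono shift_le_expected_variation[OF f h]) auto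
      also have "\<dots> \<le> ennreal c * ?E"
        using u by (intro mult_left_mono sum_mono mult_right_mono ennreal_leI) (auto simp: mem_box_cart)
      also have "\<dots> = ennreal (c * e)" using c0 3 by (simp add: ennreal_mult)
      finally show ?thesis using c0 3 by (simp add: ennreal_le_iff)
    qed
    have pair_int: "integrable (lborel \<Otimes>\<^sub>M lborel) (\<lambda>(u, s). indicator ?U u * (f s * g (s - u)))"
    proof (rule integrableI_bounded)
      have "(\<integral>\<^sup>+z. ennreal (norm (case z of (u, s) \<Rightarrow> indicator ?U u * (f s * g (s - u)))) \<partial>(lborel \<Otimes>\<^sub>M lborel))
          \<le> (\<integral>\<^sup>+z. (ennreal c * indicator ?U (fst z)) * ennreal (f (snd z)) \<partial>(lborel \<Otimes>\<^sub>M lborel))"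
      proof (rule nn_integral_mono)
        fix z :: "(real^'m) \<times> (real^'m)"
        have "f (snd z) * \<bar>g (snd z - fst z)\<bar> \<le> c * f (snd z)"
          using mult_left_mono[OF bound nn] by (simp add: mult.commute)
        then show "ennreal (norm (case z of (u, s) \<Rightarrow> indicator ?U u * (f s * g (s - u))))
            \<le> (ennreal c * indicator ?U (fst z)) * ennreal (f (snd z))"
          using c0 nn by (auto simp: case_prod_unfold indicator_def abs_mult ennreal_mult[symmetric] intro!: ennreal_leI)
      qed
      also have "\<dots> = (\<integral>\<^sup>+u. (\<integral>\<^sup>+s. (ennreal c * indicator ?U u) * ennreal (f s) \<partial>lborel) \<partial>lborel)"
        by (subst lborel.nn_integral_fst[symmetric]) auto
      also have "\<dots> = ennreal c * emeasure lborel ?U"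
        by (simp add: nn_integral_cmult one del: emeasure_lborel_cbox)
      also have "\<dots> < \<infinity>"
        using emeasure_lborel_cbox_finite[of 0 "\<chi> i. P :: real^'m"] by (simp add: ennreal_mult_less_top)
      finally show "(\<integral>\<^sup>+z. ennreal (norm (case z of (u, s) \<Rightarrow> indicator ?U u * (f s * g (s - u)))) \<partial>(lborel \<Otimes>\<^sub>M lborel)) < \<infinity>" .
    qed measurable
    have B'_int: "integrable lborel (\<lambda>u. indicator ?U u * B' u)"
      using lborel_pair.integrable_fst'[OF pair_int] by (simp add: B'_def)
    have "(LINT u|lborel. indicator ?U u * B' u) = (LINT s|lborel. (LINT u|lborel. indicator ?U u * (f s * g (s - u))))"
      using lborel_pair.Fubini_integral[OF pair_int] by (simp add: B'_def)
    also have "\<dots> = (LINT s|lborel. f s * (LINT u|lborel. indicator ?U u * g (s - u)))"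
      by (simp add: mult.left_commute[of "indicator _ _"])
    finally have fub: "(LINT u|lborel. indicator ?U u * B' u) = (LINT s|lborel. f s * (LINT u|lborel. indicator ?U u * g (s - u)))" .
    have inner: "\<bar>LINT u|lborel. indicator ?U u * g (s - u)\<bar> \<le> V * c * indicator B s" for s
    proof (cases "s \<in> B")
      case True
      have "\<bar>LINT u|lborel. indicator ?U u * g (s - u)\<bar> \<le> (LINT u|lborel. indicator ?U u * c)"
      proof (rule integral_abs_bound[THEN order_trans], rule integral_mono)
        have "integrable lborel (\<lambda>u. indicator ?U u * g (s - u))"
          by (rule mult_int) (use bound emeasure_lborel_cbox_finite in \<open>auto intro!: integrable_real_indicator\<close>)
        then show "integrable lborel (\<lambda>u. \<bar>indicator ?U u * g (s - u)\<bar>)" by simp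
        show "integrable lborel (\<lambda>u. indicator ?U u * c)" by (rule integrable_cbox_const)
        show "\<bar>indicator ?U u * g (s - u)\<bar> \<le> indicator ?U u * c" for u
          using bound[of "s - u"] by (simp add: indicator_def)
      qed
      also have "\<dots> = V * c" unfolding V_def by (rule integral_cbox_const[OF P])
      finally show ?thesis using True by simp
    qed (simp add: mean)
    have "\<bar>LINT u|lborel. indicator ?U u * B' u\<bar> \<le> (LINT s|lborel. V * c * (f s * indicator B s))"
      unfolding fub
    proof (rule integral_abs_bound[THEN order_trans], rule integral_mono)
      show "integrable lborel (\<lambda>s. V * c * (f s * indicator B s))"
        by (intro integrable_mult_right integrable_real_mult_indicator f_int) simp
      have "integrable lborel (\<lambda>s. LINT u|lborel. indicator ?U u * (f s * g (s - u)))"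
        using lborel_pair.integrable_snd[OF pair_int] by simp
      then show "integrable lborel (\<lambda>s. \<bar>f s * (LINT u|lborel. indicator ?U u * g (s - u))\<bar>)"
        by (simp add: mult.left_commute[of "indicator _ _"])
      fix s
      show "\<bar>f s * (LINT u|lborel. indicator ?U u * g (s - u))\<bar> \<le> V * c * (f s * indicator B s)"
        using mult_left_mono[OF inner nn] by (simp add: abs_mult nn ac_simps)
    qed
    then have 1: "\<bar>LINT u|lborel. indicator ?U u * B' u\<bar> \<le> V * (c * p)" by (simp add: p_def)
    have "V * ?X - (LINT u|lborel. indicator ?U u * B' u) = (LINT u|lborel. indicator ?U u * ?X - indicator ?U u * B' u)"
      unfolding V_def integral_cbox_const[OF P, symmetric]
      by (rule Bochner_Integration.integral_diff[symmetric]) (rule integrable_cbox_const B'_int)+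
    also have "\<bar>\<dots>\<bar> \<le> (LINT u|lborel. indicator ?U u * (c * e))"
    proof (rule integral_abs_bound[THEN order_trans], rule integral_mono)
      show "integrable lborel (\<lambda>u. \<bar>indicator ?U u * ?X - indicator ?U u * B' u\<bar>)"
        by (intro integrable_abs Bochner_Integration.integrable_diff B'_int integrable_cbox_const)
      show "integrable lborel (\<lambda>u. indicator ?U u * (c * e))" by (rule integrable_cbox_const)
      show "\<bar>indicator ?U u * ?X - indicator ?U u * B' u\<bar> \<le> indicator ?U u * (c * e)" for u
        using shift[of u] by (auto simp: indicator_def)
    qed
    also have "\<dots> = V * (c * e)" unfolding V_def by (rule integral_cbox_const[OF P])
    finally have 2: "\<bar>V * ?X - (LINT u|lborel. indicator ?U u * B' u)\<bar> \<le> V * (c * e)" .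
    have "V * \<bar>?X\<bar> \<le> V * (c * e) + V * (c * p)"
      using 1 2 V abs_mult[of V ?X] by linarith
    then have "V * \<bar>?X\<bar> \<le> V * (c * (e + p))" by (simp add: distrib_left)
    then have *: "\<bar>?X\<bar> \<le> c * (e + p)" using V by simp
    have p: "0 \<le> p" "(\<integral>\<^sup>+s. ennreal (f s) * indicator B s \<partial>lborel) = ennreal p"
    proof -
      show "0 \<le> p" unfolding p_def using nn by (intro Bochner_Integration.integral_nonneg) auto
      have "(\<integral>\<^sup>+s. ennreal (f s) * indicator B s \<partial>lborel) = (\<integral>\<^sup>+s. ennreal (f s * indicator B s) \<partial>lborel)"
        by (intro nn_integral_cong) (simp add: indicator_def)
      also have "\<dots> = ennreal p"
        unfolding p_def using nn by (intro nn_integral_eq_integral integrable_real_mult_indicator f_int) auto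
      finally show "(\<integral>\<^sup>+s. ennreal (f s) * indicator B s \<partial>lborel) = ennreal p" .
    qed
    have "ennreal \<bar>?X\<bar> \<le> ennreal (c * (e + p))" using * by (rule ennreal_leI)
    also have "\<dots> = ennreal c * (ennreal e + ennreal p)"
      using c0 3(1) p(1) by (simp add: ennreal_mult ennreal_plus)
    finally show ?thesis by (simp only: 3(2) p(2))
  qed
qed

section \<open>Probability of the slabs\<close>

lemma slabs_sets [measurable]: "slabs W \<in> sets borel"
  unfolding slabs_def by measurable

text \<open>Union bound over finitely many slabs. Every row of the inverse of a basis has a nonzero
  entry, which gives the axis for \<open>slab_le_expected_variation\<close>. The constant does not
  depend on the centre \<open>t\<close>, which later is \<open>T x\<close>.\<close>

lemma slabs_le_expected_variation:
  fixes W :: "real^'n::finite^'m::finite"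
  shows "\<exists>K\<ge>0. \<forall>f (M :: 'w measure) h t. joint_pdf f \<longrightarrow> distributed M lborel h (\<lambda>t. ennreal (f t)) \<longrightarrow>
    (\<integral>\<^sup>+s. ennreal (f s) * indicator {s. s - t \<in> slabs W} s \<partial>lborel) \<le> ennreal K * (\<Sum>j\<in>UNIV. expected_variation M f h j)"
proof -
  let ?A = "\<lambda>b. matrix_inv (basis_matrix W b)"
  let ?S = "{b. invertible (basis_matrix W b)}"
  let ?w = "slab_width W"
  have w: "0 < ?w"
    using common_period_pos[of W] unfolding slab_width_def cone_depth_def
    by (intro add_pos_nonneg add_nonneg_pos mult_nonneg_nonneg sum_nonneg) (auto simp: period_def)
  \<comment> \<open>The sum dominates every possible choice of an axis; zero entries add 0, as
    division by 0 yields 0.\<close>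
  define k where "k = (\<Sum>b\<in>UNIV. \<Sum>i\<in>UNIV. \<Sum>j\<in>UNIV. 2 * ?w / \<bar>?A b $ i $ j\<bar>)"
  have k_ge: "2 * ?w / \<bar>?A b $ i $ j\<bar> \<le> k" for b i j
  proof -
    have "2 * ?w / \<bar>?A b $ i $ j\<bar> \<le> (\<Sum>j\<in>UNIV. 2 * ?w / \<bar>?A b $ i $ j\<bar>)"
      using w by (intro member_le_sum) auto
    also have "\<dots> \<le> (\<Sum>i\<in>UNIV. \<Sum>j\<in>UNIV. 2 * ?w / \<bar>?A b $ i $ j\<bar>)"
      using w by (intro member_le_sum[of i UNIV "\<lambda>i. \<Sum>j\<in>UNIV. 2 * ?w / \<bar>?A b $ i $ j\<bar>"]) (auto intro!: sum_nonneg)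
    also have "\<dots> \<le> k"
      unfolding k_def using w
      by (intro member_le_sum[of b UNIV "\<lambda>b. \<Sum>i\<in>UNIV. \<Sum>j\<in>UNIV. 2 * ?w / \<bar>?A b $ i $ j\<bar>"]) (auto intro!: sum_nonneg)
    finally show ?thesis .
  qed
  have k: "0 \<le> k" using w unfolding k_def by (intro sum_nonneg) auto
  have "(\<integral>\<^sup>+s. ennreal (f s) * indicator {s. s - t \<in> slabs W} s \<partial>lborel)
      \<le> ennreal (of_nat (card ?S * CARD('m)) * k) * (\<Sum>j\<in>UNIV. expected_variation M f h j)"
    if f: "joint_pdf f" and h: "distributed M lborel h (\<lambda>t. ennreal (f t))" for f and M :: "'w measure" and h t
  proof -
    let ?V = "\<Sum>j\<in>UNIV. expected_variation M f h j"
    have [measurable]: "f \<in> borel_measurable borel" using f by (auto simp: joint_pdf_def)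
    let ?H = "\<lambda>b i. {s. \<bar>?A b $ i \<bullet> s - ?A b $ i \<bullet> t\<bar> \<le> ?w}"
    have slab: "(\<integral>\<^sup>+s. ennreal (f s) * indicator (?H b i) s \<partial>lborel) \<le> ennreal k * ?V" if "b \<in> ?S" for b i
    proof -
      have "\<exists>j. ?A b $ i $ j \<noteq> 0"
      proof (rule ccontr)
        assume "\<not> ?thesis"
        then have "(?A b ** basis_matrix W b) $ i $ i = 0" by (simp add: matrix_matrix_mult_def)
        with that show False by (simp add: matrix_inv_left mat_def)
      qed
      then obtain j where j: "?A b $ i $ j \<noteq> 0" by blast
      have "(\<integral>\<^sup>+s. ennreal (f s) * indicator (?H b i) s \<partial>lborel)
          \<le> ennreal (2 * ?w / \<bar>?A b $ i $ j\<bar>) * expected_variation M f h j"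
        by (rule slab_le_expected_variation[OF f h j w])
      also have "\<dots> \<le> ennreal k * ?V"
        by (intro mult_mono ennreal_leI k_ge member_le_sum) auto
      finally show ?thesis .
    qed
    have "(\<integral>\<^sup>+s. ennreal (f s) * indicator {s. s - t \<in> slabs W} s \<partial>lborel)
        \<le> (\<integral>\<^sup>+s. (\<Sum>b\<in>?S. \<Sum>i\<in>UNIV. ennreal (f s) * indicator (?H b i) s) \<partial>lborel)"
    proof (rule nn_integral_mono)
      fix s
      show "ennreal (f s) * indicator {s. s - t \<in> slabs W} s \<le> (\<Sum>b\<in>?S. \<Sum>i\<in>UNIV. ennreal (f s) * indicator (?H b i) s)"
      proof (cases "s - t \<in> slabs W")
        case True
        then obtain b i where bi: "b \<in> ?S" "s \<in> ?H b i" by (auto simp: slabs_def inner_diff_right)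
        have "ennreal (f s) * indicator {s. s - t \<in> slabs W} s \<le> ennreal (f s) * indicator (?H b i) s"
          using bi by (auto simp: indicator_def)
        also have "\<dots> \<le> (\<Sum>i\<in>UNIV. ennreal (f s) * indicator (?H b i) s)"
          by (rule member_le_sum) auto
        also have "\<dots> \<le> (\<Sum>b\<in>?S. \<Sum>i\<in>UNIV. ennreal (f s) * indicator (?H b i) s)"
          by (rule member_le_sum[of b ?S "\<lambda>b. \<Sum>i\<in>UNIV. ennreal (f s) * indicator (?H b i) s"]) (use bi in auto)
        finally show ?thesis .
      qed simp
    qed
    also have "\<dots> = (\<Sum>b\<in>?S. \<Sum>i\<in>UNIV. \<integral>\<^sup>+s. ennreal (f s) * indicator (?H b i) s \<partial>lborel)"
    proof -
      have [measurable]: "?H b i \<in> sets borel" for b i by measurable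
      show ?thesis by (subst nn_integral_sum; (intro sum.cong refl nn_integral_sum)?) measurable
    qed
    also have "\<dots> \<le> (\<Sum>b\<in>?S. \<Sum>i\<in>(UNIV::'m set). ennreal k * ?V)"
      by (intro sum_mono slab)
    also have "\<dots> = ennreal (of_nat (card ?S * CARD('m)) * k) * ?V"
      using k by (simp add: ennreal_mult ennreal_of_nat_eq_real_of_nat mult.assoc)
    finally show ?thesis .
  qed
  moreover have "0 \<le> of_nat (card ?S * CARD('m)) * k" using k by simp
  ultimately show ?thesis by blast
qed

section \<open>Joint measurability in the cost vector and the right-hand side\<close>

lemma continuous_on_lam [continuous_intros]: "continuous_on S (\<lambda>q. lam W q b)"
proof -
  have "(\<lambda>q. lam W q b) = (\<lambda>q. transpose (matrix_inv (basis_matrix W b)) *v (\<chi> j. q $ b j))"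
    by (simp add: lam_def)
  then show ?thesis
    by (simp only:) (intro linear_continuous_on_compose[OF _ matrix_vector_mul_linear] continuous_intros)
qed

lemma measurable_lam [measurable]: "(\<lambda>q. lam W q b) \<in> borel_measurable borel"
  by (intro borel_measurable_continuous_onI continuous_intros)

text \<open>There are finitely many sets of bases, and membership of a basis is a finite system of
  linear inequalities in \<open>q\<close>. The index set of the maxima is thus a random variable
  with finitely many values.\<close>

lemma measurable_dual_feasible [measurable]:
  fixes W :: "real^'n::finite^'m::finite"
  shows "dual_feasible W \<in> measurable borel (count_space UNIV)"
proof -
  have [measurable]: "Measurable.pred borel (\<lambda>q. b \<in> dual_feasible W q)" for b
    unfolding dual_feasible_def mem_Collect_eq
    unfolding transpose_matrix_vector[symmetric] matrix_vector_mul_component by measurable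
  show ?thesis
  proof (subst measurable_count_space_eq2, simp, intro conjI ballI)
    fix S :: "('m \<Rightarrow> 'n) set"
    have "dual_feasible W -` {S} \<inter> space borel = {q \<in> space borel. \<forall>b. b \<in> dual_feasible W q \<longleftrightarrow> b \<in> S}" by auto
    also have "\<dots> \<in> sets borel" by measurable
    finally show "dual_feasible W -` {S} \<inter> space borel \<in> sets borel" .
  qed auto
qed

lemma measurable_psi_joint:
  fixes W :: "real^'n::finite^'m::finite"
  assumes [measurable]: "f \<in> borel_measurable N" "g \<in> borel_measurable N"
  shows "(\<lambda>x. psi I W (f x) b (g x)) \<in> borel_measurable N"
proof -
  have "(\<lambda>x. (f x, g x)) \<in> N \<rightarrow>\<^sub>M borel" by measurable
  from measurable_compose[OF this measurable_gomory_value[of I W b]]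
  have [measurable]: "(\<lambda>x. gomory_value I W (f x) b (g x)) \<in> borel_measurable N" by simp
  show ?thesis unfolding psi_def by measurable
qed

lemma measurable_Gam [measurable]:
  fixes W :: "real^'n::finite^'m::finite"
  shows "(\<lambda>q. Gam I W q b) \<in> borel_measurable borel"
proof -
  have "(\<lambda>z. psi I W (fst z) b (snd z)) \<in> borel_measurable (borel \<Otimes>\<^sub>M lborel)"
    by (rule measurable_psi_joint) measurable
  then have [measurable]: "(\<lambda>(q, s). psi I W q b s) \<in> borel_measurable (borel \<Otimes>\<^sub>M lborel)"
    by (simp add: case_prod_unfold)
  show ?thesis
    unfolding Gam_def set_lebesgue_integral_def by measurable
qed

text \<open>On each of the finitely many pieces where the index set is constant, this is a maximum
  over a fixed finite set.\<close>

lemma measurable_Max_dual_feasible: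
  fixes W :: "real^'n::finite^'m::finite"
  assumes [measurable]: "f \<in> borel_measurable N" and F: "\<And>b. (\<lambda>x. F b x) \<in> borel_measurable N"
  shows "(\<lambda>x. Max ((\<lambda>b. F b x) ` dual_feasible W (f x)) :: real) \<in> borel_measurable N"
proof (rule measurable_compose_countable[where g = "\<lambda>x. dual_feasible W (f x)" and f = "\<lambda>S x. Max ((\<lambda>b. F b x) ` S)"])
  show "(\<lambda>x. Max ((\<lambda>b. F b x) ` S)) \<in> borel_measurable N" for S
    by (rule borel_measurable_Max) (auto simp: F)
qed measurable

lemma measurable_v_hat:
  fixes W :: "real^'n::finite^'m::finite"
  assumes [measurable]: "f \<in> borel_measurable N" "g \<in> borel_measurable N"
  shows "(\<lambda>x. v_hat I W (f x) (g x)) \<in> borel_measurable N"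
  unfolding v_hat_def by (rule measurable_Max_dual_feasible) measurable

lemma measurable_v_alpha:
  fixes W :: "real^'n::finite^'m::finite"
  assumes [measurable]: "f \<in> borel_measurable N" "g \<in> borel_measurable N" "t \<in> borel_measurable N"
  shows "(\<lambda>x. v_alpha I W \<alpha> (f x) (g x) (t x)) \<in> borel_measurable N"
proof -
  have [measurable]: "(\<lambda>x. psi I W (f x) b (g x - \<alpha>)) \<in> borel_measurable N" for b
    by (rule measurable_psi_joint) measurable
  show ?thesis unfolding v_alpha_def by (rule measurable_Max_dual_feasible) measurable
qed

lemma measurable_value_real:
  fixes W :: "real^'n::finite^'m::finite"
  assumes [measurable]: "f \<in> borel_measurable N" "g \<in> borel_measurable N"
  shows "(\<lambda>x. real_of_ereal (value_function I W (f x) (g x))) \<in> borel_measurable N"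
proof -
  have "(\<lambda>x. (f x, g x)) \<in> N \<rightarrow>\<^sub>M borel" by measurable
  from measurable_compose[OF this measurable_value_function[of I W]]
  have [measurable]: "(\<lambda>x. value_function I W (f x) (g x)) \<in> borel_measurable N" by simp
  show ?thesis by measurable
qed

text \<open>For a fixed cost vector and a fixed \<open>t\<close>, the errors are everywhere at most
  a multiple of \<open>norm1 q\<close> and average to 0 off the translated slabs. One constant is
  obtained for all \<open>q\<close>, \<open>f\<close>, \<open>h\<close> and
  \<open>t\<close>.\<close>

lemma conditional_error_bound:
  fixes I :: "'n::finite set" and W :: "real^'n^'m::finite"
  assumes W: "\<And>i j. W $ i $ j \<in> \<int>" and feasible: "\<And>s. \<exists>y\<in>Y I. W *v y = s"
  obtains C where "0 < C"
    and "\<And>q f (M :: 'w measure) h t. recourse_finite I W q \<Longrightarrow> joint_pdf f \<Longrightarrow>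
      distributed M lborel h (\<lambda>t. ennreal (f t)) \<Longrightarrow>
      ennreal \<bar>LINT s|lborel. f s * (real_of_ereal (value_function I W q (s - t)) - v_hat I W q (s - t))\<bar>
        \<le> ennreal (C * norm1 q) * (\<Sum>i\<in>UNIV. expected_variation M f h i)"
    and "\<And>q f (M :: 'w measure) h t \<alpha>. recourse_finite I W q \<Longrightarrow> joint_pdf f \<Longrightarrow>
      distributed M lborel h (\<lambda>t. ennreal (f t)) \<Longrightarrow>
      ennreal \<bar>LINT s|lborel. f s * (real_of_ereal (value_function I W q (s - t)) - v_alpha I W \<alpha> q s t)\<bar>
        \<le> ennreal (C * norm1 q) * (\<Sum>i\<in>UNIV. expected_variation M f h i)"
proof -
  let ?P = "common_period W"
  let ?v = "\<lambda>q s. real_of_ereal (value_function I W q s)"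
  obtain C where C: "0 < C" and err: "\<And>q c s. recourse_finite I W q \<Longrightarrow>
      (\<forall>b\<in>dual_feasible W q. 0 \<le> c b \<and> c b \<le> period W b * (\<Sum>j\<in>UNIV. red_cost W q b $ j)) \<Longrightarrow>
      \<bar>?v q s - Max ((\<lambda>b. lam W q b \<bullet> s + c b) ` dual_feasible W q)\<bar> \<le> C * norm1 q"
    using approximation_error_bound[OF W feasible] by blast
  obtain K where K: "0 \<le> K" and slabs: "\<And>f (M :: 'w measure) h t. joint_pdf f \<Longrightarrow> distributed M lborel h (\<lambda>t. ennreal (f t)) \<Longrightarrow>
      (\<integral>\<^sup>+s. ennreal (f s) * indicator {s. s - t \<in> slabs W} s \<partial>lborel) \<le> ennreal K * (\<Sum>j\<in>UNIV. expected_variation M f h j)"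
    using slabs_le_expected_variation[of W] by blast
  \<comment> \<open>In the constant, the uniform error bound \<open>C\<close> multiplies the cost
    \<open>?P\<close> of averaging the density and the factor \<open>K\<close> from the probability
    of the slabs.\<close>
  have main: "ennreal \<bar>LINT s|lborel. f s * g s\<bar> \<le> ennreal (C * (?P + K) * norm1 q) * (\<Sum>i\<in>UNIV. expected_variation M f h i)"
    if f: "joint_pdf f" and h: "distributed M lborel h (\<lambda>t. ennreal (f t))"
      and g: "g \<in> borel_measurable borel" "\<And>s. \<bar>g s\<bar> \<le> C * norm1 q"
      and mean: "\<And>s. s - t \<notin> slabs W \<Longrightarrow> (LINT u|lborel. indicator (cbox 0 (\<chi> i. ?P)) u * g (s - u)) = 0"
    for f g and M :: "'w measure" and h t and q :: "real^'n"
  proof -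
    let ?V = "\<Sum>i\<in>UNIV. expected_variation M f h i"
    have "ennreal \<bar>LINT s|lborel. f s * g s\<bar> \<le> ennreal (C * norm1 q) *
        ((\<Sum>i\<in>UNIV. ennreal ?P * expected_variation M f h i) + (\<integral>\<^sup>+s. ennreal (f s) * indicator {s. s - t \<in> slabs W} s \<partial>lborel))"
      by (rule density_mean_error[OF f h g common_period_pos _ mean]) (auto simp: measurable_ident)
    also have "\<dots> \<le> ennreal (C * norm1 q) * (ennreal ?P * ?V + ennreal K * ?V)"
      by (intro mult_left_mono add_mono slabs f h) (auto simp: sum_distrib_left)
    also have "\<dots> = ennreal (C * (?P + K) * norm1 q) * ?V"
      using K C common_period_pos[of W]
      by (simp add: distrib_right[symmetric] ennreal_plus[symmetric] ennreal_mult'[symmetric] mult.assoc[symmetric] less_imp_le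
          del: ennreal_plus) (simp add: ac_simps)
    finally show ?thesis .
  qed
  show ?thesis
  proof (rule that[of "C * (?P + K)"])
    show "0 < C * (?P + K)" using C K common_period_pos[of W] by (intro mult_pos_pos) auto
  next
    fix q :: "real^'n" and f :: "real^'m \<Rightarrow> real" and M :: "'w measure" and h t
    assume fin: "recourse_finite I W q" and f: "joint_pdf f" and h: "distributed M lborel h (\<lambda>t. ennreal (f t))"
    show "ennreal \<bar>LINT s|lborel. f s * (?v q (s - t) - v_hat I W q (s - t))\<bar>
        \<le> ennreal (C * (?P + K) * norm1 q) * (\<Sum>i\<in>UNIV. expected_variation M f h i)"
    proof (rule main[OF f h])
      show "(\<lambda>s. ?v q (s - t) - v_hat I W q (s - t)) \<in> borel_measurable borel"
        by (intro borel_measurable_diff measurable_value_real measurable_v_hat) measurable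
      show "\<bar>?v q (s - t) - v_hat I W q (s - t)\<bar> \<le> C * norm1 q" for s
        unfolding v_hat_def by (rule err[OF fin]) (auto intro: Gam_bounds[OF W fin])
      show "(LINT u|lborel. indicator (cbox 0 (\<chi> i. ?P)) u * (?v q (s - u - t) - v_hat I W q (s - u - t))) = 0"
        if "s - t \<notin> slabs W" for s
        using v_hat_mean_error[OF W fin that] by (simp add: algebra_simps)
    qed
  next
    fix q :: "real^'n" and f :: "real^'m \<Rightarrow> real" and M :: "'w measure" and h t \<alpha>
    assume fin: "recourse_finite I W q" and f: "joint_pdf f" and h: "distributed M lborel h (\<lambda>t. ennreal (f t))"
    show "ennreal \<bar>LINT s|lborel. f s * (?v q (s - t) - v_alpha I W \<alpha> q s t)\<bar>
        \<le> ennreal (C * (?P + K) * norm1 q) * (\<Sum>i\<in>UNIV. expected_variation M f h i)"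
    proof (rule main[OF f h])
      show "(\<lambda>s. ?v q (s - t) - v_alpha I W \<alpha> q s t) \<in> borel_measurable borel"
        by (intro borel_measurable_diff measurable_value_real measurable_v_alpha) measurable
      show "\<bar>?v q (s - t) - v_alpha I W \<alpha> q s t\<bar> \<le> C * norm1 q" for s
        unfolding v_alpha_def by (rule err[OF fin]) (auto intro: psi_bounds'[OF W fin])
      show "(LINT u|lborel. indicator (cbox 0 (\<chi> i. ?P)) u * (?v q (s - u - t) - v_alpha I W \<alpha> q (s - u) t)) = 0"
        if "s - t \<notin> slabs W" for s
        using v_alpha_mean_error[OF W fin that, of \<alpha> t] by (simp add: algebra_simps)
    qed
  qed
qed

section \<open>Integrating out the right-hand side by independence\<close>

lemma independent_distr_pair:
  fixes X :: "'w \<Rightarrow> 'x::second_countable_topology" and h :: "'w \<Rightarrow> 'y::second_countable_topology"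
  assumes M: "prob_space M" and ind: "independent M X h"
  shows "distr M borel X \<Otimes>\<^sub>M distr M borel h = distr M (borel \<Otimes>\<^sub>M borel) (\<lambda>\<omega>. (X \<omega>, h \<omega>))"
proof -
  interpret prob_space M by (rule M)
  have [measurable]: "X \<in> borel_measurable M" "h \<in> borel_measurable M"
    and indep: "indep_set {X -` A \<inter> space M | A. A \<in> sets borel} {h -` A \<inter> space M | A. A \<in> sets borel}"
    using ind by (auto simp: independent_def)
  interpret X: prob_space "distr M borel X" by (rule prob_space_distr) simp
  interpret h: prob_space "distr M borel h" by (rule prob_space_distr) simp
  show ?thesis
  proof (rule pair_measure_eqI)
    fix A B assume "A \<in> sets (distr M borel X)" "B \<in> sets (distr M borel h)"
    then have [measurable]: "A \<in> sets borel" "B \<in> sets borel" by auto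
    have "prob ((X -` A \<inter> space M) \<inter> (h -` B \<inter> space M)) = prob (X -` A \<inter> space M) * prob (h -` B \<inter> space M)"
      by (rule indep_setD[OF indep]) auto
    moreover have "(\<lambda>\<omega>. (X \<omega>, h \<omega>)) -` (A \<times> B) \<inter> space M = (X -` A \<inter> space M) \<inter> (h -` B \<inter> space M)" by auto
    ultimately show "emeasure (distr M borel X) A * emeasure (distr M borel h) B
        = emeasure (distr M (borel \<Otimes>\<^sub>M borel) (\<lambda>\<omega>. (X \<omega>, h \<omega>))) (A \<times> B)"
      by (simp add: emeasure_distr emeasure_eq_measure ennreal_mult)
  qed (auto intro: X.sigma_finite_measure_axioms h.sigma_finite_measure_axioms)
qed

text \<open>The joint law is a product, so Fubini allows integrating out \<open>h\<close> for each
  value of \<open>X\<close>; the bound for fixed \<open>X\<close> is then integrated.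
  \<open>V\<close> may be infinite.\<close>

lemma independent_expectation_bound:
  fixes X :: "'w \<Rightarrow> 'x::second_countable_topology" and h :: "'w \<Rightarrow> 'y::euclidean_space"
    and G :: "'x \<Rightarrow> 'y \<Rightarrow> real"
  assumes M: "prob_space M" and ind: "independent M X h"
    and h: "distributed M lborel h (\<lambda>t. ennreal (f t))"
    and [measurable]: "f \<in> borel_measurable borel" and nn: "\<And>t. 0 \<le> f t"
    and G [measurable]: "(\<lambda>z. G (fst z) (snd z)) \<in> borel_measurable (borel \<Otimes>\<^sub>M borel)"
    and int: "integrable M (\<lambda>\<omega>. G (X \<omega>) (h \<omega>))"
    and c: "integrable M c" "\<And>\<omega>. 0 \<le> c \<omega>"
    and bound: "\<And>\<omega>. \<omega> \<in> space M \<Longrightarrow> ennreal \<bar>LINT s|lborel. f s * G (X \<omega>) s\<bar> \<le> ennreal (c \<omega>) * V"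
  shows "ennreal \<bar>LINT \<omega>|M. G (X \<omega>) (h \<omega>)\<bar> \<le> ennreal (LINT \<omega>|M. c \<omega>) * V"
proof -
  interpret prob_space M by (rule M)
  have [measurable]: "X \<in> borel_measurable M" "h \<in> borel_measurable M" using ind by (auto simp: independent_def)
  interpret X: prob_space "distr M borel X" by (rule prob_space_distr) simp
  interpret h: prob_space "distr M borel h" by (rule prob_space_distr) simp
  interpret pair: pair_sigma_finite "distr M borel X" "distr M borel h" ..
  note pair = independent_distr_pair[OF M ind]
  have law: "distr M borel h = density lborel (\<lambda>t. ennreal (f t))"
  proof -
    have "distr M borel h = distr M lborel h" by (rule distr_cong) auto
    then show ?thesis using h by (simp add: distributed_def)
  qed
  have int': "integrable (distr M borel X \<Otimes>\<^sub>M distr M borel h) (\<lambda>z. G (fst z) (snd z))"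
    unfolding pair by (subst integrable_distr_eq) (auto simp: int)
  let ?\<Phi> = "\<lambda>x. LINT s|distr M borel h. G x s"
  have \<Phi>_int: "integrable (distr M borel X) ?\<Phi>"
    using pair.integrable_fst[of "\<lambda>x s. G x s"] int' by (simp add: case_prod_unfold)
  then have [measurable]: "?\<Phi> \<in> borel_measurable borel" by (auto dest: borel_measurable_integrable)
  have \<Phi>_int_M: "integrable M (\<lambda>\<omega>. ?\<Phi> (X \<omega>))"
    using \<Phi>_int by (subst (asm) integrable_distr_eq) auto
  have "(LINT \<omega>|M. G (X \<omega>) (h \<omega>)) = (LINT z|(distr M borel X \<Otimes>\<^sub>M distr M borel h). G (fst z) (snd z))"
    unfolding pair by (subst integral_distr) auto
  also have "\<dots> = (LINT x|distr M borel X. ?\<Phi> x)"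
    using pair.integral_fst[of "\<lambda>x s. G x s"] int' by (simp add: case_prod_unfold)
  also have "\<dots> = (LINT \<omega>|M. ?\<Phi> (X \<omega>))"
    by (rule integral_distr) auto
  finally have eq: "(LINT \<omega>|M. G (X \<omega>) (h \<omega>)) = (LINT \<omega>|M. ?\<Phi> (X \<omega>))" .
  have \<Phi>_eq: "?\<Phi> x = (LINT s|lborel. f s * G x s)" for x
  proof -
    have "(\<lambda>s. (x, s)) \<in> borel \<rightarrow>\<^sub>M borel \<Otimes>\<^sub>M borel" by measurable
    from measurable_compose[OF this G] have "G x \<in> borel_measurable borel" by simp
    then show ?thesis unfolding law by (subst integral_density) (auto simp: nn)
  qed
  have "ennreal \<bar>LINT \<omega>|M. G (X \<omega>) (h \<omega>)\<bar> \<le> (\<integral>\<^sup>+\<omega>. ennreal \<bar>?\<Phi> (X \<omega>)\<bar> \<partial>M)"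
    unfolding eq using integral_norm_bound_ennreal[OF \<Phi>_int_M] by simp
  also have "\<dots> \<le> (\<integral>\<^sup>+\<omega>. ennreal (c \<omega>) * V \<partial>M)"
    by (rule nn_integral_mono) (simp add: \<Phi>_eq bound)
  also have "\<dots> = (\<integral>\<^sup>+\<omega>. ennreal (c \<omega>) \<partial>M) * V"
    using c by (intro nn_integral_multc) auto
  also have "(\<integral>\<^sup>+\<omega>. ennreal (c \<omega>) \<partial>M) = ennreal (LINT \<omega>|M. c \<omega>)"
    using c by (intro nn_integral_eq_integral) auto
  finally show ?thesis .
qed

theorem theorem2:
  fixes M :: "'w measure"
    and I :: "'n::finite set"
    and W :: "real^'n^'m::finite"
    and \<Xi> :: "(real^'n) set"
    and q :: "'w \<Rightarrow> real^'n"
    and T :: "'w \<Rightarrow> real^'k::finite^'m"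
    and \<alpha> :: "real^'m"
  assumes "prob_space M"
    and "\<forall>i j. W $ i $ j \<in> \<int>"
    and "q \<in> borel_measurable M" and "T \<in> borel_measurable M"
    and "\<forall>\<omega>\<in>space M. q \<omega> \<in> \<Xi>"
    and "\<forall>q'\<in>\<Xi>. \<forall>s. -\<infinity> < value_function I W q' s \<and> value_function I W q' s < \<infinity>"
    and "integrable M (\<lambda>\<omega>. norm1 (q \<omega>))"
  shows "\<exists>C1>0. \<exists>C2>0. \<forall>f\<in>\<H>. \<forall>h.
    distributed M lborel h (\<lambda>t. ennreal (f t)) \<longrightarrow>
    independent M (\<lambda>\<omega>. (q \<omega>, T \<omega>)) h \<longrightarrow>
    integrable M (\<lambda>\<omega>. norm1 (h \<omega>)) \<longrightarrow>
    finite_expectations M I W \<alpha> q T h \<longrightarrow>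
    sup_dist (Q M I W q T h) (Q_hat M I W q T h)
      \<le> ennreal (C1 * (LINT \<omega>|M. norm1 (q \<omega>))) * (\<Sum>i\<in>UNIV. expected_variation M f h i) \<and>
    sup_dist (Q M I W q T h) (Q_alpha M I W \<alpha> q T h)
      \<le> ennreal (C2 * (LINT \<omega>|M. norm1 (q \<omega>))) * (\<Sum>i\<in>UNIV. expected_variation M f h i)"
proof -
  have W: "W $ i $ j \<in> \<int>" for i j using assms(2) by blast
  have fin: "recourse_finite I W (q \<omega>)" if "\<omega> \<in> space M" for \<omega>
    using assms(5,6) that by (auto simp: recourse_finite_def)
  \<comment> \<open>One cost vector with finite values makes every right-hand side feasible.
    Feasibility does not involve \<open>q\<close>, so the constant can be chosen for
    \<open>W\<close> and \<open>I\<close> alone.\<close>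
  obtain \<omega>0 where "\<omega>0 \<in> space M" using prob_space.not_empty[OF assms(1)] by blast
  note feasible = recourse_finite_feasible[OF fin[OF this]]
  let ?v = "\<lambda>q s. real_of_ereal (value_function I W q s)"
  show ?thesis
  proof (rule conditional_error_bound[OF W feasible])
    fix C :: real
    assume C: "0 < C"
      and bound_hat: "\<And>q f (M :: 'w measure) h t. recourse_finite I W q \<Longrightarrow> joint_pdf f \<Longrightarrow>
        distributed M lborel h (\<lambda>t. ennreal (f t)) \<Longrightarrow>
        ennreal \<bar>LINT s|lborel. f s * (?v q (s - t) - v_hat I W q (s - t))\<bar>
          \<le> ennreal (C * norm1 q) * (\<Sum>i\<in>UNIV. expected_variation M f h i)"
      and bound_alpha: "\<And>q f (M :: 'w measure) h t \<alpha>. recourse_finite I W q \<Longrightarrow> joint_pdf f \<Longrightarrow>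
        distributed M lborel h (\<lambda>t. ennreal (f t)) \<Longrightarrow>
        ennreal \<bar>LINT s|lborel. f s * (?v q (s - t) - v_alpha I W \<alpha> q s t)\<bar>
          \<le> ennreal (C * norm1 q) * (\<Sum>i\<in>UNIV. expected_variation M f h i)"
    show ?thesis
    \<comment> \<open>The same \<open>C\<close> serves as both constants.\<close>
    proof (intro exI[of _ C] conjI ballI allI impI C)
      fix f and h :: "'w \<Rightarrow> real^'m"
      assume "f \<in> \<H>" and h: "distributed M lborel h (\<lambda>t. ennreal (f t))"
        and ind: "independent M (\<lambda>\<omega>. (q \<omega>, T \<omega>)) h" and finE: "finite_expectations M I W \<alpha> q T h"
      then have f: "joint_pdf f" by (simp add: \<H>_def)
      then have f_meas: "f \<in> borel_measurable borel" and f_nn: "\<And>t. 0 \<le> f t" by (auto simp: joint_pdf_def)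
      let ?V = "\<Sum>i\<in>UNIV. expected_variation M f h i"
      have int: "integrable M (\<lambda>\<omega>. ?v (q \<omega>) (h \<omega> - T \<omega> *v x))"
        "integrable M (\<lambda>\<omega>. v_hat I W (q \<omega>) (h \<omega> - T \<omega> *v x))"
        "integrable M (\<lambda>\<omega>. v_alpha I W \<alpha> (q \<omega>) (h \<omega>) (T \<omega> *v x))" for x
        using finE by (auto simp: finite_expectations_def)
      have c: "integrable M (\<lambda>\<omega>. C * norm1 (q \<omega>))" using assms(7) by simp
      have c_nn: "0 \<le> C * norm1 (q \<omega>)" for \<omega> using C by simp
      have fst_meas: "(\<lambda>z :: (real^'n) \<times> (real^'k^'m). fst z) \<in> borel_measurable borel"
        by (intro borel_measurable_continuous_onI continuous_intros)
      have mult_meas: "(\<lambda>z :: (real^'n) \<times> (real^'k^'m). snd z *v x) \<in> borel_measurable borel" for x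
        unfolding matrix_vector_mult_def by (intro borel_measurable_continuous_onI continuous_intros)
      have [measurable]: "(\<lambda>z :: ((real^'n) \<times> (real^'k^'m)) \<times> (real^'m). fst (fst z))
          \<in> borel_measurable (borel \<Otimes>\<^sub>M borel)"
        by (rule measurable_compose[OF measurable_fst fst_meas])
      have [measurable]: "(\<lambda>z :: ((real^'n) \<times> (real^'k^'m)) \<times> (real^'m). snd (fst z) *v x)
          \<in> borel_measurable (borel \<Otimes>\<^sub>M borel)" for x
        by (rule measurable_compose[OF measurable_fst mult_meas])
      show "sup_dist (Q M I W q T h) (Q_hat M I W q T h) \<le> ennreal (C * (LINT \<omega>|M. norm1 (q \<omega>))) * ?V"
        unfolding sup_dist_def
      proof (rule SUP_least)
        fix x :: "real^'k"
        let ?G = "\<lambda>z s. ?v (fst z) (s - snd z *v x) - v_hat I W (fst z) (s - snd z *v x)"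
        have "ennreal \<bar>LINT \<omega>|M. ?G (q \<omega>, T \<omega>) (h \<omega>)\<bar> \<le> ennreal (LINT \<omega>|M. C * norm1 (q \<omega>)) * ?V"
        proof (rule independent_expectation_bound[OF assms(1) ind h f_meas f_nn _ _ c c_nn])
          show "(\<lambda>z. ?G (fst z) (snd z)) \<in> borel_measurable (borel \<Otimes>\<^sub>M borel)"
            by (intro borel_measurable_diff measurable_value_real measurable_v_hat) measurable
          show "integrable M (\<lambda>\<omega>. ?G (q \<omega>, T \<omega>) (h \<omega>))" using int(1,2)[of x] by simp
          show "ennreal \<bar>LINT s|lborel. f s * ?G (q \<omega>, T \<omega>) s\<bar> \<le> ennreal (C * norm1 (q \<omega>)) * ?V"
            if "\<omega> \<in> space M" for \<omega>
            using bound_hat[OF fin[OF that] f h, of "T \<omega> *v x"] by simp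
        qed
        then show "ennreal \<bar>Q M I W q T h x - Q_hat M I W q T h x\<bar> \<le> ennreal (C * (LINT \<omega>|M. norm1 (q \<omega>))) * ?V"
          using int(1,2)[of x] by (simp add: Q_def Q_hat_def)
      qed
      show "sup_dist (Q M I W q T h) (Q_alpha M I W \<alpha> q T h) \<le> ennreal (C * (LINT \<omega>|M. norm1 (q \<omega>))) * ?V"
        unfolding sup_dist_def
      proof (rule SUP_least)
        fix x :: "real^'k"
        let ?G = "\<lambda>z s. ?v (fst z) (s - snd z *v x) - v_alpha I W \<alpha> (fst z) s (snd z *v x)"
        have "ennreal \<bar>LINT \<omega>|M. ?G (q \<omega>, T \<omega>) (h \<omega>)\<bar> \<le> ennreal (LINT \<omega>|M. C * norm1 (q \<omega>)) * ?V"
        proof (rule independent_expectation_bound[OF assms(1) ind h f_meas f_nn _ _ c c_nn])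
          show "(\<lambda>z. ?G (fst z) (snd z)) \<in> borel_measurable (borel \<Otimes>\<^sub>M borel)"
            by (intro borel_measurable_diff measurable_value_real measurable_v_alpha) measurable
          show "integrable M (\<lambda>\<omega>. ?G (q \<omega>, T \<omega>) (h \<omega>))" using int(1,3)[of x] by simp
          show "ennreal \<bar>LINT s|lborel. f s * ?G (q \<omega>, T \<omega>) s\<bar> \<le> ennreal (C * norm1 (q \<omega>)) * ?V"
            if "\<omega> \<in> space M" for \<omega>
            using bound_alpha[OF fin[OF that] f h, of "T \<omega> *v x"] by simp
        qed
        then show "ennreal \<bar>Q M I W q T h x - Q_alpha M I W \<alpha> q T h x\<bar> \<le> ennreal (C * (LINT \<omega>|M. norm1 (q \<omega>))) * ?V"
          using int(1,3)[of x] by (simp add: Q_def Q_alpha_def)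
      qed
    qed
  qed
qed

end
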